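(* Fix $w\in S_n$ and $k\in[n]$, and let $\sigma\in S_{n-1}$ be the pattern whose Rothe diagram $D(\sigma)$ is obtained from $D(w)$ by removing row $k$ and column $w_k$ (and reindexing the remaining rows and columns by $[n-1]$ preserving order). Then $$\mathfrak{S}_w(x_1,\dots,x_n)=M(x_1,\dots,x_n)\,\mathfrak{S}_\sigma(x_1,\dots,\widehat{x_k},\dots,x_n)+F(x_1,\dots,x_n),$$ where $F\in\mathbb{Z}_{\ge 0}[x_1,\dots,x_n]$ and $$M(x_1,\dots,x_n)=\Big(\prod_{(k,i)\in D(w)}x_k\Big)\Big(\prod_{(i,w_k)\in D(w)}x_i\Big).$$
   Context: For $w\in S_n$, the Schubert polynomial $\mathfrak{S}_w$ is defined by $\mathfrak{S}_{w_0}=x_1^{n-1}x_2^{n-2}\cdots x_{n-1}$ for the longest permutation $w_0=n\,(n-1)\cdots 1$, and $\mathfrak{S}_w=\partial_i\mathfrak{S}_{ws_i}$ whenever $w_i<w_{i+1}$, where $\partial_i f=(f-s_if)/(x_i-x_{i+1})$ and $s_i$ swaps $x_i,x_{i+1}$. The Rothe diagram of $w$ is $D(w)=\{(i,j)\in[n]\times[n]: i<w^{-1}(j),\ j<w_i\}$, where $(i,j)$ denotes the box in row $i$, column $j$. The permutation $\sigma$ is the standardization of $w_1\cdots\widehat{w_k}\cdots w_n$. The notation $\mathfrak{S}_\sigma(x_1,\dots,\widehat{x_k},\dots,x_n)$ means $\mathfrak{S}_\sigma$ evaluated at the $n-1$ variables $x_1,\dots,x_{k-1},x_{k+1},\dots,x_n$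 in this order. *)

theory Defs
  imports Main "HOL-Library.Poly_Mapping" "HOL-Combinatorics.Permutations"
begin

text \<open>Multivariate integer polynomials in variables x_1, x_2, ... (indexed by nat):
  finitely supported maps from monomials (exponent vectors) to integer coefficients.\<close>
type_synonym mpoly = "(nat \<Rightarrow>\<^sub>0 nat) \<Rightarrow>\<^sub>0 int"

definition Var :: "nat \<Rightarrow> mpoly" where
  "Var i = Poly_Mapping.single (Poly_Mapping.single i 1) 1"

definition psubst :: "(nat \<Rightarrow> mpoly) \<Rightarrow> mpoly \<Rightarrow> mpoly" where
  "psubst s p = (\<Sum>m\<in>Poly_Mapping.keys p.
      Poly_Mapping.single 0 (Poly_Mapping.lookup p m) *
      (\<Prod>j\<in>Poly_Mapping.keys m. s j ^ Poly_Mapping.lookup m j))"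

definition swapvars :: "nat \<Rightarrow> mpoly \<Rightarrow> mpoly" where
  "swapvars i f = psubst (\<lambda>j. Var (Transposition.transpose i (Suc i) j)) f"

definition divdiff :: "nat \<Rightarrow> mpoly \<Rightarrow> mpoly" where
  "divdiff i f = (THE q. (Var i - Var (Suc i)) * q = f - swapvars i f)"

text \<open>Permutations of [n] = {1..n} are functions nat => nat permuting {1..n}.\<close>
definition ninv :: "nat \<Rightarrow> (nat \<Rightarrow> nat) \<Rightarrow> nat" where
  "ninv n w = card {(i, j). 1 \<le> i \<and> i < j \<and> j \<le> n \<and> w i > w j}"

definition has_ascent :: "nat \<Rightarrow> (nat \<Rightarrow> nat) \<Rightarrow> bool" where
  "has_ascent n w \<longleftrightarrow> (\<exists>i. 1 \<le> i \<and> i < n \<and> w i < w (Suc i))"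

definition first_ascent :: "nat \<Rightarrow> (nat \<Rightarrow> nat) \<Rightarrow> nat" where
  "first_ascent n w = (LEAST i. 1 \<le> i \<and> i < n \<and> w i < w (Suc i))"

text \<open>x_1^{n-1} x_2^{n-2} ... x_{n-1}, the Schubert polynomial of w_0.\<close>
definition stair :: "nat \<Rightarrow> mpoly" where
  "stair n = (\<Prod>j\<in>{1..<n}. Var j ^ (n - j))"

text \<open>Recursion S_w = \<partial>_i S_{w s_i} for an ascent i (we choose the first one), with
  fuel = number of remaining steps to w_0 (the length difference).\<close>
primrec schub_aux :: "nat \<Rightarrow> nat \<Rightarrow> (nat \<Rightarrow> nat) \<Rightarrow> mpoly" where
  "schub_aux 0 n w = stair n"
| "schub_aux (Suc m) n w =
     (if has_ascent n w then
        (let i = first_ascent n w in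
           divdiff i (schub_aux m n (w \<circ> Transposition.transpose i (Suc i))))
      else stair n)"

definition schubert :: "nat \<Rightarrow> (nat \<Rightarrow> nat) \<Rightarrow> mpoly" where
  "schubert n w = schub_aux (n * (n - 1) div 2 - ninv n w) n w"

definition rothe :: "nat \<Rightarrow> (nat \<Rightarrow> nat) \<Rightarrow> (nat \<times> nat) set" where
  "rothe n w = {(i, j). i \<in> {1..n} \<and> j \<in> {1..n} \<and> i < inv w j \<and> j < w i}"

definition skip :: "nat \<Rightarrow> nat \<Rightarrow> nat" where
  "skip k i = (if i < k then i else Suc i)"

definition pattern_del :: "nat \<Rightarrow> (nat \<Rightarrow> nat) \<Rightarrow> nat \<Rightarrow> nat \<Rightarrow> nat" where
  "pattern_del n w k i =
     (if 1 \<le> i \<and> i \<le> n - 1 then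
        (let v = w (skip k i) in if v < w k then v else v - 1)
      else i)"

end

theory Submission
  imports Defs Complex_Main "HOL-Library.FuncSet"
begin

text \<open>By a theorem of Kraskiewicz and Pragacz, the coefficient of \<open>x\<^sup>\<alpha>\<close> in a Schubert polynomial
  is the dimension of a weight space of the flagged Weyl module of the Rothe diagram, spanned by
  products of minors (one for each column of the diagram) of a generic upper triangular matrix.
  Setting the off-diagonal entries in row and column \<open>k\<close> to \<open>0\<close> turns suitable products of minors
  for \<open>w\<close> into those for \<open>\<sigma>\<close>, so independent families for \<open>\<sigma>\<close> lift to independent families
  for \<open>w\<close>, and their weights differ by the exponent of \<open>M\<close>; this argument is due to Fink,
  Meszaros and St. Dizier.

  The dimensions are computed as follows. Expanding minors along the first row bounds them from
  below by a recursion which Schubert polynomials satisfy with respect to their first variable, by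
  their factorisation in the nilCoxeter algebra. Conversely, moving boxes between columns embeds
  the direct sum of the modules of the permutations in the Pieri expansion of
  \<open>(1 + x\<^sub>1) \<cdots> (1 + x\<^sub>k) \<SS>\<^sub>u\<close> into the tensor product of an exterior algebra with the module
  of \<open>u\<close>. By induction this bounds the sum of the dimensions by the sum of the
  coefficients, which forces equality for each of the permutations.\<close>

section \<open>Ranks of families of functions\<close>

text \<open>The required inequality between coefficients for \<open>\<sigma>\<close> and
  \<open>w\<close> is not visible in divided differences, whereas a rank is bounded below as soon as
  independent vectors are exhibited; this is the reason for passing to dimensions. No modules are
  built: a weight space is represented by a finite family of functions of a matrix \<open>y\<close>,
  and only independence and spanning are used. Exhibiting independent vectors never gives an upper
  bound for the dimension that belongs to one permutation. An embedding of a direct sum bounds only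
  a sum of dimensions, so it is combined with an expansion that is exact for coefficients; as every
  summand is already bounded below by its coefficient, equality of the sums is equality of the
  summands. For this each permutation of \<open>{1..k + 1}\<close> has to occur in some Pieri
  expansion, and it does in that of the pattern without its last entry
  (\<open>lift_pattern_del\<close>). Both independence proofs are triangular for the colexicographic
  order of subsets, encoded by binary numbers as in \<open>colex_witness\<close>.\<close>

definition indep :: "'i set \<Rightarrow> ('i \<Rightarrow> 't \<Rightarrow> real) \<Rightarrow> bool" where
  "indep I x \<longleftrightarrow> (\<forall>a. (\<forall>t. (\<Sum>i\<in>I. a i * x i t) = 0) \<longrightarrow> (\<forall>i\<in>I. a i = 0))"

definition rnk :: "'i set \<Rightarrow> ('i \<Rightarrow> 't \<Rightarrow> real) \<Rightarrow> nat" where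
  "rnk I x = Max {card J |J. J \<subseteq> I \<and> indep J x}"

lemma indepD: "indep I x \<Longrightarrow> (\<And>t. (\<Sum>i\<in>I. a i * x i t) = 0) \<Longrightarrow> i \<in> I \<Longrightarrow> a i = 0"
  unfolding indep_def by blast

lemma indep_empty: "indep {} x"
  by (simp add: indep_def)

lemma not_indepE:
  assumes "\<not> indep I x"
  obtains a i where "\<And>t. (\<Sum>i\<in>I. a i * x i t) = 0" "i \<in> I" "a i \<noteq> 0"
  using assms by (auto simp: indep_def)

text \<open>Gaussian elimination: a nonzero coefficient in the equation \<open>k\<close> serves as a
  pivot that removes one equation and one unknown.\<close>

lemma underdetermined_system:
  fixes c :: "'j \<Rightarrow> 'k \<Rightarrow> real"
  assumes "finite K" "finite J" "card K < card J"
  shows "\<exists>a. (\<exists>j\<in>J. a j \<noteq> 0) \<and> (\<forall>k\<in>K. (\<Sum>j\<in>J. a j * c j k) = 0)"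
  using assms
proof (induction K arbitrary: J c rule: finite_induct)
  case empty
  then obtain j where "j \<in> J" by fastforce
  then show ?case by (intro exI[of _ "\<lambda>_. 1"]) auto
next
  case (insert k K)
  show ?case
  proof (cases "\<forall>j\<in>J. c j k = 0")
    case True
    obtain a where "\<exists>j\<in>J. a j \<noteq> 0" "\<forall>k\<in>K. (\<Sum>j\<in>J. a j * c j k) = 0"
      using insert.IH[of J c] insert.prems insert.hyps by auto
    with True show ?thesis by (intro exI[of _ a]) auto
  next
    case False
    then obtain j0 where j0: "j0 \<in> J" "c j0 k \<noteq> 0" by blast
    define J' where "J' = J - {j0}"
    define c' where "c' j l = c j l - (c j k / c j0 k) * c j0 l" for j l
    have "card K < card J'" unfolding J'_def using insert j0 by simp
    then obtain a where a: "\<exists>j\<in>J'. a j \<noteq> 0" "\<forall>l\<in>K. (\<Sum>j\<in>J'. a j * c' j l) = 0"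
      using insert.IH[of J' c'] insert.prems unfolding J'_def by auto
    \<comment> \<open>The value of the eliminated unknown \<open>j0\<close> that makes the equation
      \<open>k\<close> hold.\<close>
    define r where "r = - (\<Sum>j\<in>J'. a j * c j k) / c j0 k"
    define b where "b = a(j0 := r)"
    have split: "(\<Sum>j\<in>J. b j * c j l) = r * c j0 l + (\<Sum>j\<in>J'. a j * c j l)" for l
    proof -
      have "(\<Sum>j\<in>J. b j * c j l) = b j0 * c j0 l + (\<Sum>j\<in>J'. b j * c j l)"
        unfolding J'_def using j0 insert.prems(1) by (simp add: sum.remove)
      moreover have "(\<Sum>j\<in>J'. b j * c j l) = (\<Sum>j\<in>J'. a j * c j l)"
        by (intro sum.cong) (auto simp: b_def J'_def)
      ultimately show ?thesis by (simp add: b_def)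
    qed
    have "(\<Sum>j\<in>J. b j * c j l) = 0" if "l \<in> insert k K" for l
    proof (cases "l = k")
      case True
      then show ?thesis unfolding split r_def using j0 by simp
    next
      case False
      then have "(\<Sum>j\<in>J'. a j * c' j l) = 0" using a that by auto
      then have "(\<Sum>j\<in>J'. a j * c j l) - (\<Sum>j\<in>J'. a j * c j k) / c j0 k * c j0 l = 0"
        unfolding c'_def
        by (simp add: right_diff_distrib sum_subtractf sum_distrib_right sum_divide_distrib mult.assoc)
      then show ?thesis unfolding split r_def by (simp add: algebra_simps)
    qed
    moreover have "\<exists>j\<in>J. b j \<noteq> 0" using a(1) unfolding b_def J'_def by auto
    ultimately show ?thesis by blast
  qed
qed

text \<open>Expanding each \<open>x j\<close> in the \<open>z k\<close> turns a relation among the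
  \<open>x j\<close> into \<open>card K\<close> equations for \<open>card J\<close> unknowns, which
  have a nontrivial solution if \<open>card K < card J\<close>.\<close>

lemma indep_card_le_span:
  assumes "finite J" "finite K" "indep J x"
    and span: "\<And>j. j \<in> J \<Longrightarrow> \<exists>c. \<forall>t. x j t = (\<Sum>k\<in>K. c k * z k t)"
  shows "card J \<le> card K"
proof (rule ccontr)
  assume "\<not> card J \<le> card K"
  from span have "\<forall>j\<in>J. \<exists>c. \<forall>t. x j t = (\<Sum>k\<in>K. c k * z k t)" by blast
  then obtain c where c: "\<And>j t. j \<in> J \<Longrightarrow> x j t = (\<Sum>k\<in>K. c j k * z k t)"
    by metis
  obtain a where a: "\<exists>j\<in>J. a j \<noteq> 0" "\<forall>k\<in>K. (\<Sum>j\<in>J. a j * c j k) = 0"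
    using underdetermined_system[of K J c] assms \<open>\<not> _\<close> by auto
  have "(\<Sum>j\<in>J. a j * x j t) = 0" for t
  proof -
    have "(\<Sum>j\<in>J. a j * x j t) = (\<Sum>j\<in>J. \<Sum>k\<in>K. a j * c j k * z k t)"
      by (intro sum.cong) (auto simp: c sum_distrib_left mult.assoc)
    also have "\<dots> = (\<Sum>k\<in>K. (\<Sum>j\<in>J. a j * c j k) * z k t)"
      by (subst sum.swap) (simp add: sum_distrib_right)
    finally show ?thesis using a(2) by simp
  qed
  then show False using a(1) indepD[OF assms(3), of a] by blast
qed

lemma finite_rnk_set: "finite I \<Longrightarrow> finite {card J |J. J \<subseteq> I \<and> indep J x}"
  by (rule finite_subset[of _ "card ` Pow I"]) auto

lemma rnk_ge:
  assumes "finite I" "J \<subseteq> I" "indep J x"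
  shows "card J \<le> rnk I x"
  unfolding rnk_def by (rule Max_ge[OF finite_rnk_set]) (use assms in blast)+

lemma rnk_basis:
  assumes "finite I"
  obtains J where "J \<subseteq> I" "indep J x" "card J = rnk I x"
proof -
  have "finite {card J |J. J \<subseteq> I \<and> indep J x}"
    using assms by (rule finite_rnk_set)
  moreover have "{card J |J. J \<subseteq> I \<and> indep J x} \<noteq> {}"
    using indep_empty by blast
  ultimately have "rnk I x \<in> {card J |J. J \<subseteq> I \<and> indep J x}"
    unfolding rnk_def by (rule Max_in)
  then obtain J where "J \<subseteq> I" "indep J x" "card J = rnk I x" by auto
  then show ?thesis by (rule that)
qed

text \<open>Adding \<open>i\<close> to a maximal independent subfamily creates a relation. The
  coefficient of \<open>i\<close> in it cannot vanish, so it can be solved for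
  \<open>x i\<close>.\<close>

lemma rnk_basis_span:
  assumes "finite I" "J \<subseteq> I" "indep J x" "card J = rnk I x" "i \<in> I"
  shows "\<exists>c. \<forall>t. x i t = (\<Sum>j\<in>J. c j * x j t)"
proof (cases "i \<in> J")
  case True
  have "(\<Sum>j\<in>J. (if j = i then 1 else 0) * x j t) = x i t" for t
    using True assms finite_subset[of J I]
    by (simp add: if_distrib[of "\<lambda>c. c * _"] cong: if_cong)
  then show ?thesis by (intro exI[of _ "\<lambda>j. if j = i then 1 else 0"]) auto
next
  case False
  have fJ: "finite J" using assms finite_subset by blast
  have "\<not> indep (insert i J) x"
    using rnk_ge[of I "insert i J" x] assms False fJ by auto
  then obtain a where a: "\<And>t. (\<Sum>j\<in>insert i J. a j * x j t) = 0" "\<exists>j\<in>insert i J. a j \<noteq> 0"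
    by (elim not_indepE) auto
  have a': "a i * x i t + (\<Sum>j\<in>J. a j * x j t) = 0" for t
    using a(1)[of t] False fJ by simp
  have "a i \<noteq> 0"
  proof
    assume "a i = 0"
    then have "\<forall>j\<in>J. a j = 0" using a' assms(3) unfolding indep_def by simp
    with \<open>a i = 0\<close> a(2) show False by simp
  qed
  then have "x i t = (\<Sum>j\<in>J. (- a j / a i) * x j t)" for t
  proof -
    have "a i * x i t = - (\<Sum>j\<in>J. a j * x j t)" using a'[of t] by linarith
    then have "x i t = - (\<Sum>j\<in>J. a j * x j t) / a i"
      using \<open>a i \<noteq> 0\<close> by (simp add: field_simps)
    then show ?thesis by (simp add: sum_negf sum_divide_distrib)
  qed
  then show ?thesis by (intro exI[of _ "\<lambda>j. - a j / a i"]) auto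
qed

text \<open>\<open>\<xi> i\<close> stands for a linear map applied to the vectors \<open>x\<close>; only its compatibility
  with linear relations matters.\<close>
lemma indep_triangular:
  fixes x :: "'i \<Rightarrow> 's \<Rightarrow> 't \<Rightarrow> real" and \<xi> :: "'i \<Rightarrow> 'i \<Rightarrow> 's \<Rightarrow> 'u \<Rightarrow> real" and \<rho> :: "'i \<Rightarrow> nat"
  assumes fin: "finite S" "\<And>i. i \<in> S \<Longrightarrow> finite (B i)"
    and lin: "\<And>i a u. i \<in> S \<Longrightarrow> (\<And>t. (\<Sum>j\<in>S. \<Sum>s\<in>B j. a j s * x j s t) = 0) \<Longrightarrow>
               (\<Sum>j\<in>S. \<Sum>s\<in>B j. a j s * \<xi> i j s u) = 0"
    and diag: "\<And>i. i \<in> S \<Longrightarrow> indep (B i) (\<xi> i i)"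
    and tri: "\<And>i j s u. i \<in> S \<Longrightarrow> j \<in> S \<Longrightarrow> j \<noteq> i \<Longrightarrow> \<rho> j \<le> \<rho> i \<Longrightarrow> s \<in> B j \<Longrightarrow> \<xi> i j s u = 0"
  shows "indep (SIGMA i:S. B i) (\<lambda>(i, s). x i s)"
proof (rule ccontr)
  assume "\<not> ?thesis"
  then obtain a where a: "\<And>t. (\<Sum>p\<in>Sigma S B. a p * (case p of (i, s) \<Rightarrow> x i s) t) = 0"
      and nz: "\<exists>p\<in>Sigma S B. a p \<noteq> 0"
    by (elim not_indepE) auto
  have rel: "(\<Sum>j\<in>S. \<Sum>s\<in>B j. a (j, s) * x j s t) = 0" for t
    using a[of t] fin by (simp add: sum.Sigma case_prod_beta)
  \<comment> \<open>Among the indices that occur in the relation, one with the largest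
    \<open>\<rho>\<close> is chosen. Its map \<open>\<xi> i\<close> annihilates all other blocks
    that occur, by \<open>tri\<close>, and leaves a relation inside block \<open>i\<close>.\<close>
  define N where "N = {i \<in> S. \<exists>s\<in>B i. a (i, s) \<noteq> 0}"
  have "finite N" "N \<noteq> {}" using nz fin by (auto simp: N_def)
  then have "Max (\<rho> ` N) \<in> \<rho> ` N" by (intro Max_in) auto
  then obtain i where "i \<in> N" "\<rho> i = Max (\<rho> ` N)" by auto
  then have i: "i \<in> N" "\<And>j. j \<in> N \<Longrightarrow> \<rho> j \<le> \<rho> i" using \<open>finite N\<close> by auto
  have "i \<in> S" using i by (simp add: N_def)
  have "(\<Sum>s\<in>B i. a (i, s) * \<xi> i i s u) = 0" for u
  proof -
    have z: "(\<Sum>s\<in>B j. a (j, s) * \<xi> i j s u) = 0" if "j \<in> S" "j \<noteq> i" for j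
    proof (cases "j \<in> N")
      case True
      then show ?thesis using tri[OF \<open>i \<in> S\<close> that] i(2) by simp
    next
      case False
      then show ?thesis using that by (simp add: N_def)
    qed
    have "0 = (\<Sum>j\<in>S. \<Sum>s\<in>B j. a (j, s) * \<xi> i j s u)"
      using lin[OF \<open>i \<in> S\<close>, of "\<lambda>j s. a (j, s)" u] rel by simp
    also have "\<dots> = (\<Sum>s\<in>B i. a (i, s) * \<xi> i i s u) + (\<Sum>j\<in>S - {i}. \<Sum>s\<in>B j. a (j, s) * \<xi> i j s u)"
      using fin \<open>i \<in> S\<close> by (simp add: sum.remove)
    also have "(\<Sum>j\<in>S - {i}. \<Sum>s\<in>B j. a (j, s) * \<xi> i j s u) = 0"
      using z by (intro sum.neutral) auto
    finally show ?thesis by simp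
  qed
  then have "\<forall>s\<in>B i. a (i, s) = 0"
    using indepD[OF diag[OF \<open>i \<in> S\<close>], of "\<lambda>s. a (i, s)"] by blast
  with i(1) show False by (simp add: N_def)
qed

lemma sum_pow2_less: "finite A \<Longrightarrow> (\<And>e. e \<in> A \<Longrightarrow> e < x) \<Longrightarrow> (\<Sum>e\<in>A. 2 ^ e) < (2 ^ x :: nat)"
proof -
  assume A: "finite A" "\<And>e. e \<in> A \<Longrightarrow> e < x"
  have "(\<Sum>e\<in>A. 2 ^ e) \<le> (\<Sum>e\<in>{..<x}. (2::nat) ^ e)"
    using A by (intro sum_mono2) auto
  also have "\<dots> < 2 ^ x" by (induction x) auto
  finally show ?thesis .
qed

text \<open>Reading a set as the binary digits of a number turns the colexicographic order into a
  \<open>nat\<close>-valued \<open>\<rho>\<close> for \<open>indep_triangular\<close>. The witness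
  is the largest element of the symmetric difference, since that digit decides the
  comparison.\<close>

lemma colex_witness:
  fixes A B :: "nat set"
  assumes "finite A" "finite B" "A \<noteq> B" "(\<Sum>e\<in>A. 2 ^ e) \<le> (\<Sum>e\<in>B. 2 ^ e :: nat)"
  obtains x where "x \<in> B" "x \<notin> A" "\<And>y. y > x \<Longrightarrow> y \<in> A \<longleftrightarrow> y \<in> B"
proof -
  define D where "D = (A - B) \<union> (B - A)"
  have D: "finite D" "D \<noteq> {}" using assms by (auto simp: D_def)
  define x where "x = Max D"
  have xD: "x \<in> D" using D by (simp add: x_def)
  have up: "y \<in> A \<longleftrightarrow> y \<in> B" if "y > x" for y
  proof (rule ccontr)
    assume "\<not> ?thesis"
    then have "y \<in> D" by (auto simp: D_def)
    then have "y \<le> x" using D by (simp add: x_def)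
    with that show False by simp
  qed
  have "x \<notin> A"
  proof
    assume "x \<in> A"
    then have "x \<notin> B" using xD by (auto simp: D_def)
    define U where "U = {e \<in> A. e > x}"
    have B: "B = U \<union> {e \<in> B. e < x}" using up \<open>x \<notin> B\<close> by (auto simp: U_def not_less le_less)
    have "(\<Sum>e\<in>B. 2 ^ e) = (\<Sum>e\<in>U. 2 ^ e) + (\<Sum>e\<in>{e \<in> B. e < x}. 2 ^ e :: nat)"
      using assms(1,2) by (subst B, subst sum.union_disjoint) (auto simp: U_def)
    also have "\<dots> < (\<Sum>e\<in>U. 2 ^ e) + 2 ^ x"
      using assms(2) by (intro add_strict_left_mono sum_pow2_less) auto
    also have "\<dots> = (\<Sum>e\<in>insert x U. 2 ^ e)" using assms(1) by (subst sum.insert) (auto simp: U_def)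
    also have "\<dots> \<le> (\<Sum>e\<in>A. 2 ^ e)" using assms(1) \<open>x \<in> A\<close> by (intro sum_mono2) (auto simp: U_def)
    finally show False using assms(4) by simp
  qed
  moreover have "x \<in> B" using xD \<open>x \<notin> A\<close> by (auto simp: D_def)
  ultimately show ?thesis using that up by blast
qed

section \<open>Minors and flagged Weyl modules\<close>

text \<open>For \<open>l\<close> in \<open>C\<close> the zero-based index of the row
  \<open>l\<close>, whose parity is the cofactor sign; for \<open>l\<close> outside \<open>C\<close>
  the index at which it would be inserted.\<close>

definition pos :: "nat \<Rightarrow> nat set \<Rightarrow> nat" where
  "pos l C = card {m \<in> C. m < l}"

text \<open>The minor of \<open>A\<close> with (increasingly ordered) row set \<open>C\<close> and column list \<open>ds\<close>,
  by expansion along the first column; it is \<open>0\<close> when \<open>card C \<noteq> length ds\<close>.\<close>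
fun minor :: "(nat \<Rightarrow> nat \<Rightarrow> real) \<Rightarrow> nat set \<Rightarrow> nat list \<Rightarrow> real" where
  "minor A C [] = (if C = {} then 1 else 0)"
| "minor A C (d # ds) = (\<Sum>l\<in>C. (-1) ^ pos l C * A l d * minor A (C - {l}) ds)"

definition del :: "nat \<Rightarrow> 'a list \<Rightarrow> 'a list" where
  "del p X = take p X @ drop (Suc p) X"

text \<open>The expansion of a determinant along a row \<open>l\<close> put on top of the rows
  \<open>C\<close>. The case \<open>l \<in> C\<close> is allowed and describes a matrix with two
  equal rows.\<close>

definition row_exp :: "(nat \<Rightarrow> nat \<Rightarrow> real) \<Rightarrow> nat \<Rightarrow> nat set \<Rightarrow> nat list \<Rightarrow> real" where
  "row_exp A l C X = (\<Sum>p<length X. (-1) ^ p * A l (X ! p) * minor A C (del p X))"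

lemma pos_insert: "finite C \<Longrightarrow> l \<notin> C \<Longrightarrow> pos m (insert l C) = pos m C + (if l < m then 1 else 0)"
proof -
  assume a: "finite C" "l \<notin> C"
  have "{x \<in> insert l C. x < m} = (if l < m then insert l {x \<in> C. x < m} else {x \<in> C. x < m})"
    by auto
  then show ?thesis using a by (simp add: pos_def)
qed

lemma pos_remove: "finite C \<Longrightarrow> l \<in> C \<Longrightarrow> pos m C = pos m (C - {l}) + (if l < m then 1 else 0)"
  using pos_insert[of "C - {l}" l m] by (simp add: insert_absorb)

lemma minor_card: "finite C \<Longrightarrow> card C \<noteq> length ds \<Longrightarrow> minor A C ds = 0"
proof (induction ds arbitrary: C)
  case Nil
  then show ?case by (cases "C = {}") simp_all
next
  case (Cons d ds)
  have "minor A (C - {l}) ds = 0" if "l \<in> C" for l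
  proof (rule Cons.IH)
    show "card (C - {l}) \<noteq> length ds"
      using Cons.prems that card_Suc_Diff1[of C l] by simp
  qed (use Cons.prems in simp)
  then show ?case by simp
qed

text \<open>Expanding twice gives a sum over ordered pairs of distinct rows. Exchanging the rows of
  a pair changes the product of the two cofactor signs, because removing the smaller row lowers the
  index of the larger one.\<close>

lemma minor_swap:
  assumes "finite C"
  shows "minor A C (d # e # ds) = - minor A C (e # d # ds)"
proof -
  define f where "f d e l m = (-1) ^ pos l C * A l d * ((-1) ^ pos m (C - {l}) * A m e * minor A (C - {l} - {m}) ds)" for d e l m
  have exp: "minor A C (d # e # ds) = (\<Sum>l\<in>C. \<Sum>m\<in>C. if l = m then 0 else f d e l m)" for d e
  proof -
    have "(\<Sum>m\<in>C. if l = m then 0 else f d e l m) = (\<Sum>m\<in>C - {l}. f d e l m)" for l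
      using assms by (intro sum.mono_neutral_cong_right) auto
    then show ?thesis by (simp add: f_def sum_distrib_left)
  qed
  have anti: "f d e l m = - f e d m l" if "l \<in> C" "m \<in> C" "l \<noteq> m" for l m
  proof -
    have "pos m C = pos m (C - {l}) + (if l < m then 1 else 0)" using pos_remove that assms by blast
    moreover have "pos l C = pos l (C - {m}) + (if m < l then 1 else 0)" using pos_remove that assms by blast
    moreover have "C - {l} - {m} = C - {m} - {l}" by auto
    ultimately show ?thesis using that by (cases "l < m") (auto simp: f_def power_add)
  qed
  have "minor A C (d # e # ds) = (\<Sum>l\<in>C. \<Sum>m\<in>C. - (if m = l then 0 else f e d m l))"
    unfolding exp using anti by (intro sum.cong) auto
  also have "\<dots> = - (\<Sum>m\<in>C. \<Sum>l\<in>C. if m = l then 0 else f e d m l)"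
    by (subst sum.swap) (simp only: sum_negf)
  also have "\<dots> = - minor A C (e # d # ds)" unfolding exp ..
  finally show ?thesis .
qed

lemma minor_move: "finite C \<Longrightarrow> minor A C (xs @ a # ys) = (-1) ^ length xs * minor A C (a # xs @ ys)"
proof (induction xs arbitrary: C)
  case Nil
  then show ?case by simp
next
  case (Cons x xs)
  have "minor A C ((x # xs) @ a # ys) = (-1) ^ length xs * minor A C (x # a # xs @ ys)"
    using Cons by (simp add: sum_distrib_left mult_ac del: minor.simps(1))
  then show ?case using minor_swap[OF Cons.prems, of A x a] by simp
qed

text \<open>The scalar constructed here is a sign. One scalar serves all row sets \<open>C\<close>,
  so reordering columns respects linear relations between minors.\<close>

lemma minor_perm:
  "mset ds = mset es \<Longrightarrow>
   \<exists>s::real. s \<noteq> 0 \<and> (\<forall>C. finite C \<longrightarrow> minor A C ds = s * minor A C es)"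
  proof (induction ds arbitrary: es)
    case Nil
    then show ?case by (intro exI[of _ 1]) auto
  next
    case (Cons d ds)
    then have "d \<in> set es" by (metis list.set_intros(1) set_mset_mset)
    then obtain xs ys where es: "es = xs @ d # ys" by (meson split_list)
    then have "mset ds = mset (xs @ ys)" using Cons.prems by simp
    then obtain s :: real where s: "s \<noteq> 0"
        "\<And>C. finite C \<Longrightarrow> minor A C ds = s * minor A C (xs @ ys)"
      using Cons.IH by blast
    have "minor A C (d # ds) = s * minor A C (d # xs @ ys)" if "finite C" for C
      using s(2) that by (simp add: sum_distrib_left mult_ac)
    moreover have "minor A C (d # xs @ ys) = (-1) ^ length xs * minor A C es" if "finite C" for C
      using minor_move[OF that, of A xs d ys] es by simp
    ultimately have "minor A C (d # ds) = (s * (-1) ^ length xs) * minor A C es" if "finite C" for C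
      using that by simp
    moreover have "s * (-1) ^ length xs \<noteq> 0"
      using s(1) by simp
    ultimately show ?case by blast
  qed
text \<open>With the equal columns moved next to each other, \<open>minor_swap\<close> makes the
  minor its own negative.\<close>

lemma minor_repeat:
  assumes "finite C" "a \<in> set ds"
  shows "minor A C (a # ds) = 0"
proof -
  obtain xs ys where ds: "ds = xs @ a # ys" using assms(2) by (meson split_list)
  have "minor A C (a # ds) = (-1) ^ length xs * minor A C (a # a # xs @ ys)"
    using assms(1) by (simp add: ds minor_move sum_distrib_left mult_ac del: minor.simps(1))
  moreover have "minor A C (a # a # xs @ ys) = 0"
    using minor_swap[OF assms(1), of A a a "xs @ ys"] by (simp del: minor.simps)
  ultimately show ?thesis by simp
qed

lemma minor_not_distinct:
  assumes "finite C" "\<not> distinct ds"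
  shows "minor A C ds = 0"
proof -
  obtain xs ys zs a where ds: "ds = xs @ [a] @ ys @ [a] @ zs"
    using assms(2) not_distinct_decomp by blast
  have "minor A C (a # (xs @ ys @ [a] @ zs)) = 0" by (rule minor_repeat[OF assms(1)]) auto
  then show ?thesis using minor_move[OF assms(1), of A xs a "ys @ [a] @ zs"] by (simp add: ds)
qed

lemma row_exp_Nil [simp]: "row_exp A l C [] = 0"
  by (simp add: row_exp_def)

lemma del_0 [simp]: "del 0 (d # ds) = ds"
  and del_Suc [simp]: "del (Suc p) (d # ds) = d # del p ds"
  by (simp_all add: del_def)

lemma row_exp_Cons:
  "row_exp A l C (d # ds) = A l d * minor A C ds - (\<Sum>m\<in>C. (-1) ^ pos m C * A m d * row_exp A l (C - {m}) ds)"
proof -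
  have "row_exp A l C (d # ds) =
      A l d * minor A C ds + (\<Sum>p<length ds. (-1) ^ Suc p * A l (ds ! p) * minor A C (d # del p ds))"
    unfolding row_exp_def by (simp only: length_Cons sum.lessThan_Suc_shift) simp
  also have "(\<Sum>p<length ds. (-1) ^ Suc p * A l (ds ! p) * minor A C (d # del p ds)) =
      - (\<Sum>p<length ds. \<Sum>m\<in>C. (-1) ^ pos m C * A m d * ((-1) ^ p * A l (ds ! p) * minor A (C - {m}) (del p ds)))"
    by (simp add: sum_negf sum_distrib_left mult_ac)
  also have "\<dots> = - (\<Sum>m\<in>C. (-1) ^ pos m C * A m d * row_exp A l (C - {m}) ds)"
    by (subst sum.swap) (simp add: row_exp_def sum_distrib_left)
  finally show ?thesis by simp
qed

text \<open>Laplace expansion along a row, derived from the column recursion by induction on the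
  columns: both sides are expanded along the column \<open>d\<close> and the signs compared as in
  \<open>minor_swap\<close>.\<close>

lemma minor_row_exp:
  "finite C \<Longrightarrow> l \<notin> C \<Longrightarrow> minor A (insert l C) X = (-1) ^ pos l C * row_exp A l C X"
proof (induction X arbitrary: C)
  case Nil
  then show ?case by simp
next
  case (Cons d ds)
  have "(-1) ^ pos m (insert l C) * A m d * minor A (insert l C - {m}) ds =
      - ((-1) ^ pos l C * ((-1) ^ pos m C * A m d * row_exp A l (C - {m}) ds))" if "m \<in> C" for m
  proof -
    have "m \<noteq> l" using that Cons by auto
    then have eq: "insert l C - {m} = insert l (C - {m})" by auto
    have 1: "minor A (insert l (C - {m})) ds = (-1) ^ pos l (C - {m}) * row_exp A l (C - {m}) ds"
      using Cons by auto
    have 2: "pos m (insert l C) = pos m C + (if l < m then 1 else 0)"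
      using pos_insert Cons.prems by blast
    have 3: "pos l C = pos l (C - {m}) + (if m < l then 1 else 0)"
      using pos_remove Cons.prems that by blast
    show ?thesis unfolding eq 1 2 3 using \<open>m \<noteq> l\<close> by (cases "l < m") (auto simp: power_add)
  qed
  moreover have "pos l (insert l C) = pos l C" "insert l C - {l} = C"
    using Cons.prems pos_insert[of C l l] by auto
  ultimately have "minor A (insert l C) (d # ds) = (-1) ^ pos l C * A l d * minor A C ds +
      (\<Sum>m\<in>C. - ((-1) ^ pos l C * ((-1) ^ pos m C * A m d * row_exp A l (C - {m}) ds)))"
    using Cons.prems by simp
  then show ?case by (simp add: row_exp_Cons algebra_simps sum_negf sum_distrib_left)
qed

text \<open>A determinant with two equal rows vanishes. In \<open>row_exp_Cons\<close> the terms
  with \<open>m\<close> different from \<open>l\<close> are zero by induction, and the term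
  \<open>m = l\<close> cancels the leading one.\<close>

lemma row_exp_mem: "finite C \<Longrightarrow> l \<in> C \<Longrightarrow> row_exp A l C X = 0"
proof (induction X arbitrary: C)
  case Nil
  then show ?case by simp
next
  case (Cons d ds)
  have "minor A C ds = (-1) ^ pos l C * row_exp A l (C - {l}) ds"
    using minor_row_exp[of "C - {l}" l A ds] Cons.prems pos_remove[of C l l] by (simp add: insert_absorb)
  moreover have "(\<Sum>m\<in>C. (-1) ^ pos m C * A m d * row_exp A l (C - {m}) ds) =
      (-1) ^ pos l C * A l d * row_exp A l (C - {l}) ds"
    using Cons by (subst sum.remove[of C l]) (auto intro!: sum.neutral)
  ultimately show ?case by (simp add: row_exp_Cons)
qed

text \<open>A box is moved from the column \<open>X\<close> to the column \<open>G\<close>, in all possible ways.\<close>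
lemma minor_exchange:
  assumes "finite C0" "finite C1"
  shows "(\<Sum>l\<in>C0 - C1. (-1) ^ pos l C0 * (-1) ^ pos l C1 * (minor A (C0 - {l}) G * minor A (insert l C1) X)) =
    (\<Sum>p<length X. (-1) ^ p * (minor A C0 (X ! p # G) * minor A C1 (del p X)))"
proof -
  \<comment> \<open>The rows in both \<open>C0\<close> and \<open>C1\<close> may be added because
    \<open>row_exp_mem\<close> makes their terms zero. The sum over all of \<open>C0\<close> is then
    the expansion of a minor along the new first column \<open>X ! p\<close>.\<close>
  have "(\<Sum>l\<in>C0 - C1. (-1) ^ pos l C0 * (-1) ^ pos l C1 * (minor A (C0 - {l}) G * minor A (insert l C1) X)) =
     (\<Sum>l\<in>C0. (-1) ^ pos l C0 * minor A (C0 - {l}) G * row_exp A l C1 X)"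
  proof (rule sum.mono_neutral_cong_left)
    show "\<forall>l\<in>C0 - (C0 - C1). (-1) ^ pos l C0 * minor A (C0 - {l}) G * row_exp A l C1 X = 0"
      using row_exp_mem[OF assms(2)] by simp
  qed (use assms in \<open>auto simp: minor_row_exp\<close>)
  also have "\<dots> = (\<Sum>l\<in>C0. \<Sum>p<length X. (-1) ^ p * ((-1) ^ pos l C0 * A l (X ! p) * minor A (C0 - {l}) G * minor A C1 (del p X)))"
    by (simp add: row_exp_def sum_distrib_left mult_ac)
  also have "\<dots> = (\<Sum>p<length X. (-1) ^ p * (minor A C0 (X ! p # G) * minor A C1 (del p X)))"
    by (subst sum.swap) (simp add: sum_distrib_left sum_distrib_right mult_ac)
  finally show ?thesis .
qed

lemma minor_row_cong:
  "(\<And>l d. l \<in> C \<Longrightarrow> d \<in> set ds \<Longrightarrow> A l d = B l d) \<Longrightarrow> minor A C ds = minor B C ds"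
proof (induction ds arbitrary: C)
  case (Cons d ds)
  have "minor A (C - {l}) ds = minor B (C - {l}) ds" for l
    using Cons by (intro Cons.IH) auto
  then show ?case using Cons.prems by (auto intro!: sum.cong)
qed simp

lemma minor_zero_row:
  assumes "finite C" "k \<in> C" "\<And>d. d \<in> set ds \<Longrightarrow> A k d = 0"
  shows "minor A C ds = 0"
proof -
  have "row_exp A k (C - {k}) ds = 0" unfolding row_exp_def using assms by (intro sum.neutral) auto
  then show ?thesis
    using minor_row_exp[of "C - {k}" k A ds] assms by (simp add: insert_absorb)
qed

lemma minor_unit_row:
  assumes "finite C" "k \<notin> C" "A k k = 1" "\<And>d. d \<in> set ds \<Longrightarrow> A k d = 0"
  shows "minor A (insert k C) (k # ds) = (-1) ^ pos k C * minor A C ds"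
proof -
  have "row_exp A k (C - {m}) ds = 0" for m
    unfolding row_exp_def using assms by (intro sum.neutral) auto
  then show ?thesis using assms by (simp add: minor_row_exp row_exp_Cons del: minor.simps)
qed

text \<open>Normalising the diagonal to \<open>1\<close> loses nothing within one weight space:
  scaling the rows of the matrix multiplies all products of minors of the same weight by a common
  factor.\<close>

definition unitri :: "(nat \<Rightarrow> nat \<Rightarrow> real) \<Rightarrow> nat \<Rightarrow> nat \<Rightarrow> real" where
  "unitri y l d = (if l < d then y l d else if l = d then 1 else 0)"

lemma minor_diagonal: "sorted_wrt (<) ds \<Longrightarrow> minor (unitri y) (set ds) ds = 1"
proof (induction ds)
  case (Cons d ds)
  have "set (d # ds) - {d} = set ds" using Cons.prems by auto
  moreover have "pos d (set (d # ds)) = 0" using Cons.prems by (auto simp: pos_def)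
  moreover have "minor (unitri y) (set (d # ds)) (d # ds) =
     (-1) ^ pos d (set (d # ds)) * unitri y d d * minor (unitri y) (set (d # ds) - {d}) ds"
    unfolding minor.simps using Cons.prems
    by (subst sum.remove[of _ d]) (auto intro!: sum.neutral simp: unitri_def)
  moreover have "minor (unitri y) (set ds) ds = 1" "unitri y d d = 1"
    using Cons by simp (simp add: unitri_def)
  ultimately show ?case by (simp del: minor.simps)
qed simp

section \<open>Fillings of a diagram and weight spaces\<close>

text \<open>The rows chosen in the columns of a diagram, \<open>\<alpha>\<close> being the multiset of all of them.\<close>
definition fillings :: "nat set \<Rightarrow> (nat \<Rightarrow>\<^sub>0 nat) \<Rightarrow> (nat \<Rightarrow> nat set) set" where
  "fillings Q \<alpha> = {C. (\<forall>q. q \<notin> Q \<longrightarrow> C q = {}) \<and> (\<forall>l. card {q \<in> Q. l \<in> C q} = Poly_Mapping.lookup \<alpha> l)}"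

definition minors :: "nat set \<Rightarrow> (nat \<Rightarrow> nat list) \<Rightarrow> (nat \<Rightarrow> nat set) \<Rightarrow> (nat \<Rightarrow> nat \<Rightarrow> real) \<Rightarrow> real" where
  "minors Q D C y = (\<Prod>q\<in>Q. minor (unitri y) (C q) (D q))"

text \<open>The dimension of the \<open>\<alpha>\<close>-weight space of the flagged Weyl module of the diagram whose
  columns are \<open>D q\<close> for \<open>q \<in> Q\<close>.\<close>
definition wdim :: "nat set \<Rightarrow> (nat \<Rightarrow> nat list) \<Rightarrow> (nat \<Rightarrow>\<^sub>0 nat) \<Rightarrow> nat" where
  "wdim Q D \<alpha> = rnk (fillings Q \<alpha>) (minors Q D)"

lemma fillings_subset_keys:
  assumes "C \<in> fillings Q \<alpha>" "finite Q"
  shows "C q \<subseteq> Poly_Mapping.keys \<alpha>"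
proof
  fix l assume "l \<in> C q"
  then have "q \<in> {q \<in> Q. l \<in> C q}" using assms(1) by (auto simp: fillings_def)
  then have "card {q \<in> Q. l \<in> C q} \<noteq> 0" using assms(2) by (auto simp: card_eq_0_iff)
  then show "l \<in> Poly_Mapping.keys \<alpha>" using assms(1) by (simp add: fillings_def in_keys_iff)
qed

lemma finite_filling: "C \<in> fillings Q \<alpha> \<Longrightarrow> finite Q \<Longrightarrow> finite (C q)"
  by (meson fillings_subset_keys finite_keys finite_subset)

lemma finite_fillings:
  assumes "finite Q"
  shows "finite (fillings Q \<alpha>)"
proof (rule finite_subset)
  show "fillings Q \<alpha> \<subseteq> {C. \<forall>q. (q \<in> Q \<longrightarrow> C q \<in> Pow (Poly_Mapping.keys \<alpha>)) \<and> (q \<notin> Q \<longrightarrow> C q = {})}"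
  proof
    fix C assume "C \<in> fillings Q \<alpha>"
    then show "C \<in> {C. \<forall>q. (q \<in> Q \<longrightarrow> C q \<in> Pow (Poly_Mapping.keys \<alpha>)) \<and> (q \<notin> Q \<longrightarrow> C q = {})}"
      using fillings_subset_keys[of C Q \<alpha>] assms by (auto simp: fillings_def)
  qed
  show "finite {C. \<forall>q. (q \<in> Q \<longrightarrow> C q \<in> Pow (Poly_Mapping.keys \<alpha>)) \<and> (q \<notin> Q \<longrightarrow> C q = {})}"
    using assms by (intro finite_set_of_finite_funs) auto
qed

lemma wdim_ge:
  assumes "finite Q" "J \<subseteq> fillings Q \<alpha>" "indep J (minors Q D)"
  shows "card J \<le> wdim Q D \<alpha>"
  unfolding wdim_def using rnk_ge[OF finite_fillings assms(2,3)] assms(1) by blast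

lemma wdim_basis:
  assumes "finite Q"
  obtains J where "J \<subseteq> fillings Q \<alpha>" "finite J" "indep J (minors Q D)" "card J = wdim Q D \<alpha>"
    "\<And>C. C \<in> fillings Q \<alpha> \<Longrightarrow> \<exists>c. \<forall>y. minors Q D C y = (\<Sum>B\<in>J. c B * minors Q D B y)"
proof -
  obtain J where J: "J \<subseteq> fillings Q \<alpha>" "indep J (minors Q D)" "card J = rnk (fillings Q \<alpha>) (minors Q D)"
    by (rule rnk_basis[OF finite_fillings[OF assms]])
  show ?thesis
  proof (rule that[of J])
    show "finite J" using J(1) finite_fillings[OF assms] finite_subset by blast
    show "\<exists>c. \<forall>y. minors Q D C y = (\<Sum>B\<in>J. c B * minors Q D B y)" if "C \<in> fillings Q \<alpha>" for C
      using rnk_basis_span[OF finite_fillings[OF assms] J that] .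
  qed (use J in \<open>auto simp: wdim_def\<close>)
qed

text \<open>The scalar may vary with \<open>y\<close> but is common to all fillings, so it can be
  cancelled from linear relations (\<open>indep_scale\<close>).\<close>

lemma minors_perm:
  assumes "finite Q" "\<And>q. q \<in> Q \<Longrightarrow> mset (D q) = mset (D' q)"
  obtains s :: "(nat \<Rightarrow> nat \<Rightarrow> real) \<Rightarrow> real" where "\<And>y. s y \<noteq> 0"
    "\<And>C y. (\<And>q. q \<in> Q \<Longrightarrow> finite (C q)) \<Longrightarrow> minors Q D C y = s y * minors Q D' C y"
proof -
  have "\<forall>q\<in>Q. \<forall>y. \<exists>s. s \<noteq> 0 \<and> (\<forall>C. finite C \<longrightarrow> minor (unitri y) C (D q) = s * minor (unitri y) C (D' q))"
    using minor_perm[OF assms(2)] by blast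
  then obtain s where s: "\<And>q y. q \<in> Q \<Longrightarrow> s q y \<noteq> 0"
      "\<And>q y C. q \<in> Q \<Longrightarrow> finite C \<Longrightarrow> minor (unitri y) C (D q) = s q y * minor (unitri y) C (D' q)"
    by metis
  show ?thesis
  proof (rule that[of "\<lambda>y. \<Prod>q\<in>Q. s q y"])
    show "(\<Prod>q\<in>Q. s q y) \<noteq> 0" for y using s(1) assms(1) by simp
    show "minors Q D C y = (\<Prod>q\<in>Q. s q y) * minors Q D' C y" if "\<And>q. q \<in> Q \<Longrightarrow> finite (C q)" for C y
      unfolding minors_def using s(2) that by (simp add: prod.distrib[symmetric])
  qed
qed

section \<open>Removing a row and a column\<close>

lemma skip_strict_mono: "strict_mono (skip k)"
  by (auto simp: strict_mono_def skip_def)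

lemma inj_skip: "inj_on (skip k) S"
  using skip_strict_mono strict_mono_imp_inj_on inj_on_subset by blast

lemma skip_neq [simp]: "skip k l \<noteq> k" "k \<noteq> skip k l"
  by (auto simp: skip_def)

lemma skip_less_iff [simp]: "skip k l < skip k m \<longleftrightarrow> l < m"
  using skip_strict_mono strict_mono_less by blast

lemma skip_eq_iff [simp]: "skip k l = skip k m \<longleftrightarrow> l = m"
  using inj_skip[of k UNIV] by (auto dest: injD)

lemma skip_surj:
  assumes "l \<noteq> k"
  obtains m where "l = skip k m"
proof (cases "l < k")
  case True
  then show ?thesis using that[of l] by (simp add: skip_def)
next
  case False
  then show ?thesis using that[of "l - 1"] assms by (simp add: skip_def)
qed

lemma minor_map:
  assumes "strict_mono f"
  shows "minor A (f ` C) (map f ds) = minor (\<lambda>l d. A (f l) (f d)) C ds"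
proof (induction ds arbitrary: C)
  case Nil
  then show ?case by simp
next
  case (Cons d ds)
  have inj: "inj f" using assms strict_mono_imp_inj_on by blast
  have "pos (f l) (f ` C) = pos l C" for l
  proof -
    have "{m \<in> f ` C. m < f l} = f ` {m \<in> C. m < l}" using assms by (auto simp: strict_mono_less)
    then show ?thesis by (simp add: pos_def card_image inj_on_subset[OF inj])
  qed
  moreover have "f ` C - {f l} = f ` (C - {l})" for l using inj by (auto dest: injD)
  ultimately show ?case using Cons by (simp add: sum.reindex inj_on_subset[OF inj])
qed

text \<open>Setting the off-diagonal entries in row and column \<open>k\<close> to \<open>0\<close> turns the chosen products
  of minors for \<open>D\<close> into those for the diagram with row and column \<open>k\<close> removed.\<close>
lemma wdim_delete:
  assumes "finite Q'" and Q: "Q = insert k (skip k ` Q')"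
    and D: "\<And>q. q \<in> Q' \<Longrightarrow> D (skip k q) = (if k \<in> S q then [k] else []) @ map (skip k) (D' q)"
    and Dk: "sorted_wrt (<) (D k)" "k \<notin> set (D k)"
    and \<beta>: "\<And>l. Poly_Mapping.lookup \<beta> (skip k l) =
              Poly_Mapping.lookup \<alpha> l + (if skip k l \<in> set (D k) then 1 else 0)"
           "Poly_Mapping.lookup \<beta> k = card {q \<in> Q'. k \<in> S q}"
  shows "wdim Q' D' \<alpha> \<le> wdim Q D \<beta>"
proof -
  define R where "R q = (if k \<in> S q then {k} else {})" for q
  \<comment> \<open>Column \<open>k\<close> is filled with its own boxes, which gives a minor equal
    to \<open>1\<close> (\<open>minor_diagonal\<close>); a column that contains the box
    \<open>k\<close> also receives the row \<open>k\<close>.\<close>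
  define e where "e C q = (if q = k then set (D k) else if q \<in> skip k ` Q' then
      R (THE q'. q = skip k q') \<union> skip k ` C (THE q'. q = skip k q') else {})" for C q
  have ek: "e C k = set (D k)" for C by (simp add: e_def)
  have es: "e C (skip k q) = R q \<union> skip k ` C q" if "q \<in> Q'" for C q
    using that by (simp add: e_def)
  obtain J where J: "J \<subseteq> fillings Q' \<alpha>" "finite J" "indep J (minors Q' D')" "card J = wdim Q' D' \<alpha>"
    using wdim_basis[OF assms(1), where D = D'] by metis
  have fQ: "finite Q" using assms(1) Q by simp
  have cnt: "card {q \<in> Q. P q} = (if P k then 1 else 0) + card {q \<in> Q'. P (skip k q)}" for P
  proof -
    have "{q \<in> Q. P q} = (if P k then {k} else {}) \<union> skip k ` {q \<in> Q'. P (skip k q)}"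
      unfolding Q by auto
    then show ?thesis using assms(1) by (auto simp: card_insert_if card_image[OF inj_skip])
  qed
  have fill: "e C \<in> fillings Q \<beta>" if "C \<in> fillings Q' \<alpha>" for C
  proof -
    have "card {q \<in> Q. l \<in> e C q} = Poly_Mapping.lookup \<beta> l" for l
    proof (cases "l = k")
      case True
      have "{q \<in> Q'. k \<in> e C (skip k q)} = {q \<in> Q'. k \<in> S q}"
        by (auto simp: es R_def split: if_splits)
      then show ?thesis unfolding cnt using True Dk \<beta>(2) by (simp add: ek)
    next
      case False
      then obtain m where m: "l = skip k m" by (rule skip_surj)
      have "{q \<in> Q'. skip k m \<in> e C (skip k q)} = {q \<in> Q'. m \<in> C q}"
        by (auto simp: es R_def split: if_splits)
      then show ?thesis unfolding cnt using m that \<beta>(1) by (simp add: ek fillings_def)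
    qed
    then show ?thesis by (auto simp: fillings_def e_def Q)
  qed
  have inj: "inj_on e J"
  proof (rule inj_onI)
    fix B C assume BC: "B \<in> J" "C \<in> J" "e B = e C"
    show "B = C"
    proof
      fix q show "B q = C q"
      proof (cases "q \<in> Q'")
        case True
        have "R q \<union> skip k ` B q = R q \<union> skip k ` C q" using BC(3) es[OF True] by metis
        moreover have "k \<notin> skip k ` B q" "k \<notin> skip k ` C q" by auto
        ultimately have "skip k ` B q = skip k ` C q" by (simp add: R_def insert_ident split: if_splits)
        then show ?thesis using inj_image_eq_iff[OF inj_skip] by blast
      next
        case False
        then show ?thesis using BC J(1) by (auto simp: fillings_def)
      qed
    qed
  qed
  \<comment> \<open>The signs produced by the additional row \<open>k\<close>. They depend on
    \<open>C\<close>, but a nonzero factor on each member of a family is absorbed in the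
    coefficients of a relation.\<close>
  define sg :: "(nat \<Rightarrow> nat set) \<Rightarrow> real" where
    "sg C = (\<Prod>q\<in>Q'. if k \<in> S q then (-1) ^ pos k (skip k ` C q) else 1)" for C
  have sg: "sg C \<noteq> 0" for C using assms(1) by (simp add: sg_def)
  define pre where "pre l = (if l < k then l else l - 1)" for l
  have pre: "pre (skip k l) = l" for l by (auto simp: pre_def skip_def)
  define z :: "(nat \<Rightarrow> nat \<Rightarrow> real) \<Rightarrow> nat \<Rightarrow> nat \<Rightarrow> real" where
    "z y l d = (if l = k \<or> d = k then 0 else y (pre l) (pre d))" for y l d
  have zu: "unitri (z y) (skip k l) (skip k d) = unitri y l d" for y l d
    by (simp add: unitri_def z_def pre)
  have val: "minors Q D (e C) (z y) = sg C * minors Q' D' C y" if "C \<in> J" for C y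
  proof -
    have fC: "finite (C q)" for q using finite_filling[OF _ assms(1)] that J(1) by blast
    have "minor (unitri (z y)) (e C (skip k q)) (D (skip k q)) =
        (if k \<in> S q then (-1) ^ pos k (skip k ` C q) else 1) * minor (unitri y) (C q) (D' q)"
      if "q \<in> Q'" for q
    proof -
      have base: "minor (unitri (z y)) (skip k ` C q) (map (skip k) (D' q)) = minor (unitri y) (C q) (D' q)"
        by (simp add: minor_map[OF skip_strict_mono] zu)
      show ?thesis
      proof (cases "k \<in> S q")
        case True
        have "minor (unitri (z y)) (insert k (skip k ` C q)) (k # map (skip k) (D' q)) =
          (-1) ^ pos k (skip k ` C q) * minor (unitri (z y)) (skip k ` C q) (map (skip k) (D' q))"
          by (rule minor_unit_row) (use fC in \<open>auto simp: unitri_def z_def\<close>)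
        then show ?thesis using True base by (simp add: es[OF that] D[OF that] R_def)
      next
        case False
        then show ?thesis using base by (simp add: es[OF that] D[OF that] R_def)
      qed
    qed
    moreover have "minors Q D (e C) (z y) = minor (unitri (z y)) (e C k) (D k) *
        (\<Prod>q\<in>Q'. minor (unitri (z y)) (e C (skip k q)) (D (skip k q)))"
      unfolding minors_def Q using assms(1)
      by (subst prod.insert) (auto simp: prod.reindex[OF inj_skip])
    ultimately show ?thesis
      by (simp add: ek minor_diagonal[OF Dk(1)] sg_def minors_def prod.distrib)
  qed
  have "indep (e ` J) (minors Q D)"
    unfolding indep_def
  proof (intro allI impI)
    fix a assume a: "\<forall>y. (\<Sum>C\<in>e ` J. a C * minors Q D C y) = 0"
    have "(\<Sum>C\<in>J. (a (e C) * sg C) * minors Q' D' C y) = 0" for y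
    proof -
      have "(\<Sum>C\<in>J. (a (e C) * sg C) * minors Q' D' C y) = (\<Sum>C\<in>J. a (e C) * minors Q D (e C) (z y))"
        by (intro sum.cong) (auto simp: val)
      also have "\<dots> = (\<Sum>C\<in>e ` J. a C * minors Q D C (z y))" by (simp add: sum.reindex[OF inj])
      finally show ?thesis using a by simp
    qed
    then have "a (e C) * sg C = 0" if "C \<in> J" for C
      using indepD[OF J(3), of "\<lambda>C. a (e C) * sg C"] that by blast
    then show "\<forall>C\<in>e ` J. a C = 0" using sg by auto
  qed
  then have "card (e ` J) \<le> wdim Q D \<beta>"
    using fill J(1) by (intro wdim_ge[OF fQ]) auto
  then show ?thesis using J(4) by (simp add: card_image[OF inj])
qed

section \<open>Expansion along the first row\<close>

lemma sum_monomials_eq_0: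
  fixes c :: "'i \<Rightarrow> real" and k :: "'i \<Rightarrow> nat"
  assumes "finite I" "\<And>s. (\<Sum>i\<in>I. c i * s ^ k i) = 0"
  shows "(\<Sum>i\<in>{i \<in> I. k i = e}. c i) = 0"
proof (cases "e \<in> k ` I")
  case True
  define n where "n = Max (k ` I)"
  have le: "k i \<le> n" if "i \<in> I" for i using that assms(1) by (simp add: n_def)
  have "(\<Sum>e\<le>n. (\<Sum>i\<in>{i \<in> I. k i = e}. c i) * s ^ e) = 0" for s
  proof -
    have "(\<Sum>e\<le>n. (\<Sum>i\<in>{i \<in> I. k i = e}. c i) * s ^ e) = (\<Sum>e\<le>n. \<Sum>i\<in>{i \<in> I. k i = e}. c i * s ^ k i)"
      by (simp add: sum_distrib_right)
    also have "\<dots> = (\<Sum>i\<in>I. c i * s ^ k i)"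
      using assms(1) le by (intro sum.group) auto
    finally show ?thesis using assms(2) by simp
  qed
  then have "\<forall>e\<le>n. (\<Sum>i\<in>{i \<in> I. k i = e}. c i) = 0"
    using polyfun_eq_0[of "\<lambda>e. \<Sum>i\<in>{i \<in> I. k i = e}. c i" n] by blast
  then show ?thesis using True le by auto
next
  case False
  then have "{i \<in> I. k i = e} = {}" by auto
  then show ?thesis by (simp only: sum.empty)
qed

text \<open>Coefficient comparison for polynomial functions, one variable at a time. Several indices
  may carry the same monomial, hence the sum over all indices with exponents
  \<open>e\<close>.\<close>

lemma sum_multivariate_monomials_eq_0:
  fixes c :: "'i \<Rightarrow> real" and k :: "'i \<Rightarrow> 'b \<Rightarrow> nat"
  assumes "finite B" "finite I" "\<And>t. (\<Sum>i\<in>I. c i * (\<Prod>b\<in>B. t b ^ k i b)) = 0"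
  shows "(\<Sum>i\<in>{i \<in> I. \<forall>b\<in>B. k i b = e b}. c i) = 0"
  using assms
proof (induction B arbitrary: I rule: finite_induct)
  case empty
  then show ?case by simp
next
  case (insert b B)
  have "(\<Sum>i\<in>{i \<in> I. k i b = e b}. c i * (\<Prod>x\<in>B. t x ^ k i x)) = 0" for t
  proof (rule sum_monomials_eq_0)
    fix s
    have "(\<Prod>x\<in>insert b B. (t(b := s)) x ^ k i x) = s ^ k i b * (\<Prod>x\<in>B. t x ^ k i x)" for i
    proof -
      have "(\<Prod>x\<in>B. (t(b := s)) x ^ k i x) = (\<Prod>x\<in>B. t x ^ k i x)"
        using insert.hyps by (intro prod.cong) auto
      then show ?thesis using insert.hyps by simp
    qed
    then show "(\<Sum>i\<in>I. c i * (\<Prod>x\<in>B. t x ^ k i x) * s ^ k i b) = 0"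
      using insert.prems(2)[of "t(b := s)"] by (simp add: mult_ac)
  qed fact
  then have "(\<Sum>i\<in>{i \<in> {i \<in> I. k i b = e b}. \<forall>x\<in>B. k i x = e x}. c i) = 0"
    using insert.prems(1) by (intro insert.IH) auto
  moreover have "{i \<in> {i \<in> I. k i b = e b}. \<forall>x\<in>B. k i x = e x} =
      {i \<in> I. \<forall>x\<in>insert b B. k i x = e x}" by auto
  ultimately show ?case by simp
qed

lemma indep_scale:
  assumes "indep I x" "\<And>t. s t \<noteq> 0" "\<And>i t. i \<in> I \<Longrightarrow> z i t = s t * x i t"
  shows "indep I z"
  unfolding indep_def
proof (intro allI impI)
  fix a assume a: "\<forall>t. (\<Sum>i\<in>I. a i * z i t) = 0"
  have "(\<Sum>i\<in>I. a i * x i t) = 0" for t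
  proof -
    have "s t * (\<Sum>i\<in>I. a i * x i t) = (\<Sum>i\<in>I. a i * z i t)"
      unfolding sum_distrib_left by (intro sum.cong) (auto simp: assms(3))
    then show ?thesis using a assms(2)[of t] by simp
  qed
  then show "\<forall>i\<in>I. a i = 0" using indepD[OF assms(1)] by blast
qed

lemma indep_inj:
  assumes "finite I" "indep I (\<lambda>i. x (f i))"
  shows "inj_on f I"
proof (rule inj_onI, rule ccontr)
  fix i j assume ij: "i \<in> I" "j \<in> I" "f i = f j" "i \<noteq> j"
  define a :: "'a \<Rightarrow> real" where "a l = (if l = i then 1 else if l = j then -1 else 0)" for l
  have "(\<Sum>l\<in>I. a l * x (f l) t) = 0" for t
  proof -
    have "(\<Sum>l\<in>I. a l * x (f l) t) = (\<Sum>l\<in>{i, j}. a l * x (f l) t)"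
      using ij assms(1) by (intro sum.mono_neutral_right) (auto simp: a_def)
    also have "\<dots> = 0" using ij by (simp add: a_def)
    finally show ?thesis .
  qed
  then have "a i = 0" using indepD[OF assms(2), of a i] ij by blast
  then show False by (simp add: a_def)
qed

text \<open>Independence of the indexed family forces \<open>f\<close> to be injective, so its image
  is an independent set of fillings of the same size.\<close>

lemma wdim_ge_family:
  assumes "finite Q" "finite I" "\<And>i. i \<in> I \<Longrightarrow> f i \<in> fillings Q \<alpha>" "indep I (\<lambda>i. minors Q D (f i))"
  shows "card I \<le> wdim Q D \<alpha>"
proof -
  have inj: "inj_on f I" using indep_inj assms(2,4) by blast
  have "indep (f ` I) (minors Q D)"
    unfolding indep_def
  proof (intro allI impI)
    fix a assume "\<forall>t. (\<Sum>C\<in>f ` I. a C * minors Q D C t) = 0"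
    then have "(\<Sum>i\<in>I. a (f i) * minors Q D (f i) t) = 0" for t
      by (simp add: sum.reindex[OF inj])
    then show "\<forall>C\<in>f ` I. a C = 0" using indepD[OF assms(4), of "\<lambda>i. a (f i)"] by blast
  qed
  then have "card (f ` I) \<le> wdim Q D \<alpha>" using assms by (intro wdim_ge) auto
  then show ?thesis by (simp add: card_image[OF inj])
qed

lemma mset_del: "p < length X \<Longrightarrow> mset X = add_mset (X ! p) (mset (del p X))"
  unfolding del_def by (metis add_mset_add_single append_Cons id_take_nth_drop mset.simps(2) mset_append union_mset_add_mset_right)

text \<open>The products of minors for \<open>D\<close> are expanded along their smallest row \<open>m\<close>. The monomial
  in the entries of that row which is indexed by \<open>st E\<close> occurs for \<open>E\<close> itself with coefficient
  a product of minors for \<open>DE E\<close>, and otherwise only for larger \<open>E'\<close>.\<close>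
lemma wdim_first_row:
  fixes D :: "nat \<Rightarrow> nat list" and DE :: "'e \<Rightarrow> nat \<Rightarrow> nat list" and \<rho> :: "'e \<Rightarrow> nat"
    and cut :: "'e \<Rightarrow> nat set" and st :: "'e \<Rightarrow> nat \<Rightarrow> nat"
  assumes fin: "finite Q" "finite S"
    and cut: "\<And>E. E \<in> S \<Longrightarrow> cut E \<subseteq> Q" "\<And>E. E \<in> S \<Longrightarrow> card (cut E) = Poly_Mapping.lookup \<alpha> m"
    and D: "\<And>q. q \<in> Q \<Longrightarrow> distinct (D q)" "\<And>q d. q \<in> Q \<Longrightarrow> d \<in> set (D q) \<Longrightarrow> m \<le> d"
    and DE_cut: "\<And>E q. E \<in> S \<Longrightarrow> q \<in> cut E \<Longrightarrow> mset (D q) = add_mset (st E q) (mset (DE E q))"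
    and DE: "\<And>E q. E \<in> S \<Longrightarrow> q \<in> Q \<Longrightarrow> q \<notin> cut E \<Longrightarrow> mset (D q) = mset (DE E q)"
    and \<alpha>: "\<And>l. l \<noteq> m \<Longrightarrow> Poly_Mapping.lookup \<alpha>' l = Poly_Mapping.lookup \<alpha> l"
      "\<And>l. l \<le> m \<Longrightarrow> Poly_Mapping.lookup \<alpha>' l = 0"
    and tri: "\<And>E E' \<beta>. E \<in> S \<Longrightarrow> E' \<in> S \<Longrightarrow> (\<And>q. q \<in> cut E' \<Longrightarrow> \<beta> q \<in> set (D q)) \<Longrightarrow>
        (\<And>b. b \<noteq> m \<Longrightarrow> card {q \<in> cut E'. \<beta> q = b} = card {q \<in> cut E. st E q = b}) \<Longrightarrow>
        (E = E' \<and> (\<forall>q\<in>cut E. \<beta> q = st E q)) \<or> \<rho> E < \<rho> E'"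
  shows "(\<Sum>E\<in>S. wdim Q (DE E) \<alpha>') \<le> wdim Q D \<alpha>"
proof -
  have "\<forall>E. \<exists>J. J \<subseteq> fillings Q \<alpha>' \<and> finite J \<and> indep J (minors Q (DE E)) \<and> card J = wdim Q (DE E) \<alpha>'"
    using wdim_basis[OF fin(1)] by metis
  then obtain J where J: "\<And>E. J E \<subseteq> fillings Q \<alpha>'" "\<And>E. finite (J E)"
      "\<And>E. indep (J E) (minors Q (DE E))" "\<And>E. card (J E) = wdim Q (DE E) \<alpha>'"
    by metis
  define e where "e E C q = (if q \<in> cut E then insert m (C q) else C q)" for E :: 'e and C :: "nat \<Rightarrow> nat set" and q
  \<comment> \<open>All rows in \<open>C\<close> exceed \<open>m\<close>, so an inserted
    \<open>m\<close> becomes the first row and the expansion along it needs no extra sign.\<close>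
  have C_gt: "m < l" if "C \<in> J E" "l \<in> C q" for C E l q
  proof (rule ccontr)
    assume "\<not> m < l"
    then have "Poly_Mapping.lookup \<alpha>' l = 0" using \<alpha>(2) by simp
    then have "l \<notin> Poly_Mapping.keys \<alpha>'" by (simp add: in_keys_iff)
    then show False using fillings_subset_keys[of C Q \<alpha>' q] that J(1) fin(1) by blast
  qed
  have C_fin: "finite (C q)" if "C \<in> J E" for C E q
    using finite_filling[OF _ fin(1)] that J(1) by blast
  have fill: "e E C \<in> fillings Q \<alpha>" if "E \<in> S" "C \<in> J E" for E C
  proof -
    have C: "\<And>q. q \<notin> Q \<Longrightarrow> C q = {}" "\<And>l. card {q \<in> Q. l \<in> C q} = Poly_Mapping.lookup \<alpha>' l"
      using subsetD[OF J(1) that(2)] by (auto simp: fillings_def)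
    have "card {q \<in> Q. l \<in> e E C q} = Poly_Mapping.lookup \<alpha> l" for l
    proof (cases "l = m")
      case True
      then have "{q \<in> Q. l \<in> e E C q} = cut E"
        using cut(1)[OF that(1)] C_gt[OF that(2)] by (auto simp: e_def split: if_splits)
      then show ?thesis using True cut(2) that by simp
    next
      case False
      then have "{q \<in> Q. l \<in> e E C q} = {q \<in> Q. l \<in> C q}" by (auto simp: e_def)
      then show ?thesis using C(2) \<alpha>(1) False by simp
    qed
    moreover have "e E C q = {}" if "q \<notin> Q" for q
      using that C(1) cut(1)[OF \<open>E \<in> S\<close>] by (auto simp: e_def)
    ultimately show ?thesis by (auto simp: fillings_def)
  qed
  \<comment> \<open>A choice in \<open>PI E\<close> picks, in every cut column, the entry of row
    \<open>m\<close> used by the expansion; \<open>K\<close> below is the cofactor that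
    remains.\<close>
  define PI where "PI E = (\<Pi>\<^sub>E q\<in>cut E. {..<length (D q)})" for E
  have fcut: "finite (cut E)" if "E \<in> S" for E
    using cut(1)[OF that] fin(1) finite_subset by blast
  have fPI: "finite (PI E)" if "E \<in> S" for E
    unfolding PI_def using fcut[OF that] by (intro finite_PiE) auto
  define K where "K y E C \<beta> = (\<Prod>q\<in>cut E. (-1) ^ \<beta> q * minor (unitri y) (C q) (del (\<beta> q) (D q))) *
      (\<Prod>q\<in>Q - cut E. minor (unitri y) (C q) (D q))" for y E C and \<beta> :: "nat \<Rightarrow> nat"
  \<comment> \<open>The entry in row and column \<open>m\<close> is \<open>1\<close> and carries no
    variable. Hence a monomial does not record how often the column \<open>m\<close> is
    chosen.\<close>
  define V where "V = (\<Union>q\<in>Q. set (D q)) - {m}"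
  have fV: "finite V" using fin(1) by (simp add: V_def)
  define ex where "ex E \<beta> b = card {q \<in> cut E. D q ! \<beta> q = b}" for E and \<beta> :: "nat \<Rightarrow> nat" and b
  \<comment> \<open>Row \<open>m\<close> becomes a vector of independent variables \<open>t\<close>,
    while the other rows keep the values \<open>y\<close>.\<close>
  define sub where "sub y t l d = (if l = m then t d else y l d)" for y and t :: "nat \<Rightarrow> real" and l d :: nat
  have expand: "minors Q D (e E C) (sub y t) = (\<Sum>\<beta>\<in>PI E. K y E C \<beta> * (\<Prod>b\<in>V. t b ^ ex E \<beta> b))"
    if ES: "E \<in> S" "C \<in> J E" for E C y t
  proof -
    have other: "minor (unitri (sub y t)) (C q) X = minor (unitri y) (C q) X" for q X
      using C_gt[OF ES(2)] by (intro minor_row_cong) (fastforce simp: unitri_def sub_def)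
    have T: "unitri (sub y t) m b = (if b = m then 1 else t b)" if "m \<le> b" for b
      using that by (auto simp: unitri_def sub_def)
    have row: "minor (unitri (sub y t)) (insert m (C q)) (D q) =
        (\<Sum>p<length (D q). unitri (sub y t) m (D q ! p) * ((-1) ^ p * minor (unitri y) (C q) (del p (D q))))" for q
    proof -
      have "pos m (C q) = 0" "m \<notin> C q" using C_gt[OF ES(2)] by (fastforce simp: pos_def)+
      then show ?thesis
        using C_fin[OF ES(2)] by (simp add: minor_row_exp row_exp_def other mult_ac)
    qed
    have "minors Q D (e E C) (sub y t) = (\<Prod>q\<in>cut E. minor (unitri (sub y t)) (insert m (C q)) (D q)) *
       (\<Prod>q\<in>Q - cut E. minor (unitri y) (C q) (D q))"
    proof -
      have "minors Q D (e E C) (sub y t) = (\<Prod>q\<in>Q - cut E. minor (unitri (sub y t)) (e E C q) (D q)) *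
          (\<Prod>q\<in>cut E. minor (unitri (sub y t)) (e E C q) (D q))"
        unfolding minors_def using fin(1) cut(1)[OF ES(1)] by (rule prod.subset_diff[rotated])
      then show ?thesis by (simp add: e_def other mult.commute)
    qed
    also have "(\<Prod>q\<in>cut E. minor (unitri (sub y t)) (insert m (C q)) (D q)) =
       (\<Sum>\<beta>\<in>PI E. \<Prod>q\<in>cut E. unitri (sub y t) m (D q ! \<beta> q) * ((-1) ^ \<beta> q * minor (unitri y) (C q) (del (\<beta> q) (D q))))"
      unfolding row PI_def using fcut[OF ES(1)] by (intro prod_sum_PiE) auto
    also have "\<dots> * (\<Prod>q\<in>Q - cut E. minor (unitri y) (C q) (D q)) =
        (\<Sum>\<beta>\<in>PI E. K y E C \<beta> * (\<Prod>q\<in>cut E. unitri (sub y t) m (D q ! \<beta> q)))"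
      by (simp add: K_def prod.distrib sum_distrib_right sum_distrib_left mult_ac)
    also have "\<dots> = (\<Sum>\<beta>\<in>PI E. K y E C \<beta> * (\<Prod>b\<in>V. t b ^ ex E \<beta> b))"
    proof (intro sum.cong refl arg_cong2[where f = "(*)"])
      fix \<beta> assume \<beta>: "\<beta> \<in> PI E"
      have mem: "D q ! \<beta> q \<in> insert m V" "m \<le> D q ! \<beta> q" if "q \<in> cut E" for q
      proof -
        have "\<beta> q < length (D q)" using \<beta> that by (auto simp: PI_def)
        then have "D q ! \<beta> q \<in> set (D q)" "q \<in> Q" using that cut(1)[OF ES(1)] by auto
        then show "D q ! \<beta> q \<in> insert m V" "m \<le> D q ! \<beta> q"
          using D(2) by (auto simp: V_def)
      qed
      have "(\<Prod>q\<in>cut E. unitri (sub y t) m (D q ! \<beta> q)) =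
          (\<Prod>b\<in>insert m V. \<Prod>q\<in>{q \<in> cut E. D q ! \<beta> q = b}. unitri (sub y t) m (D q ! \<beta> q))"
        using mem(1) fcut[OF ES(1)] fV by (intro prod.group[symmetric]) auto
      also have "\<dots> = (\<Prod>b\<in>insert m V. unitri (sub y t) m b ^ ex E \<beta> b)"
        by (simp add: ex_def)
      also have "\<dots> = (\<Prod>b\<in>V. unitri (sub y t) m b ^ ex E \<beta> b)"
        using fV by (subst prod.insert) (auto simp: V_def unitri_def)
      also have "\<dots> = (\<Prod>b\<in>V. t b ^ ex E \<beta> b)"
        using D(2) by (intro prod.cong) (auto simp: V_def T)
      finally show "(\<Prod>q\<in>cut E. unitri (sub y t) m (D q ! \<beta> q)) = (\<Prod>b\<in>V. t b ^ ex E \<beta> b)" .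
    qed
    finally show ?thesis .
  qed
  define \<mu> where "\<mu> E b = card {q \<in> cut E. st E q = b}" for E b
  \<comment> \<open>The choices in \<open>E'\<close> that produce the monomial
    \<open>\<mu> E\<close> of \<open>st E\<close>. Thus \<open>\<xi> E E'\<close> extracts the
    coefficient of this monomial from a product belonging to \<open>E'\<close>.\<close>
  define M where "M E E' = {\<beta> \<in> PI E'. \<forall>b\<in>V. ex E' \<beta> b = \<mu> E b}" for E E'
  define \<xi> where "\<xi> E E' C y = (\<Sum>\<beta>\<in>M E E'. K y E' C \<beta>)" for E E' C y
  have st_in: "st E q \<in> set (D q)" if "E \<in> S" "q \<in> cut E" for E q
  proof -
    have "st E q \<in># mset (D q)" using DE_cut[OF that] by simp
    then show ?thesis by simp
  qed
  have match: "(E = E' \<and> (\<forall>q\<in>cut E. D q ! \<beta> q = st E q)) \<or> \<rho> E < \<rho> E'"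
    if "E \<in> S" "E' \<in> S" "\<beta> \<in> M E E'" for E E' \<beta>
  proof (rule tri[OF that(1,2)])
    have \<beta>: "\<beta> q < length (D q)" if "q \<in> cut E'" for q
      using \<open>\<beta> \<in> M E E'\<close> that by (auto simp: M_def PI_def)
    then show "D q ! \<beta> q \<in> set (D q)" if "q \<in> cut E'" for q using that by simp
    show "card {q \<in> cut E'. D q ! \<beta> q = b} = card {q \<in> cut E. st E q = b}" if "b \<noteq> m" for b
    proof (cases "b \<in> V")
      case True
      then show ?thesis using \<open>\<beta> \<in> M E E'\<close> by (simp add: M_def ex_def \<mu>_def)
    next
      case False
      then have no: "b \<notin> set (D q)" if "q \<in> Q" for q using that \<open>b \<noteq> m\<close> by (auto simp: V_def)
      have "{q \<in> cut E'. D q ! \<beta> q = b} = {}"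
        using no cut(1)[OF \<open>E' \<in> S\<close>] \<beta> by (auto dest!: nth_mem)
      moreover have "{q \<in> cut E. st E q = b} = {}"
        using no cut(1)[OF \<open>E \<in> S\<close>] st_in[OF \<open>E \<in> S\<close>] by auto
      ultimately show ?thesis by (simp only:)
    qed
  qed
  have "indep (SIGMA E:S. J E) (\<lambda>(E, C). minors Q D (e E C))"
  proof (rule indep_triangular[where \<xi> = \<xi> and \<rho> = \<rho>])
    show "finite S" "\<And>E. E \<in> S \<Longrightarrow> finite (J E)" using fin J by auto
  next
    fix E a y
    assume ES: "E \<in> S" and rel: "\<And>t. (\<Sum>E'\<in>S. \<Sum>C\<in>J E'. a E' C * minors Q D (e E' C) t) = 0"
    define I where "I = (SIGMA E':S. J E' \<times> PI E')"
    have fI: "finite I" unfolding I_def using fin J fPI by auto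
    define c where "c = (\<lambda>(E', C, \<beta>). a E' C * K y E' C \<beta>)"
    define ek where "ek = (\<lambda>(E', C :: nat \<Rightarrow> nat set, \<beta>). ex E' \<beta>)"
    have "(\<Sum>i\<in>{i \<in> I. \<forall>b\<in>V. ek i b = \<mu> E b}. c i) = 0"
    proof (rule sum_multivariate_monomials_eq_0[OF fV fI])
      fix t
      have "(\<Sum>i\<in>I. c i * (\<Prod>b\<in>V. t b ^ ek i b)) =
          (\<Sum>E'\<in>S. \<Sum>C\<in>J E'. \<Sum>\<beta>\<in>PI E'. a E' C * K y E' C \<beta> * (\<Prod>b\<in>V. t b ^ ex E' \<beta> b))"
        unfolding I_def c_def ek_def using fin J fPI
        by (simp add: sum.Sigma sum.cartesian_product case_prod_beta)
      also have "\<dots> = (\<Sum>E'\<in>S. \<Sum>C\<in>J E'. a E' C * minors Q D (e E' C) (sub y t))"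
        by (intro sum.cong) (auto simp: expand sum_distrib_left mult_ac)
      finally show "(\<Sum>i\<in>I. c i * (\<Prod>b\<in>V. t b ^ ek i b)) = 0" using rel by simp
    qed
    moreover have "{i \<in> I. \<forall>b\<in>V. ek i b = \<mu> E b} = (SIGMA E':S. J E' \<times> M E E')"
      by (auto simp: I_def ek_def M_def)
    moreover have "finite (M E E')" if "E' \<in> S" for E' using fPI[OF that] by (simp add: M_def)
    ultimately show "(\<Sum>E'\<in>S. \<Sum>C\<in>J E'. a E' C * \<xi> E E' C y) = 0"
      using fin J(2) by (simp add: sum.Sigma sum.cartesian_product c_def case_prod_beta \<xi>_def sum_distrib_left)
  next
    fix E assume ES: "E \<in> S"
    define \<beta>0 where "\<beta>0 = (\<lambda>q\<in>cut E. (THE p. p < length (D q) \<and> D q ! p = st E q))"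
    have \<beta>0: "\<beta>0 q < length (D q)" "D q ! \<beta>0 q = st E q" if "q \<in> cut E" for q
    proof -
      have "q \<in> Q" using cut(1) ES that by blast
      have "\<exists>!p. p < length (D q) \<and> D q ! p = st E q"
        using distinct_Ex1[OF D(1)[OF \<open>q \<in> Q\<close>] st_in[OF ES that]] .
      from theI'[OF this] show "\<beta>0 q < length (D q)" "D q ! \<beta>0 q = st E q" using that by (auto simp: \<beta>0_def)
    qed
    \<comment> \<open>For \<open>E\<close> itself \<open>tri\<close> leaves only the choice
      \<open>st E\<close>, and the boxes of a column are distinct, so their positions are
      determined.\<close>
    have "M E E = {\<beta>0}"
    proof (intro equalityI subsetI)
      fix \<beta> assume \<beta>: "\<beta> \<in> M E E"
      then have "\<forall>q\<in>cut E. D q ! \<beta> q = st E q" using match[OF ES ES] by auto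
      then have "\<beta> q = \<beta>0 q" if "q \<in> cut E" for q
      proof -
        have "\<beta> q < length (D q)" using \<beta> that by (auto simp: M_def PI_def)
        moreover have "distinct (D q)" using D(1) cut(1)[OF ES] that by blast
        ultimately show ?thesis
          using \<beta>0[OF that] that \<open>\<forall>q\<in>cut E. D q ! \<beta> q = st E q\<close> nth_eq_iff_index_eq by metis
      qed
      moreover have "\<beta> \<in> PI E" "\<beta>0 \<in> PI E" using \<beta> \<beta>0(1) by (auto simp: M_def PI_def \<beta>0_def)
      ultimately have "\<beta> = \<beta>0" unfolding PI_def by (intro PiE_ext) auto
      then show "\<beta> \<in> {\<beta>0}" by simp
    next
      fix \<beta> assume "\<beta> \<in> {\<beta>0}"
      moreover have "{q \<in> cut E. D q ! \<beta>0 q = b} = {q \<in> cut E. st E q = b}" for b using \<beta>0 by auto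
      moreover have "\<beta>0 \<in> PI E" using \<beta>0(1) by (auto simp: PI_def \<beta>0_def)
      ultimately show "\<beta> \<in> M E E" by (simp add: M_def ex_def \<mu>_def)
    qed
    define D0 where "D0 q = (if q \<in> cut E then del (\<beta>0 q) (D q) else D q)" for q
    have "mset (D0 q) = mset (DE E q)" if "q \<in> Q" for q
    proof (cases "q \<in> cut E")
      case True
      then show ?thesis using mset_del[of "\<beta>0 q" "D q"] \<beta>0[of q] DE_cut[OF ES, of q] by (simp add: D0_def)
    next
      case False
      then show ?thesis using DE[OF ES that] by (simp add: D0_def)
    qed
    then obtain s where s: "\<And>y. s y \<noteq> 0"
        "\<And>C y. (\<And>q. q \<in> Q \<Longrightarrow> finite (C q)) \<Longrightarrow> minors Q D0 C y = s y * minors Q (DE E) C y"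
      using minors_perm[OF fin(1), of D0 "DE E"] by metis
    show "indep (J E) (\<xi> E E)"
    proof (rule indep_scale[OF J(3), of "\<lambda>y. (\<Prod>q\<in>cut E. (-1) ^ \<beta>0 q) * s y"])
      show "(\<Prod>q\<in>cut E. (-1) ^ \<beta>0 q) * s y \<noteq> 0" for y using s(1) fcut[OF ES] by simp
    next
      fix C y assume C: "C \<in> J E"
      have "minors Q D0 C y = (\<Prod>q\<in>Q - cut E. minor (unitri y) (C q) (D0 q)) *
          (\<Prod>q\<in>cut E. minor (unitri y) (C q) (D0 q))"
        unfolding minors_def using fin(1) cut(1)[OF ES] by (rule prod.subset_diff[rotated])
      also have "\<dots> = (\<Prod>q\<in>Q - cut E. minor (unitri y) (C q) (D q)) *
          (\<Prod>q\<in>cut E. minor (unitri y) (C q) (del (\<beta>0 q) (D q)))"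
        by (simp add: D0_def)
      finally have "\<xi> E E C y = (\<Prod>q\<in>cut E. (-1) ^ \<beta>0 q) * minors Q D0 C y"
        unfolding \<xi>_def \<open>M E E = {\<beta>0}\<close> K_def by (simp add: prod.distrib)
      then show "\<xi> E E C y = (\<Prod>q\<in>cut E. (-1) ^ \<beta>0 q) * s y * minors Q (DE E) C y"
        using s(2) C_fin[OF C] by simp
    qed
  next
    fix E E' C y
    assume "E \<in> S" "E' \<in> S" "E' \<noteq> E" "\<rho> E' \<le> \<rho> E"
    then have "M E E' = {}" using match[of E E'] by fastforce
    then show "\<xi> E E' C y = 0" by (simp add: \<xi>_def)
  qed
  then have "indep (SIGMA E:S. J E) (\<lambda>i. minors Q D (case i of (E, C) \<Rightarrow> e E C))"
    by (simp add: case_prod_unfold)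
  then have "card (SIGMA E:S. J E) \<le> wdim Q D \<alpha>"
    using fin J(2) fill by (intro wdim_ge_family[where f = "\<lambda>(E, C). e E C"]) (auto simp: case_prod_unfold)
  then show ?thesis using fin J by simp
qed

section \<open>Exchanging boxes between columns\<close>

text \<open>Moves one row from \<open>C0\<close> to \<open>C q\<close>, with signs. On products of
  minors this amounts to moving a box from column \<open>q\<close> to the extra column
  (\<open>Theta_Psi\<close>). The operator itself mentions no diagram, so it acts on arbitrary
  functions of \<open>C0\<close> and \<open>C\<close> and commutes with linear combinations.\<close>

definition Theta :: "nat \<Rightarrow> (nat set \<Rightarrow> (nat \<Rightarrow> nat set) \<Rightarrow> real) \<Rightarrow> nat set \<Rightarrow> (nat \<Rightarrow> nat set) \<Rightarrow> real" where
  "Theta q \<Psi> C0 C = (\<Sum>l\<in>C0 - C q. (-1) ^ pos l C0 * (-1) ^ pos l (C q) * \<Psi> (C0 - {l}) (C(q := insert l (C q))))"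

text \<open>An invariant of \<open>Theta\<close>. Besides finiteness, the fixed bound
  \<open>U\<close> leaves only finitely many possible \<open>C0\<close>, over which exterior basis
  vectors can be summed.\<close>

definition adm :: "nat set \<Rightarrow> nat set \<Rightarrow> (nat \<Rightarrow> nat set) \<Rightarrow> bool" where
  "adm U C0 C \<longleftrightarrow> finite U \<and> C0 \<subseteq> U \<and> (\<forall>q. finite (C q))"

definition Psi :: "nat set \<Rightarrow> (nat \<Rightarrow> nat \<Rightarrow> real) \<Rightarrow> (nat \<Rightarrow> nat list) \<Rightarrow> nat list \<Rightarrow> nat set \<Rightarrow> (nat \<Rightarrow> nat set) \<Rightarrow> real" where
  "Psi Q y D G C0 C = minor (unitri y) C0 G * minors Q D C y"

lemma adm_step: "adm U C0 C \<Longrightarrow> adm U (C0 - {l}) (C(q := insert l (C q)))"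
  by (auto simp: adm_def)

lemma Thetas_cong:
  "(\<And>C0 C. adm U C0 C \<Longrightarrow> \<Psi> C0 C = \<Psi>' C0 C) \<Longrightarrow> adm U C0 C \<Longrightarrow>
   fold Theta qs \<Psi> C0 C = fold Theta qs \<Psi>' C0 C"
proof (induction qs arbitrary: \<Psi> \<Psi>' C0 C)
  case (Cons q qs)
  have "Theta q \<Psi> C0 C = Theta q \<Psi>' C0 C" if "adm U C0 C" for C0 C
    unfolding Theta_def by (intro sum.cong refl) (simp only: Cons.prems(1)[OF adm_step[OF that]])
  then have "fold Theta qs (Theta q \<Psi>) C0 C = fold Theta qs (Theta q \<Psi>') C0 C"
    by (rule Cons.IH[OF _ Cons.prems(2)])
  then show ?case by simp
qed simp

lemma Thetas_sum:
  "fold Theta qs (\<lambda>C0 C. \<Sum>i\<in>I. a i * \<Psi> i C0 C) = (\<lambda>C0 C. \<Sum>i\<in>I. a i * fold Theta qs (\<Psi> i) C0 C)"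
proof (induction qs arbitrary: \<Psi>)
  case (Cons q qs)
  have "Theta q (\<lambda>C0 C. \<Sum>i\<in>I. a i * \<Psi> i C0 C) = (\<lambda>C0 C. \<Sum>i\<in>I. a i * Theta q (\<Psi> i) C0 C)"
    by (intro ext) (simp add: Theta_def sum_distrib_left mult_ac, rule sum.swap)
  then show ?case by (simp add: Cons)
qed simp

lemma Thetas_scale:
  "fold Theta qs (\<lambda>C0 C. a * \<Psi> C0 C) = (\<lambda>C0 C. a * fold Theta qs \<Psi> C0 C)"
  using Thetas_sum[of qs "\<lambda>_. a" "\<lambda>_. \<Psi>" "{()}"] by simp

lemma Thetas_zero: "fold Theta qs (\<lambda>C0 C. 0) C0 C = 0"
  using Thetas_scale[of qs 0 "\<lambda>_ _. 0"] by simp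

lemma Theta_Psi:
  assumes "finite Q" "q \<in> Q" "adm U C0 C"
  shows "Theta q (Psi Q y D G) C0 C =
    (\<Sum>p<length (D q). (-1) ^ p * Psi Q y (D(q := del p (D q))) (D q ! p # G) C0 C)"
proof -
  have fin: "finite C0" "finite (C q)" using assms(3) finite_subset by (auto simp: adm_def)
  define R where "R = (\<Prod>q\<in>Q - {q}. minor (unitri y) (C q) (D q))"
  have split: "minors Q D' C' y = minor (unitri y) (C' q) (D' q) * R"
    if "\<And>r. r \<noteq> q \<Longrightarrow> D' r = D r" "\<And>r. r \<noteq> q \<Longrightarrow> C' r = C r" for D' C'
    unfolding minors_def R_def using assms(1,2) that by (simp add: prod.remove[of Q q])
  have "Theta q (Psi Q y D G) C0 C = (\<Sum>l\<in>C0 - C q. (-1) ^ pos l C0 * (-1) ^ pos l (C q) *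
      (minor (unitri y) (C0 - {l}) G * minor (unitri y) (insert l (C q)) (D q))) * R"
    by (simp add: Theta_def Psi_def split sum_distrib_right sum_distrib_left mult_ac)
  also have "\<dots> = (\<Sum>p<length (D q). (-1) ^ p * (minor (unitri y) C0 (D q ! p # G) *
      minor (unitri y) (C q) (del p (D q)))) * R"
    by (simp only: minor_exchange[OF fin])
  also have "\<dots> = (\<Sum>p<length (D q). (-1) ^ p * Psi Q y (D(q := del p (D q))) (D q ! p # G) C0 C)"
    by (simp add: Psi_def split sum_distrib_right sum_distrib_left mult_ac del: minor.simps)
  finally show ?thesis .
qed

lemma del_append: "p < length xs \<Longrightarrow> del p (xs @ ys) = del p xs @ ys"
  by (simp add: del_def)

lemma length_del: "p < length xs \<Longrightarrow> length (del p xs) = length xs - 1"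
  by (simp add: del_def)

lemma minor_rev_del:
  assumes "finite C" "p < length As"
  shows "minor A C (rev (del p As) @ (As ! p) # G) = (-1) ^ p * minor A C (rev As @ G)"
proof -
  define R T where "R = rev (drop (Suc p) As)" and "T = rev (take p As)"
  have del: "rev (del p As) = R @ T" by (simp add: del_def R_def T_def)
  have As: "rev As = R @ As ! p # T"
    unfolding R_def T_def using assms(2) by (subst id_take_nth_drop[of p As]) auto
  have "length T = p" using assms(2) by (simp add: T_def)
  then show ?thesis
    unfolding del As
    using minor_move[OF assms(1), of A "R @ T" "As ! p" G] minor_move[OF assms(1), of A R "As ! p" "T @ G"]
    by (simp add: power_add mult_ac del: minor.simps)
qed

text \<open>A box of \<open>X\<close> contributes nothing when moved, since \<open>G\<close> already
  contains it. The boxes of \<open>As\<close> can be moved in any order, and by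
  \<open>minor_rev_del\<close> all orders give the same product including the sign; their number is
  the factorial.\<close>

lemma Thetas_block:
  assumes "finite Q" "q \<in> Q" "D q = As @ X" "set X \<subseteq> set G" "adm U C0 C"
  shows "fold Theta (replicate (length As) q) (Psi Q y D G) C0 C =
    fact (length As) * Psi Q y (D(q := X)) (rev As @ G) C0 C"
  using assms(3-)
proof (induction "length As" arbitrary: As D G C0 C)
  case 0
  then show ?case by (simp add: fun_upd_idem)
next
  case (Suc k)
  have len: "length As = Suc k" using Suc by simp
  have "Theta q (Psi Q y D G) C0 C =
      (\<Sum>p<length As. (-1) ^ p * Psi Q y (D(q := del p As @ X)) (As ! p # G) C0 C)"
    if adm: "adm U C0 C" for C0 C
  proof -
    have fC: "finite C0" using adm finite_subset by (auto simp: adm_def)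
    have "Psi Q y D' (D q ! p # G) C0 C = 0" if "p < length (D q)" "\<not> p < length As" for p D'
    proof -
      have "D q ! p \<in> set X" using that Suc.prems(1) by (simp add: nth_append)
      then have "minor (unitri y) C0 (D q ! p # G) = 0"
        using Suc.prems(2) by (intro minor_repeat[OF fC]) auto
      then show ?thesis by (simp add: Psi_def del: minor.simps)
    qed
    then have "(\<Sum>p<length (D q). (-1) ^ p * Psi Q y (D(q := del p (D q))) (D q ! p # G) C0 C) =
        (\<Sum>p<length As. (-1) ^ p * Psi Q y (D(q := del p As @ X)) (As ! p # G) C0 C)"
      using Suc.prems(1)
      by (intro sum.mono_neutral_cong_right) (auto simp: nth_append del_append simp del: minor.simps)
    then show ?thesis using Theta_Psi[OF assms(1,2) adm] by simp
  qed
  then have "fold Theta (replicate k q) (Theta q (Psi Q y D G)) C0 C =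
      fold Theta (replicate k q) (\<lambda>C0 C. \<Sum>p<length As. (-1) ^ p * Psi Q y (D(q := del p As @ X)) (As ! p # G) C0 C) C0 C"
    by (intro Thetas_cong[OF _ Suc.prems(3)]) auto
  also have "\<dots> = (\<Sum>p<length As. (-1) ^ p * fold Theta (replicate k q) (Psi Q y (D(q := del p As @ X)) (As ! p # G)) C0 C)"
    by (simp only: Thetas_sum)
  also have "\<dots> = (\<Sum>p<length As. fact k * Psi Q y (D(q := X)) (rev As @ G) C0 C)"
  proof (intro sum.cong refl)
    fix p assume "p \<in> {..<length As}"
    then have p: "p < length As" by simp
    have k: "k = length (del p As)" using p len by (simp add: length_del)
    have "fold Theta (replicate k q) (Psi Q y (D(q := del p As @ X)) (As ! p # G)) C0 C =
        fact k * Psi Q y (D(q := X)) (rev (del p As) @ (As ! p) # G) C0 C"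
      using Suc.hyps(1)[OF k, of "D(q := del p As @ X)" "As ! p # G" C0 C] Suc.prems(2,3) k by auto
    moreover have "finite C0" using Suc.prems(3) finite_subset by (auto simp: adm_def)
    ultimately show "(-1) ^ p * fold Theta (replicate k q) (Psi Q y (D(q := del p As @ X)) (As ! p # G)) C0 C =
        fact k * Psi Q y (D(q := X)) (rev As @ G) C0 C"
      by (simp add: Psi_def minor_rev_del p)
  qed
  also have "\<dots> = fact (Suc k) * Psi Q y (D(q := X)) (rev As @ G) C0 C"
    by (simp add: len algebra_simps)
  finally show ?case by (simp only: len replicate_Suc fold_simps)
qed

section \<open>Chains of box moves\<close>

definition moves :: "(nat \<Rightarrow> nat list) \<Rightarrow> nat list \<Rightarrow> nat list" where
  "moves A gs = concat (map (\<lambda>g. replicate (length (A g)) g) gs)"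

definition moved :: "(nat \<Rightarrow> nat list) \<Rightarrow> nat list \<Rightarrow> nat list" where
  "moved A gs = concat (map (\<lambda>g. rev (A g)) (rev gs))"

text \<open>Says that \<open>Thetas_block\<close> applies to each column of \<open>gs\<close> in
  turn: the boxes that stay in \<open>g\<close> are in the extra column when the turn of
  \<open>g\<close> comes, either from the start or moved there earlier.\<close>

definition movable :: "(nat \<Rightarrow> nat list) \<Rightarrow> (nat \<Rightarrow> nat list) \<Rightarrow> nat list \<Rightarrow> nat list \<Rightarrow> bool" where
  "movable A X gs G \<longleftrightarrow> (\<forall>xs g ys. gs = xs @ g # ys \<longrightarrow> set (X g) \<subseteq> set G \<union> (\<Union>h\<in>set xs. set (A h)))"

text \<open>The scalar is the product of the factorials from \<open>Thetas_block\<close>; it is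
  recorded as positive because it must not annihilate the independent family.\<close>

lemma Thetas_chain:
  assumes "finite Q"
  shows "set gs \<subseteq> Q \<Longrightarrow> distinct gs \<Longrightarrow> (\<And>g. g \<in> set gs \<Longrightarrow> D g = A g @ X g) \<Longrightarrow> movable A X gs G \<Longrightarrow>
    \<exists>c>0. \<forall>U C0 C. adm U C0 C \<longrightarrow> fold Theta (moves A gs) (Psi Q y D G) C0 C =
      c * Psi Q y (\<lambda>q. if q \<in> set gs then X q else D q) (moved A gs @ G) C0 C"
proof (induction gs arbitrary: D G)
  case Nil
  then show ?case by (intro exI[of _ 1]) (auto simp: moves_def moved_def)
next
  case (Cons g gs)
  define D1 where "D1 = D(g := X g)"
  have XG: "set (X g) \<subseteq> set G" using Cons.prems(4) unfolding movable_def by fastforce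
  have "movable A X gs (rev (A g) @ G)"
    unfolding movable_def
  proof (intro allI impI)
    fix xs h ys assume "gs = xs @ h # ys"
    then have "g # gs = (g # xs) @ h # ys" by simp
    then have "set (X h) \<subseteq> set G \<union> (\<Union>h\<in>set (g # xs). set (A h))"
      using Cons.prems(4) unfolding movable_def by blast
    then show "set (X h) \<subseteq> set (rev (A g) @ G) \<union> (\<Union>h\<in>set xs. set (A h))" by auto
  qed
  moreover have "D1 h = A h @ X h" if "h \<in> set gs" for h
    using Cons.prems that by (auto simp: D1_def)
  ultimately obtain c where c: "c > 0" "\<And>U C0 C. adm U C0 C \<Longrightarrow>
      fold Theta (moves A gs) (Psi Q y D1 (rev (A g) @ G)) C0 C =
      c * Psi Q y (\<lambda>q. if q \<in> set gs then X q else D1 q) (moved A gs @ rev (A g) @ G) C0 C"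
    using Cons.IH[of D1 "rev (A g) @ G"] Cons.prems by auto
  have D1: "(\<lambda>q. if q \<in> set gs then X q else D1 q) = (\<lambda>q. if q \<in> set (g # gs) then X q else D q)"
    by (auto simp: D1_def)
  have "fold Theta (moves A (g # gs)) (Psi Q y D G) C0 C =
      (fact (length (A g)) * c) * Psi Q y (\<lambda>q. if q \<in> set (g # gs) then X q else D q) (moved A (g # gs) @ G) C0 C"
    if adm: "adm U C0 C" for U C0 C
  proof -
    have "fold Theta (moves A (g # gs)) (Psi Q y D G) C0 C =
        fold Theta (moves A gs) (fold Theta (replicate (length (A g)) g) (Psi Q y D G)) C0 C"
      by (simp add: moves_def)
    also have "\<dots> = fold Theta (moves A gs) (\<lambda>C0 C. fact (length (A g)) * Psi Q y D1 (rev (A g) @ G) C0 C) C0 C"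
      using Thetas_block[of Q g D "A g" "X g" G] assms Cons.prems XG
      by (intro Thetas_cong[OF _ adm]) (auto simp: D1_def)
    also have "\<dots> = fact (length (A g)) * (c * Psi Q y (\<lambda>q. if q \<in> set gs then X q else D1 q) (moved A gs @ rev (A g) @ G) C0 C)"
      by (simp add: Thetas_scale c(2)[OF adm])
    also have "\<dots> = (fact (length (A g)) * c) * Psi Q y (\<lambda>q. if q \<in> set (g # gs) then X q else D q) (moved A (g # gs) @ G) C0 C"
      unfolding D1 by (simp add: moved_def)
    finally show ?thesis .
  qed
  moreover have "fact (length (A g)) * c > 0" using c(1) by simp
  ultimately show ?case by blast
qed

lemma moves_append: "moves A (xs @ ys) = moves A xs @ moves A ys"
  by (simp add: moves_def)

lemma set_moved: "set (moved A gs) = (\<Union>g\<in>set gs. set (A g))"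
  by (simp add: moved_def)

text \<open>Once the boxes of \<open>g\<close> have been moved, the extra column contains a box
  twice and the minor vanishes; later moves preserve zero.\<close>

lemma Thetas_chain_zero:
  assumes "finite Q" "set gs \<subseteq> Q" "distinct gs" "\<And>g. g \<in> set gs \<Longrightarrow> D g = A g @ X g"
    and gs: "gs = xs @ g # ys" and "movable A X (xs @ [g]) G" "set (A g) \<inter> set G \<noteq> {}" "adm U C0 C"
  shows "fold Theta (moves A gs) (Psi Q y D G) C0 C = 0"
proof -
  obtain c where c: "\<And>U C0 C. adm U C0 C \<Longrightarrow> fold Theta (moves A (xs @ [g])) (Psi Q y D G) C0 C =
      c * Psi Q y (\<lambda>q. if q \<in> set (xs @ [g]) then X q else D q) (moved A (xs @ [g]) @ G) C0 C"
    using Thetas_chain[of Q "xs @ [g]" D A X G y] assms by auto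
  have "\<not> distinct (moved A (xs @ [g]) @ G)" using assms(7) by (auto simp: set_moved)
  then have "Psi Q y D' (moved A (xs @ [g]) @ G) C0 C = 0" if "adm U C0 C" for D' C0 C
    using that finite_subset minor_not_distinct[of C0 "moved A (xs @ [g]) @ G"] by (auto simp: Psi_def adm_def)
  then have z: "fold Theta (moves A (xs @ [g])) (Psi Q y D G) C0 C = 0" if "adm U C0 C" for C0 C
    using c[OF that] that by simp
  have "fold Theta (moves A gs) (Psi Q y D G) C0 C =
      fold Theta (moves A ys) (fold Theta (moves A (xs @ [g])) (Psi Q y D G)) C0 C"
    using moves_append[of A "xs @ [g]" ys] by (simp add: gs)
  also have "\<dots> = fold Theta (moves A ys) (\<lambda>_ _. 0) C0 C"
    using z by (intro Thetas_cong[OF _ assms(8)]) auto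
  finally show ?thesis by (simp add: Thetas_zero)
qed

definition bsum :: "nat set \<Rightarrow> (nat \<Rightarrow>\<^sub>0 nat)" where
  "bsum B = (\<Sum>l\<in>B. Poly_Mapping.single l 1)"

lemma lookup_bsum: "finite B \<Longrightarrow> Poly_Mapping.lookup (bsum B) l = (if l \<in> B then 1 else 0)"
  by (induction B rule: finite_induct) (auto simp: bsum_def lookup_add lookup_single when_def)

definition in_span :: "'k set \<Rightarrow> ('k \<Rightarrow> 't \<Rightarrow> real) \<Rightarrow> ('t \<Rightarrow> real) \<Rightarrow> bool" where
  "in_span K z v \<longleftrightarrow> (\<exists>c. \<forall>t. v t = (\<Sum>k\<in>K. c k * z k t))"

lemma in_span_sum:
  assumes "\<And>i. i \<in> I \<Longrightarrow> in_span K z (v i)"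
  shows "in_span K z (\<lambda>t. \<Sum>i\<in>I. a i * v i t)"
proof -
  have "\<forall>i\<in>I. \<exists>c. \<forall>t. v i t = (\<Sum>k\<in>K. c k * z k t)" using assms by (simp add: in_span_def)
  then obtain c where c: "\<And>i t. i \<in> I \<Longrightarrow> v i t = (\<Sum>k\<in>K. c i k * z k t)" by metis
  have "(\<Sum>i\<in>I. a i * v i t) = (\<Sum>k\<in>K. (\<Sum>i\<in>I. a i * c i k) * z k t)" for t
  proof -
    have "(\<Sum>i\<in>I. a i * v i t) = (\<Sum>i\<in>I. \<Sum>k\<in>K. a i * c i k * z k t)"
      by (intro sum.cong) (auto simp: c sum_distrib_left mult.assoc)
    also have "\<dots> = (\<Sum>k\<in>K. (\<Sum>i\<in>I. a i * c i k) * z k t)"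
      by (subst sum.swap) (simp add: sum_distrib_right)
    finally show ?thesis .
  qed
  then show ?thesis unfolding in_span_def by (intro exI[of _ "\<lambda>k. \<Sum>i\<in>I. a i * c i k"]) simp
qed

lemma indep_nonzero:
  assumes "finite I" "indep I x" "i \<in> I"
  obtains t where "x i t \<noteq> 0"
proof (rule ccontr)
  assume "\<not> thesis"
  then have "x i t = 0" for t using that by blast
  then have "(\<Sum>j\<in>I. (if j = i then 1 else 0) * x j t) = 0" for t
    by (intro sum.neutral) auto
  then show False using indepD[OF assms(2), of "\<lambda>j. if j = i then 1 else 0" i] assms(3) by simp
qed

text \<open>The rows of \<open>C0\<close> and of \<open>C\<close> together have weight
  \<open>\<alpha>\<close>. As \<open>Theta\<close> only transports rows, the weight is preserved
  (\<open>balanced_step\<close>).\<close>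

definition balanced :: "nat set \<Rightarrow> (nat \<Rightarrow>\<^sub>0 nat) \<Rightarrow> nat set \<Rightarrow> (nat \<Rightarrow> nat set) \<Rightarrow> bool" where
  "balanced Q \<alpha> C0 C \<longleftrightarrow> (\<forall>q. q \<notin> Q \<longrightarrow> C q = {}) \<and>
     (\<forall>l. (if l \<in> C0 then 1 else 0) + card {q \<in> Q. l \<in> C q} = Poly_Mapping.lookup \<alpha> l)"

lemma balanced_keys: "balanced Q \<alpha> C0 C \<Longrightarrow> C0 \<subseteq> Poly_Mapping.keys \<alpha>"
proof
  fix l assume "balanced Q \<alpha> C0 C" "l \<in> C0"
  then have "1 + card {q \<in> Q. l \<in> C q} = Poly_Mapping.lookup \<alpha> l" unfolding balanced_def by (metis (full_types))
  then show "l \<in> Poly_Mapping.keys \<alpha>" by (simp add: in_keys_iff)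
qed

lemma balanced_filling:
  assumes "balanced Q \<alpha> C0 C"
  shows "C \<in> fillings Q (\<alpha> - bsum C0)"
proof -
  have "finite C0" by (rule finite_subset[OF balanced_keys[OF assms] finite_keys])
  then have "card {q \<in> Q. l \<in> C q} = Poly_Mapping.lookup (\<alpha> - bsum C0) l" for l
  proof -
    have "(if l \<in> C0 then 1 else 0) + card {q \<in> Q. l \<in> C q} = Poly_Mapping.lookup \<alpha> l"
      using assms by (simp add: balanced_def)
    then show ?thesis using \<open>finite C0\<close> by (auto simp: lookup_minus lookup_bsum split: if_splits)
  qed
  then show ?thesis using assms by (simp add: fillings_def balanced_def)
qed

lemma balanced_step:
  assumes "finite Q" "q \<in> Q" "l \<in> C0 - C q" "balanced Q \<alpha> C0 C"
  shows "balanced Q \<alpha> (C0 - {l}) (C(q := insert l (C q)))"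
proof -
  have "(if k \<in> C0 - {l} then 1 else 0) + card {r \<in> Q. k \<in> (C(q := insert l (C q))) r} =
      Poly_Mapping.lookup \<alpha> k" for k
  proof -
    have b: "(if k \<in> C0 then 1 else 0) + card {r \<in> Q. k \<in> C r} = Poly_Mapping.lookup \<alpha> k"
      using assms(4) by (simp add: balanced_def)
    show ?thesis
    proof (cases "k = l")
      case True
      have "{r \<in> Q. l \<in> (C(q := insert l (C q))) r} = insert q {r \<in> Q. l \<in> C r}"
        using assms(2) by auto
      moreover have "card (insert q {r \<in> Q. l \<in> C r}) = Suc (card {r \<in> Q. l \<in> C r})"
        using assms by (intro card_insert_disjoint) auto
      ultimately show ?thesis using b True assms(3) by simp
    next
      case False
      then have "{r \<in> Q. k \<in> (C(q := insert l (C q))) r} = {r \<in> Q. k \<in> C r}" by auto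
      then show ?thesis using b False by simp
    qed
  qed
  then show ?thesis using assms(2,4) by (auto simp: balanced_def)
qed

lemma Thetas_in_span:
  assumes "finite Q"
  shows "set qs \<subseteq> Q \<Longrightarrow> (\<And>C0 C. balanced Q \<alpha> C0 C \<Longrightarrow> in_span K z (\<lambda>t. \<Psi> t C0 C)) \<Longrightarrow>
    balanced Q \<alpha> C0 C \<Longrightarrow> in_span K z (\<lambda>t. fold Theta qs (\<Psi> t) C0 C)"
proof (induction qs arbitrary: \<Psi> C0 C)
  case (Cons q qs)
  have "in_span K z (\<lambda>t. Theta q (\<Psi> t) C0 C)" if "balanced Q \<alpha> C0 C" for C0 C
    unfolding Theta_def
  proof (rule in_span_sum)
    fix l assume "l \<in> C0 - C q"
    then show "in_span K z (\<lambda>t. \<Psi> t (C0 - {l}) (C(q := insert l (C q))))"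
      using Cons.prems(1) by (intro Cons.prems(2) balanced_step assms that) auto
  qed
  then have "in_span K z (\<lambda>t. fold Theta qs (Theta q (\<Psi> t)) C0 C)"
    using Cons.prems(1,3) by (intro Cons.IH) auto
  then show ?case by simp
qed simp

text \<open>The exchange operators are applied to the tensor product of an exterior algebra, in which the
  subset \<open>B\<close> indexes a basis vector, and the module of \<open>Du\<close>; evaluating the exterior factor at
  the column \<open>Gl G\<close> detects the module of \<open>Dw G\<close>.\<close>
lemma wdim_pieri:
  fixes gs Gl :: "'g \<Rightarrow> nat list" and A X Dw :: "'g \<Rightarrow> nat \<Rightarrow> nat list" and \<rho> :: "'g \<Rightarrow> nat"
  assumes fin: "finite Q" "finite S" and N: "N \<notin> Q"
    and gs: "\<And>G. G \<in> S \<Longrightarrow> set (gs G) \<subseteq> Q" "\<And>G. G \<in> S \<Longrightarrow> distinct (gs G)"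
    and Du: "\<And>G g. G \<in> S \<Longrightarrow> g \<in> set (gs G) \<Longrightarrow> mset (Du g) = mset (A G g @ X G g)"
    and mov: "\<And>G. G \<in> S \<Longrightarrow> movable (A G) (X G) (gs G) (Gl G)"
    and Dw: "\<And>G q. G \<in> S \<Longrightarrow> q \<in> Q \<Longrightarrow> mset (Dw G q) = mset (if q \<in> set (gs G) then X G q else Du q)"
      "\<And>G. G \<in> S \<Longrightarrow> mset (Dw G N) = mset (moved (A G) (gs G) @ Gl G)"
    and tri: "\<And>G G'. G \<in> S \<Longrightarrow> G' \<in> S \<Longrightarrow> G \<noteq> G' \<Longrightarrow> \<rho> G \<le> \<rho> G' \<Longrightarrow>
      (\<exists>xs g ys. gs G = xs @ g # ys \<and> movable (A G) (X G) (xs @ [g]) (Gl G') \<and> set (A G g) \<inter> set (Gl G') \<noteq> {}) \<or>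
      (movable (A G) (X G) (gs G) (Gl G') \<and> length (Gl G') \<noteq> length (Gl G))"
  shows "(\<Sum>G\<in>S. wdim (insert N Q) (Dw G) \<alpha>) \<le> (\<Sum>B\<in>Pow (Poly_Mapping.keys \<alpha>). wdim Q Du (\<alpha> - bsum B))"
proof -
  define U where "U = Poly_Mapping.keys \<alpha>"
  have fU: "finite U" by (simp add: U_def)
  have fQN: "finite (insert N Q)" using fin by simp
  have "\<forall>G. \<exists>J. J \<subseteq> fillings (insert N Q) \<alpha> \<and> finite J \<and> indep J (minors (insert N Q) (Dw G)) \<and>
      card J = wdim (insert N Q) (Dw G) \<alpha>"
    using wdim_basis[OF fQN] by metis
  then obtain J where J: "\<And>G. J G \<subseteq> fillings (insert N Q) \<alpha>" "\<And>G. finite (J G)"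
      "\<And>G. indep (J G) (minors (insert N Q) (Dw G))" "\<And>G. card (J G) = wdim (insert N Q) (Dw G) \<alpha>"
    by metis
  have "\<forall>B. \<exists>J. J \<subseteq> fillings Q (\<alpha> - bsum B) \<and> finite J \<and> card J = wdim Q Du (\<alpha> - bsum B) \<and>
      (\<forall>C\<in>fillings Q (\<alpha> - bsum B). \<exists>c. \<forall>y. minors Q Du C y = (\<Sum>B\<in>J. c B * minors Q Du B y))"
  proof
    fix B
    show "\<exists>J. J \<subseteq> fillings Q (\<alpha> - bsum B) \<and> finite J \<and> card J = wdim Q Du (\<alpha> - bsum B) \<and>
      (\<forall>C\<in>fillings Q (\<alpha> - bsum B). \<exists>c. \<forall>y. minors Q Du C y = (\<Sum>B\<in>J. c B * minors Q Du B y))"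
    proof (rule wdim_basis[OF fin(1), where D = Du and \<alpha> = "\<alpha> - bsum B"], rule exI, intro conjI ballI)
    qed
  qed
  then obtain JB where JB: "\<And>B. finite (JB B)" "\<And>B. card (JB B) = wdim Q Du (\<alpha> - bsum B)"
      "\<And>B C. C \<in> fillings Q (\<alpha> - bsum B) \<Longrightarrow> \<exists>c. \<forall>y. minors Q Du C y = (\<Sum>C'\<in>JB B. c C' * minors Q Du C' y)"
    by metis
  \<comment> \<open>The basis vector \<open>C0\<close> of the exterior algebra tensored with the
    product of minors of \<open>C\<close>, written as a function of a subset and a matrix.\<close>
  define T where "T t C0 C = (if fst t = C0 then minors Q Du C (snd t) else 0)"
    for t :: "nat set \<times> (nat \<Rightarrow> nat \<Rightarrow> real)" and C0 C
  \<comment> \<open>The rows of the new column \<open>N\<close> start in the exterior factor, from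
    where the operators distribute some of them to the columns in \<open>Q\<close>.\<close>
  define x where "x G C t = fold Theta (moves (A G) (gs G)) (T t) (C N) (C(N := {}))" for G C t
  define \<xi> where "\<xi> G' G C y = fold Theta (moves (A G) (gs G)) (Psi Q y Du (Gl G')) (C N) (C(N := {}))" for G' G C y
  \<comment> \<open>Diagrams are given up to the order of boxes in a column. \<open>D1\<close> puts
    the boxes to be moved in front, at the price of a nonzero scalar; \<open>D2\<close> is what is
    left after the moves.\<close>
  define D1 where "D1 G q = (if q \<in> set (gs G) then A G q @ X G q else Du q)" for G q
  define D2 where "D2 G q = (if q \<in> set (gs G) then X G q else D1 G q)" for G q
  have C_adm: "adm U (C N) (C(N := {}))" if "C \<in> J G" for C G
    using fillings_subset_keys[OF subsetD[OF J(1) that] fQN] finite_subset[OF _ fU]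
    by (auto simp: adm_def fU) (auto simp: U_def)
  have D1: "D1 G g = A G g @ X G g" if "g \<in> set (gs G)" for G g using that by (simp add: D1_def)
  have s1: "\<exists>s. \<forall>y. s y \<noteq> (0::real) \<and> (\<forall>C0 C Gl. adm U C0 C \<longrightarrow> Psi Q y Du Gl C0 C = s y * Psi Q y (D1 G) Gl C0 C)"
    if "G \<in> S" for G
  proof -
    have "mset (Du q) = mset (D1 G q)" if "q \<in> Q" for q using Du[OF \<open>G \<in> S\<close>] by (simp add: D1_def)
    then obtain s where "\<And>y. s y \<noteq> 0" "\<And>C y. (\<And>q. q \<in> Q \<Longrightarrow> finite (C q)) \<Longrightarrow> minors Q Du C y = s y * minors Q (D1 G) C y"
      using minors_perm[OF fin(1), of Du "D1 G"] by metis
    then show ?thesis by (intro exI[of _ s]) (simp add: Psi_def adm_def)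
  qed
  \<comment> \<open>\<open>\<xi> G'\<close> is the contraction of \<open>x\<close> with the minors
    of the column \<open>Gl G'\<close>, hence respects linear relations.\<close>
  have link: "\<xi> G' G C y = (\<Sum>B\<in>Pow U. minor (unitri y) B (Gl G') * x G C (B, y))" if "C \<in> J G" for G' G C y
  proof -
    have "\<xi> G' G C y = fold Theta (moves (A G) (gs G))
        (\<lambda>C0 C. \<Sum>B\<in>Pow U. minor (unitri y) B (Gl G') * T (B, y) C0 C) (C N) (C(N := {}))"
      unfolding \<xi>_def
    proof (rule Thetas_cong[OF _ C_adm[OF that]])
      fix C0 C assume "adm U C0 C"
      then have "C0 \<in> Pow U" by (simp add: adm_def)
      have "(\<Sum>B\<in>Pow U. minor (unitri y) B (Gl G') * T (B, y) C0 C) =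
          (\<Sum>B\<in>{C0}. minor (unitri y) B (Gl G') * T (B, y) C0 C)"
        using \<open>C0 \<in> Pow U\<close> fU by (intro sum.mono_neutral_right) (auto simp: T_def)
      then show "Psi Q y Du (Gl G') C0 C = (\<Sum>B\<in>Pow U. minor (unitri y) B (Gl G') * T (B, y) C0 C)"
        by (simp add: T_def Psi_def)
    qed
    then show ?thesis by (simp only: Thetas_sum x_def)
  qed
  have ind: "indep (SIGMA G:S. J G) (\<lambda>(G, C). x G C)"
  proof (rule indep_triangular[where \<xi> = \<xi> and \<rho> = \<rho>])
    show "finite S" "\<And>G. G \<in> S \<Longrightarrow> finite (J G)" using fin J by auto
  next
    fix G' a y
    assume rel: "\<And>t. (\<Sum>G\<in>S. \<Sum>C\<in>J G. a G C * x G C t) = 0"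
    have "(\<Sum>G\<in>S. \<Sum>C\<in>J G. a G C * \<xi> G' G C y) =
        (\<Sum>G\<in>S. \<Sum>C\<in>J G. \<Sum>B\<in>Pow U. minor (unitri y) B (Gl G') * (a G C * x G C (B, y)))"
      by (intro sum.cong) (auto simp: link sum_distrib_left mult_ac)
    also have "\<dots> = (\<Sum>G\<in>S. \<Sum>B\<in>Pow U. minor (unitri y) B (Gl G') * (\<Sum>C\<in>J G. a G C * x G C (B, y)))"
      by (subst sum.swap) (simp add: sum_distrib_left)
    also have "\<dots> = (\<Sum>B\<in>Pow U. minor (unitri y) B (Gl G') * (\<Sum>G\<in>S. \<Sum>C\<in>J G. a G C * x G C (B, y)))"
      by (subst sum.swap) (simp add: sum_distrib_left)
    also have "\<dots> = 0" using rel by simp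
    finally show "(\<Sum>G\<in>S. \<Sum>C\<in>J G. a G C * \<xi> G' G C y) = 0" .
  next
    fix G assume GS: "G \<in> S"
    obtain s where s: "\<And>y. s y \<noteq> (0::real)" "\<And>y C0 C Gl. adm U C0 C \<Longrightarrow> Psi Q y Du Gl C0 C = s y * Psi Q y (D1 G) Gl C0 C"
      using s1[OF GS] by blast
    have "\<forall>y. \<exists>c>0. \<forall>U C0 C. adm U C0 C \<longrightarrow> fold Theta (moves (A G) (gs G)) (Psi Q y (D1 G) (Gl G)) C0 C =
      c * Psi Q y (D2 G) (moved (A G) (gs G) @ Gl G) C0 C"
      using Thetas_chain[OF fin(1) gs[OF GS], of "D1 G" "A G" "X G" "Gl G"] D1 mov[OF GS]
      unfolding D2_def[abs_def] by blast
    then obtain c where c: "\<And>y. c y > 0" "\<And>y U C0 C. adm U C0 C \<Longrightarrow>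
        fold Theta (moves (A G) (gs G)) (Psi Q y (D1 G) (Gl G)) C0 C = c y * Psi Q y (D2 G) (moved (A G) (gs G) @ Gl G) C0 C"
      by metis
    define D3 where "D3 q = (if q = N then moved (A G) (gs G) @ Gl G else D2 G q)" for q
    have "mset (D3 q) = mset (Dw G q)" if "q \<in> insert N Q" for q
      using that Dw[OF GS] N by (auto simp: D3_def D2_def D1_def)
    then obtain s2 where s2: "\<And>y. s2 y \<noteq> 0" "\<And>C y. (\<And>q. q \<in> insert N Q \<Longrightarrow> finite (C q)) \<Longrightarrow>
        minors (insert N Q) D3 C y = s2 y * minors (insert N Q) (Dw G) C y"
      using minors_perm[OF fQN, of D3 "Dw G"] by metis
    show "indep (J G) (\<xi> G G)"
    proof (rule indep_scale[OF J(3), of "\<lambda>y. s y * c y * s2 y"])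
      show "s y * c y * s2 y \<noteq> 0" for y using s(1)[of y] c(1)[of y] s2(1)[of y] by simp
    next
      fix C y assume CJ: "C \<in> J G"
      note adm = C_adm[OF CJ]
      have finC: "finite (C q)" for q using finite_filling[OF subsetD[OF J(1) CJ] fQN] .
      have "\<xi> G G C y = fold Theta (moves (A G) (gs G)) (\<lambda>C0 C. s y * Psi Q y (D1 G) (Gl G) C0 C) (C N) (C(N := {}))"
        unfolding \<xi>_def by (rule Thetas_cong[OF _ adm]) (rule s(2))
      also have "\<dots> = s y * (c y * Psi Q y (D2 G) (moved (A G) (gs G) @ Gl G) (C N) (C(N := {})))"
        by (simp only: Thetas_scale c(2)[OF adm])
      also have "Psi Q y (D2 G) (moved (A G) (gs G) @ Gl G) (C N) (C(N := {})) = minors (insert N Q) D3 C y"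
      proof -
        have "minors Q (D2 G) (C(N := {})) y = minors Q D3 C y"
          unfolding minors_def using N by (intro prod.cong) (auto simp: D3_def)
        then show ?thesis using fin(1) N by (simp add: Psi_def minors_def D3_def)
      qed
      also have "\<dots> = s2 y * minors (insert N Q) (Dw G) C y" using finC by (intro s2(2))
      finally show "\<xi> G G C y = s y * c y * s2 y * minors (insert N Q) (Dw G) C y" by simp
    qed
  next
    fix G' G C y
    assume as: "G' \<in> S" "G \<in> S" "G \<noteq> G'" "\<rho> G \<le> \<rho> G'" "C \<in> J G"
    note adm = C_adm[OF as(5)]
    obtain s where s: "\<And>y C0 C Gl. adm U C0 C \<Longrightarrow> Psi Q y Du Gl C0 C = s y * Psi Q y (D1 G) Gl C0 C"
      using s1[OF as(2)] by blast
    have "\<xi> G' G C y = fold Theta (moves (A G) (gs G)) (\<lambda>C0 C. s y * Psi Q y (D1 G) (Gl G') C0 C) (C N) (C(N := {}))"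
      unfolding \<xi>_def by (rule Thetas_cong[OF _ adm]) (rule s)
    then have eq: "\<xi> G' G C y = s y * fold Theta (moves (A G) (gs G)) (Psi Q y (D1 G) (Gl G')) (C N) (C(N := {}))"
      by (simp only: Thetas_scale)
    from tri[OF as(2,1,3,4)] show "\<xi> G' G C y = 0"
    proof (elim disjE exE conjE)
      fix xs g ys
      assume "gs G = xs @ g # ys" "movable (A G) (X G) (xs @ [g]) (Gl G')" "set (A G g) \<inter> set (Gl G') \<noteq> {}"
      then have "fold Theta (moves (A G) (gs G)) (Psi Q y (D1 G) (Gl G')) (C N) (C(N := {})) = 0"
        by (rule Thetas_chain_zero[OF fin(1) gs[OF as(2)] _ _ _ _ adm, rotated]) (rule D1)
      then show ?thesis by (simp add: eq)
    next
      assume mv: "movable (A G) (X G) (gs G) (Gl G')" "length (Gl G') \<noteq> length (Gl G)"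
      obtain c where c: "\<And>U C0 C. adm U C0 C \<Longrightarrow> fold Theta (moves (A G) (gs G)) (Psi Q y (D1 G) (Gl G')) C0 C =
        c * Psi Q y (D2 G) (moved (A G) (gs G) @ Gl G') C0 C"
        using Thetas_chain[OF fin(1) gs[OF as(2)], of "D1 G" "A G" "X G" "Gl G'" y] D1 mv(1)
        unfolding D2_def[abs_def] by blast
      \<comment> \<open>A member of an independent family is not the zero function, so
        \<open>C N\<close> has as many rows as the new column has boxes. With \<open>Gl G'\<close>
        of another length the minor is not square and vanishes.\<close>
      obtain y' where "minors (insert N Q) (Dw G) C y' \<noteq> 0"
        using indep_nonzero[OF J(2) J(3) as(5)] by blast
      then have "minor (unitri y') (C N) (Dw G N) \<noteq> 0"
        using fin(1) N by (simp add: minors_def)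
      then have "card (C N) = length (Dw G N)"
        using minor_card finite_filling[OF subsetD[OF J(1) as(5)] fQN] by blast
      also have "\<dots> = length (moved (A G) (gs G) @ Gl G)"
        using Dw(2)[OF as(2)] by (metis size_mset)
      finally have "minor (unitri y) (C N) (moved (A G) (gs G) @ Gl G') = 0"
        using mv(2) finite_filling[OF subsetD[OF J(1) as(5)] fQN] by (intro minor_card) auto
      then show ?thesis by (simp add: eq c[OF adm] Psi_def)
    qed
  qed
  \<comment> \<open>A spanning family for the \<open>\<alpha>\<close>-weight space of the tensor
    product: an exterior factor \<open>B\<close> leaves the weight \<open>\<alpha> - bsum B\<close>
    for the module.\<close>
  define K where "K = (SIGMA B:Pow U. JB B)"
  define z where "z k t = (if fst t = fst k then minors Q Du (snd k) (snd t) else 0)"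
    for k :: "nat set \<times> (nat \<Rightarrow> nat set)" and t :: "nat set \<times> (nat \<Rightarrow> nat \<Rightarrow> real)"
  have fK: "finite K" unfolding K_def using fU JB(1) by auto
  have base: "in_span K z (\<lambda>t. T t C0 C)" if bal: "balanced Q \<alpha> C0 C" for C0 C
  proof -
    have C0: "C0 \<in> Pow U" using balanced_keys[OF bal] by (simp add: U_def)
    obtain c where c: "\<And>y. minors Q Du C y = (\<Sum>C'\<in>JB C0. c C' * minors Q Du C' y)"
      using JB(3)[OF balanced_filling[OF bal]] by blast
    have "T t C0 C = (\<Sum>k\<in>K. (if fst k = C0 then c (snd k) else 0) * z k t)" for t
    proof -
      have "(\<Sum>k\<in>K. (if fst k = C0 then c (snd k) else 0) * z k t) =
          (\<Sum>B\<in>Pow U. \<Sum>C'\<in>JB B. (if B = C0 then c C' else 0) * z (B, C') t)"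
        unfolding K_def using fU JB(1) by (simp add: sum.Sigma case_prod_unfold)
      also have "\<dots> = (\<Sum>B\<in>{C0}. \<Sum>C'\<in>JB B. (if B = C0 then c C' else 0) * z (B, C') t)"
        using C0 fU by (intro sum.mono_neutral_right) auto
      also have "\<dots> = T t C0 C" by (auto simp: T_def z_def c)
      finally show ?thesis by simp
    qed
    then show ?thesis
      unfolding in_span_def by (intro exI[of _ "\<lambda>k. if fst k = C0 then c (snd k) else 0"] allI)
  qed
  have "card (SIGMA G:S. J G) \<le> card K"
  proof (rule indep_card_le_span[OF _ fK ind])
    show "finite (SIGMA G:S. J G)" using fin J(2) by auto
    fix j assume "j \<in> (SIGMA G:S. J G)"
    then obtain G C where j: "j = (G, C)" "G \<in> S" "C \<in> J G" by auto
    have C: "\<And>q. q \<notin> insert N Q \<Longrightarrow> C q = {}" "\<And>l. card {q \<in> insert N Q. l \<in> C q} = Poly_Mapping.lookup \<alpha> l"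
      using subsetD[OF J(1) j(3)] by (auto simp: fillings_def)
    have "(if l \<in> C N then 1 else 0) + card {q \<in> Q. l \<in> (C(N := {})) q} = Poly_Mapping.lookup \<alpha> l" for l
    proof -
      have "{q \<in> insert N Q. l \<in> C q} = (if l \<in> C N then {N} else {}) \<union> {q \<in> Q. l \<in> (C(N := {})) q}"
        using N by auto
      then have "card {q \<in> insert N Q. l \<in> C q} = (if l \<in> C N then 1 else 0) + card {q \<in> Q. l \<in> (C(N := {})) q}"
        using fin(1) N by (auto simp: card_insert_if)
      then show ?thesis using C(2) by simp
    qed
    then have "balanced Q \<alpha> (C N) (C(N := {}))" using C(1) by (auto simp: balanced_def)
    moreover have "set (moves (A G) (gs G)) \<subseteq> Q" using gs(1)[OF j(2)] by (auto simp: moves_def)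
    ultimately have "in_span K z (\<lambda>t. x G C t)"
      unfolding x_def by (intro Thetas_in_span[OF fin(1)] base)
    then show "\<exists>c. \<forall>t. (case j of (G, C) \<Rightarrow> x G C) t = (\<Sum>k\<in>K. c k * z k t)"
      by (simp add: in_span_def j(1))
  qed
  also have "card K = (\<Sum>B\<in>Pow U. card (JB B))" unfolding K_def using fU JB(1) by simp
  finally show ?thesis using fin(2) J(2,4) JB(2) by (simp add: U_def)
qed

section \<open>Polynomials and the nilCoxeter algebra\<close>

abbreviation adj_swap :: "nat \<Rightarrow> nat \<Rightarrow> nat" where
  "adj_swap i \<equiv> Transposition.transpose i (Suc i)"

section \<open>Substitution and the variables of a polynomial\<close>

lemma poly_mapping_sum_single:
  fixes p :: "'a \<Rightarrow>\<^sub>0 'b::comm_monoid_add"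
  assumes "finite K" "Poly_Mapping.keys p \<subseteq> K"
  shows "p = (\<Sum>m\<in>K. Poly_Mapping.single m (Poly_Mapping.lookup p m))"
proof (rule poly_mapping_eqI)
  fix k
  have "(\<Sum>m\<in>K. Poly_Mapping.lookup p m when m = k) = Poly_Mapping.lookup p k"
  proof (cases "k \<in> K")
    case True
    then show ?thesis using assms(1) by (simp add: when_def)
  next
    case False
    then show ?thesis using assms by (auto simp: when_def in_keys_iff)
  qed
  then show "Poly_Mapping.lookup p k = Poly_Mapping.lookup (\<Sum>m\<in>K. Poly_Mapping.single m (Poly_Mapping.lookup p m)) k"
    by (simp add: lookup_sum lookup_single)
qed

definition mon :: "(nat \<Rightarrow> mpoly) \<Rightarrow> (nat \<Rightarrow>\<^sub>0 nat) \<Rightarrow> mpoly" where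
  "mon s m = (\<Prod>j\<in>Poly_Mapping.keys m. s j ^ Poly_Mapping.lookup m j)"

lemma mon_superset:
  "finite K \<Longrightarrow> Poly_Mapping.keys m \<subseteq> K \<Longrightarrow> mon s m = (\<Prod>j\<in>K. s j ^ Poly_Mapping.lookup m j)"
  unfolding mon_def by (rule prod.mono_neutral_left) (auto simp: in_keys_iff)

lemma mon_zero [simp]: "mon s 0 = 1"
  by (simp add: mon_def)

lemma mon_add: "mon s (m + m') = mon s m * mon s m'"
proof -
  define K where "K = Poly_Mapping.keys m \<union> Poly_Mapping.keys m'"
  have K: "finite K" "Poly_Mapping.keys m \<subseteq> K" "Poly_Mapping.keys m' \<subseteq> K" "Poly_Mapping.keys (m + m') \<subseteq> K"
    using keys_add[of m m'] by (auto simp: K_def)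
  show ?thesis
    unfolding mon_superset[OF K(1,2)] mon_superset[OF K(1,3)] mon_superset[OF K(1,4)]
    by (simp add: lookup_add power_add prod.distrib)
qed

lemma psubst_superset:
  "finite K \<Longrightarrow> Poly_Mapping.keys p \<subseteq> K \<Longrightarrow>
   psubst s p = (\<Sum>m\<in>K. Poly_Mapping.single 0 (Poly_Mapping.lookup p m) * mon s m)"
  unfolding psubst_def mon_def[symmetric] by (rule sum.mono_neutral_left) (auto simp: in_keys_iff)

lemma psubst_add: "psubst s (p + q) = psubst s p + psubst s q"
proof -
  define K where "K = Poly_Mapping.keys p \<union> Poly_Mapping.keys q"
  have K: "finite K" "Poly_Mapping.keys p \<subseteq> K" "Poly_Mapping.keys q \<subseteq> K" "Poly_Mapping.keys (p + q) \<subseteq> K"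
    using keys_add[of p q] by (auto simp: K_def)
  show ?thesis
    unfolding psubst_superset[OF K(1,2)] psubst_superset[OF K(1,3)] psubst_superset[OF K(1,4)]
    by (simp add: lookup_add single_add distrib_right sum.distrib)
qed

lemma psubst_zero [simp]: "psubst s 0 = 0"
  by (simp add: psubst_def)

lemma psubst_diff: "psubst s (p - q) = psubst s p - psubst s q"
  using psubst_add[of s "p - q" q] by simp

lemma psubst_sum: "psubst s (sum f I) = (\<Sum>i\<in>I. psubst s (f i))"
  by (induction I rule: infinite_finite_induct) (auto simp: psubst_add)

lemma psubst_single: "psubst s (Poly_Mapping.single m c) = Poly_Mapping.single 0 c * mon s m"
  by (cases "c = 0") (simp_all add: psubst_def mon_def)

lemma psubst_mult: "psubst s (p * q) = psubst s p * psubst s q"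
proof -
  let ?P = "Poly_Mapping.keys p" and ?Q = "Poly_Mapping.keys q"
  have p: "p = (\<Sum>m\<in>?P. Poly_Mapping.single m (Poly_Mapping.lookup p m))"
    and q: "q = (\<Sum>m\<in>?Q. Poly_Mapping.single m (Poly_Mapping.lookup q m))"
    by (rule poly_mapping_sum_single; simp)+
  have 1: "psubst s (Poly_Mapping.single m c * Poly_Mapping.single m' c') =
      psubst s (Poly_Mapping.single m c) * psubst s (Poly_Mapping.single m' c')" for m m' c c'
  proof -
    have "Poly_Mapping.single (0::nat \<Rightarrow>\<^sub>0 nat) (c * c') = Poly_Mapping.single 0 c * Poly_Mapping.single 0 c'"
      by (simp add: mult_single)
    then show ?thesis by (simp add: mult_single psubst_single mon_add mult_ac)
  qed
  have "psubst s (p * q) = (\<Sum>m\<in>?P. \<Sum>m'\<in>?Q. psubst s (Poly_Mapping.single m (Poly_Mapping.lookup p m) *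
      Poly_Mapping.single m' (Poly_Mapping.lookup q m')))"
    by (subst p, subst q, simp only: sum_product psubst_sum)
  also have "\<dots> = (\<Sum>m\<in>?P. psubst s (Poly_Mapping.single m (Poly_Mapping.lookup p m))) *
      (\<Sum>m'\<in>?Q. psubst s (Poly_Mapping.single m' (Poly_Mapping.lookup q m')))"
    by (simp only: 1 sum_product)
  also have "\<dots> = psubst s p * psubst s q"
    by (simp only: psubst_sum[symmetric] p[symmetric] q[symmetric])
  finally show ?thesis .
qed

lemma psubst_one [simp]: "psubst s 1 = 1"
  using psubst_single[of s 0 1] by simp

lemma psubst_Var [simp]: "psubst s (Var i) = s i"
  by (simp add: Var_def psubst_single mon_def)

lemma psubst_power: "psubst s (p ^ k) = psubst s p ^ k"
  by (induction k) (auto simp: psubst_mult)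

lemma psubst_prod: "psubst s (prod f I) = (\<Prod>i\<in>I. psubst s (f i))"
  by (induction I rule: infinite_finite_induct) (auto simp: psubst_mult)

lemmas swapvars_simps = psubst_add psubst_diff psubst_mult psubst_sum psubst_prod psubst_power

lemma swapvars_Var: "swapvars i (Var j) = Var (adj_swap i j)"
  by (simp add: swapvars_def)

definition in_vars :: "nat set \<Rightarrow> mpoly \<Rightarrow> bool" where
  "in_vars V p \<longleftrightarrow> (\<forall>m\<in>Poly_Mapping.keys p. Poly_Mapping.keys m \<subseteq> V)"

lemma in_vars_zero [simp]: "in_vars V 0" and in_vars_one [simp]: "in_vars V 1"
  by (auto simp: in_vars_def)

lemma in_vars_Var: "i \<in> V \<Longrightarrow> in_vars V (Var i)"
  by (auto simp: in_vars_def Var_def)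

lemma in_vars_add: "in_vars V p \<Longrightarrow> in_vars V q \<Longrightarrow> in_vars V (p + q)"
  using keys_add[of p q] by (fastforce simp: in_vars_def)

lemma in_vars_mult:
  assumes "in_vars V p" "in_vars V q"
  shows "in_vars V (p * q)"
  unfolding in_vars_def
proof
  fix m assume "m \<in> Poly_Mapping.keys (p * q)"
  then obtain a b where "m = a + b" "a \<in> Poly_Mapping.keys p" "b \<in> Poly_Mapping.keys q"
    using keys_mult[of p q] by auto
  then show "Poly_Mapping.keys m \<subseteq> V" using assms keys_add[of a b] unfolding in_vars_def by blast
qed

lemma in_vars_mono: "in_vars V p \<Longrightarrow> V \<subseteq> W \<Longrightarrow> in_vars W p"
  by (auto simp: in_vars_def)

lemma mon_Var: "mon Var m = Poly_Mapping.single m 1"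
proof -
  have pow: "Var j ^ k = Poly_Mapping.single (Poly_Mapping.single j k) 1" for j k
    by (induction k) (auto simp: Var_def mult_single single_add[symmetric])
  have "(\<Prod>j\<in>K. Poly_Mapping.single (f j) (1::int)) = Poly_Mapping.single (\<Sum>j\<in>K. f j) 1"
    for f :: "nat \<Rightarrow> nat \<Rightarrow>\<^sub>0 nat" and K
    by (induction K rule: infinite_finite_induct) (auto simp: mult_single)
  then have "mon Var m = Poly_Mapping.single (\<Sum>j\<in>Poly_Mapping.keys m. Poly_Mapping.single j (Poly_Mapping.lookup m j)) 1"
    by (simp add: mon_def pow)
  then show ?thesis using poly_mapping_sum_single[of "Poly_Mapping.keys m" m] by simp
qed

lemma psubst_in_vars_id:
  assumes "in_vars V p" "\<And>j. j \<in> V \<Longrightarrow> s j = Var j"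
  shows "psubst s p = p"
proof -
  have "mon s m = Poly_Mapping.single m 1" if "m \<in> Poly_Mapping.keys p" for m
  proof -
    have "Poly_Mapping.keys m \<subseteq> V" using assms(1) that by (simp add: in_vars_def)
    then have "mon s m = mon Var m"
      unfolding mon_def by (intro prod.cong refl) (simp add: assms(2) subsetD)
    then show ?thesis by (simp add: mon_Var)
  qed
  then have "psubst s p = (\<Sum>m\<in>Poly_Mapping.keys p. Poly_Mapping.single m (Poly_Mapping.lookup p m))"
    by (simp add: psubst_def mon_def[symmetric] mult_single)
  also have "\<dots> = p" using poly_mapping_sum_single[of "Poly_Mapping.keys p" p] by simp
  finally show ?thesis .
qed

lemma swapvars_in_vars: "in_vars V p \<Longrightarrow> i \<notin> V \<Longrightarrow> Suc i \<notin> V \<Longrightarrow> swapvars i p = p"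
  unfolding swapvars_def by (rule psubst_in_vars_id) (auto simp: Transposition.transpose_def)

text \<open>The defining equation of \<open>divdiff\<close> without \<open>THE\<close>. The relation
  is closed under sums and under multiples by invariant factors, and quotients are always exhibited
  explicitly, so \<open>divdiff_eq\<close> applies.\<close>

definition is_divdiff :: "nat \<Rightarrow> mpoly \<Rightarrow> mpoly \<Rightarrow> bool" where
  "is_divdiff i f g \<longleftrightarrow> (Var i - Var (Suc i)) * g = f - swapvars i f"

lemma Var_inj: "Var i = Var j \<longleftrightarrow> i = j"
proof
  assume "Var i = Var j"
  then have "Poly_Mapping.keys (Var i) = Poly_Mapping.keys (Var j)" by simp
  then have "Poly_Mapping.keys (Poly_Mapping.single i (1::nat)) = Poly_Mapping.keys (Poly_Mapping.single j (1::nat))"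
    by (simp add: Var_def)
  then show "i = j" by simp
qed simp

lemma is_divdiff_unique: "is_divdiff i f g \<Longrightarrow> is_divdiff i f h \<Longrightarrow> g = h"
proof -
  assume "is_divdiff i f g" "is_divdiff i f h"
  then have "(Var i - Var (Suc i)) * g = (Var i - Var (Suc i)) * h" by (simp add: is_divdiff_def)
  moreover have "Var i - Var (Suc i) \<noteq> 0" by (simp add: Var_inj)
  ultimately show "g = h" by (simp only: mult_cancel_left) simp
qed

lemma divdiff_eq: "is_divdiff i f g \<Longrightarrow> divdiff i f = g"
  unfolding divdiff_def is_divdiff_def[symmetric]
  by (rule the_equality) (auto intro: is_divdiff_unique)

lemma is_divdiff_add: "is_divdiff i f g \<Longrightarrow> is_divdiff i f' g' \<Longrightarrow> is_divdiff i (f + f') (g + g')"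
  by (simp add: is_divdiff_def swapvars_def swapvars_simps algebra_simps)

lemma is_divdiff_zero: "is_divdiff i 0 0"
  by (simp add: is_divdiff_def swapvars_def)

lemma is_divdiff_sum: "(\<And>j. j \<in> I \<Longrightarrow> is_divdiff i (f j) (g j)) \<Longrightarrow> is_divdiff i (sum f I) (sum g I)"
  by (induction I rule: infinite_finite_induct) (auto intro: is_divdiff_add is_divdiff_zero)

lemma is_divdiff_mult: "swapvars i c = c \<Longrightarrow> is_divdiff i f g \<Longrightarrow> is_divdiff i (c * f) (c * g)"
  by (simp add: is_divdiff_def swapvars_def swapvars_simps right_diff_distrib mult.left_commute)

text \<open>A function \<open>F\<close> on permutations stands for the nilCoxeter element with
  coefficient \<open>F p\<close> at the basis element of \<open>p\<close>. This is right
  multiplication by the generator \<open>u_j\<close>; the condition says that removing it shortens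
  \<open>p\<close>.\<close>

definition uop :: "nat \<Rightarrow> ((nat \<Rightarrow> nat) \<Rightarrow> mpoly) \<Rightarrow> (nat \<Rightarrow> nat) \<Rightarrow> mpoly" where
  "uop j F p = (if p j > p (Suc j) then F (p \<circ> adj_swap j) else 0)"

definition hop :: "nat \<Rightarrow> mpoly \<Rightarrow> ((nat \<Rightarrow> nat) \<Rightarrow> mpoly) \<Rightarrow> (nat \<Rightarrow> nat) \<Rightarrow> mpoly" where
  "hop j x F p = F p + x * uop j F p"

text \<open>Right multiplication by the product of the factors \<open>1 + x u_j\<close>, with
  \<open>j\<close> increasing from \<open>m\<close> to \<open>n - 1\<close>.\<close>

definition Aop :: "nat \<Rightarrow> nat \<Rightarrow> mpoly \<Rightarrow> ((nat \<Rightarrow> nat) \<Rightarrow> mpoly) \<Rightarrow> (nat \<Rightarrow> nat) \<Rightarrow> mpoly" where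
  "Aop n m x F = fold (\<lambda>j. hop j x) [m..<n] F"

lemma uop_add: "uop j (\<lambda>p. F p + G p) = (\<lambda>p. uop j F p + uop j G p)"
  and uop_diff: "uop j (\<lambda>p. F p - G p) = (\<lambda>p. uop j F p - uop j G p)"
  and uop_scale: "uop j (\<lambda>p. c * F p) = (\<lambda>p. c * uop j F p)"
  and uop_zero: "uop j (\<lambda>p. 0) = (\<lambda>p. 0)"
  by (auto simp: uop_def)

text \<open>With the next two lemmas these are the defining relations of the nilCoxeter
  algebra.\<close>

lemma uop_uop: "uop j (uop j F) = (\<lambda>p. 0)"
  by (auto simp: uop_def)

lemma uop_braid: "uop j (uop (Suc j) (uop j F)) = uop (Suc j) (uop j (uop (Suc j) F))"
proof
  fix p :: "nat \<Rightarrow> nat"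
  have eq: "p \<circ> adj_swap j \<circ> adj_swap (Suc j) \<circ> adj_swap j =
    p \<circ> adj_swap (Suc j) \<circ> adj_swap j \<circ> adj_swap (Suc j)"
    by (auto simp: fun_eq_iff Transposition.transpose_def)
  show "uop j (uop (Suc j) (uop j F)) p = uop (Suc j) (uop j (uop (Suc j) F)) p"
    unfolding uop_def by (auto simp: eq)
qed

lemma uop_comm:
  assumes "Suc j < k"
  shows "uop j (uop k F) = uop k (uop j F)"
proof
  fix p :: "nat \<Rightarrow> nat"
  have eq: "p \<circ> adj_swap j \<circ> adj_swap k =
    p \<circ> adj_swap k \<circ> adj_swap j"
    using assms by (auto simp: fun_eq_iff Transposition.transpose_def)
  show "uop j (uop k F) p = uop k (uop j F) p"
    unfolding uop_def using assms by (auto simp: eq)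
qed

lemma hop_eq: "hop j x F = (\<lambda>p. F p + x * uop j F p)"
  by (simp add: hop_def fun_eq_iff)

lemma hop_comm: "Suc j < k \<Longrightarrow> hop j x (hop k y F) = hop k y (hop j x F)"
  by (simp add: hop_eq uop_add uop_scale uop_comm[of j k F] algebra_simps)

lemma hop_comm_same: "hop j x (hop j y F) = hop j y (hop j x F)"
  by (simp add: hop_eq uop_add uop_diff uop_scale uop_uop algebra_simps)

lemma hop_inverse: "hop j y (hop j (- y) F) = F"
  by (simp add: hop_eq uop_add uop_diff uop_scale uop_uop algebra_simps)

text \<open>The Yang-Baxter equation for the factors \<open>1 + x u_j\<close>, brought into a form
  symmetric in \<open>x\<close> and \<open>y\<close> by means of inverse factors.\<close>

lemma hop_exchange:
  "hop (Suc j) (- y) (hop j x (hop (Suc j) y (hop j y F))) = hop (Suc j) (- x) (hop j y (hop (Suc j) x (hop j x F)))"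
  by (simp add: hop_eq uop_add uop_diff uop_scale uop_uop uop_zero uop_braid algebra_simps)

lemma Aop_ge [simp]: "n \<le> m \<Longrightarrow> Aop n m x F = F"
  by (simp add: Aop_def)

lemma Aop_rec: "m < n \<Longrightarrow> Aop n m x F = Aop n (Suc m) x (hop m x F)"
  by (simp add: Aop_def upt_conv_Cons)

lemma Aop_Suc: "m \<le> n \<Longrightarrow> Aop (Suc n) m x F = hop n x (Aop n m x F)"
  by (simp add: Aop_def)

lemma Aop_rec': "m < n \<Longrightarrow> Aop n (Suc m) x F = Aop n m x (hop m (- x) F)"
  by (simp add: Aop_rec hop_inverse)

lemma fold_hop_comm:
  "(\<And>j. j \<in> set js \<Longrightarrow> Suc m < j) \<Longrightarrow> hop m x (fold (\<lambda>j. hop j y) js F) = fold (\<lambda>j. hop j y) js (hop m x F)"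
  by (induction js arbitrary: F) (auto simp: hop_comm)

lemma hop_Aop_comm: "hop m x (Aop n (Suc (Suc m)) y F) = Aop n (Suc (Suc m)) y (hop m x F)"
  unfolding Aop_def by (rule fold_hop_comm) auto

text \<open>Inserting the inverse factor \<open>hop (Suc m) (- y)\<close> extends the inner product
  down to \<open>Suc m\<close>. Both sides then consist of two operators with \<open>Suc m\<close>,
  which commute by induction, and four factors that \<open>hop_exchange\<close> identifies.\<close>

lemma Aop_comm: "Aop n m x (Aop n m y F) = Aop n m y (Aop n m x F)"
proof (induction "n - m" arbitrary: m F)
  case 0
  then show ?case by simp
next
  case (Suc d)
  then have "m < n" by simp
  show ?case
  proof (cases "Suc m < n")
    case False
    then have n: "n = Suc m" using \<open>m < n\<close> by simp
    show ?thesis using hop_comm_same[of m x y F] by (simp add: n Aop_Suc)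
  next
    case True
    have W: "Aop n m x (Aop n m y F) =
        Aop n (Suc m) x (Aop n (Suc m) y (hop (Suc m) (- y) (hop m x (hop (Suc m) y (hop m y F)))))" for x y
    proof -
      have "Aop n m x (Aop n m y F) = Aop n (Suc m) x (hop m x (Aop n (Suc (Suc m)) y (hop (Suc m) y (hop m y F))))"
        using \<open>m < n\<close> True by (simp add: Aop_rec)
      also have "\<dots> = Aop n (Suc m) x (Aop n (Suc (Suc m)) y (hop m x (hop (Suc m) y (hop m y F))))"
        by (simp only: hop_Aop_comm)
      also have "\<dots> = Aop n (Suc m) x (Aop n (Suc m) y (hop (Suc m) (- y) (hop m x (hop (Suc m) y (hop m y F)))))"
        using True by (simp only: Aop_rec')
      finally show ?thesis .
    qed
    show ?thesis
      unfolding W[of x y] W[of y x] hop_exchange[of m y x]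
      using Suc.hyps(1)[of "Suc m"] Suc.hyps(2) by simp
  qed
qed

abbreviation hops :: "mpoly \<Rightarrow> nat list \<Rightarrow> ((nat \<Rightarrow> nat) \<Rightarrow> mpoly) \<Rightarrow> (nat \<Rightarrow> nat) \<Rightarrow> mpoly" where
  "hops x js F \<equiv> fold (\<lambda>j. hop j x) js F"

lemma hops_linear: "hops x js (\<lambda>p. a * F p + b * G p) = (\<lambda>p. a * hops x js F p + b * hops x js G p)"
proof (induction js arbitrary: F G)
  case (Cons j js)
  have "hop j x (\<lambda>p. a * F p + b * G p) = (\<lambda>p. a * hop j x F p + b * hop j x G p)"
    by (simp add: hop_eq uop_add uop_scale algebra_simps)
  then show ?case by (simp add: Cons)
qed simp

lemma swapvars_hops:
  "swapvars i (hops x js F p) = hops (swapvars i x) js (\<lambda>p. swapvars i (F p)) p"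
proof (induction js arbitrary: F)
  case (Cons j js)
  have "(\<lambda>p. swapvars i (hop j x F p)) = hop j (swapvars i x) (\<lambda>p. swapvars i (F p))"
    by (auto simp: hop_def uop_def swapvars_def psubst_add psubst_mult fun_eq_iff)
  then show ?case by (simp add: Cons)
qed simp

lemma in_vars_hops:
  "(\<And>p. in_vars V (F p)) \<Longrightarrow> in_vars V x \<Longrightarrow> in_vars V (hops x js F p)"
proof (induction js arbitrary: F p)
  case (Cons j js)
  have "in_vars V (hop j x F p)" for p
    using Cons.prems by (auto simp: hop_def uop_def intro!: in_vars_add in_vars_mult)
  then show ?case using Cons by simp
qed simp

lemma hops_cong_bij:
  "(\<And>p. bij p \<Longrightarrow> F p = G p) \<Longrightarrow> bij p \<Longrightarrow> hops x js F p = hops x js G p"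
proof (induction js arbitrary: F G p)
  case (Cons j js)
  have "hop j x F p = hop j x G p" if "bij p" for p
  proof -
    have "bij (p \<circ> adj_swap j)" using that by (simp add: bij_comp)
    then show ?thesis
      unfolding hop_def uop_def by (simp only: Cons.prems(1)[OF that] Cons.prems(1))
  qed
  then have "hops x js (hop j x F) p = hops x js (hop j x G) p"
    by (rule Cons.IH[OF _ Cons.prems(2)])
  then show ?case by simp
qed simp

lemma hops_support:
  "(\<And>p. F p \<noteq> 0 \<Longrightarrow> p permutes V) \<Longrightarrow> (\<And>j. j \<in> set js \<Longrightarrow> j \<in> V \<and> Suc j \<in> V) \<Longrightarrow>
   hops x js F p \<noteq> 0 \<Longrightarrow> p permutes V"
proof (induction js arbitrary: F p)
  case (Cons j js)
  have "p permutes V" if nz: "hop j x F p \<noteq> 0" for p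
  proof (cases "F p = 0")
    case True
    then have "F (p \<circ> adj_swap j) \<noteq> 0"
      using nz by (auto simp: hop_def uop_def split: if_splits)
    then have "p \<circ> adj_swap j permutes V" by (rule Cons.prems(1))
    moreover have "adj_swap j permutes V"
      using Cons.prems(2) by (auto intro: permutes_swap_id)
    ultimately have "p \<circ> adj_swap j \<circ> adj_swap j permutes V"
      using permutes_compose by blast
    then show ?thesis by (simp add: comp_assoc)
  qed (use Cons.prems(1) in blast)
  then show ?case using Cons.IH[of "hop j x F" p] Cons.prems(2,3) by simp
qed simp

text \<open>Left multiplication by \<open>u_i\<close>, for bijective \<open>p\<close>.\<close>

definition rop :: "nat \<Rightarrow> ((nat \<Rightarrow> nat) \<Rightarrow> mpoly) \<Rightarrow> (nat \<Rightarrow> nat) \<Rightarrow> mpoly" where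
  "rop i F p = (if inv p i > inv p (Suc i) then F (adj_swap i \<circ> p) else 0)"

lemma transpose_less:
  "x \<noteq> y \<Longrightarrow> {x, y} \<noteq> {j, Suc j} \<Longrightarrow>
   adj_swap j x < adj_swap j y \<longleftrightarrow> x < y"
  by (auto simp: Transposition.transpose_def doubleton_eq_iff)

text \<open>Associativity of left and right multiplication. The two length conditions agree because
  a transposition changes the order of one pair only; in the exceptional case where \<open>j\<close>
  and \<open>Suc j\<close> are the positions of \<open>i\<close> and \<open>Suc i\<close>, both
  sides vanish.\<close>

lemma uop_rop:
  assumes "bij p"
  shows "uop j (rop i F) p = rop i (uop j F) p"
proof -
  let ?s = "adj_swap j" and ?t = "adj_swap i"
  define P R where "P = inv p i" and "R = inv p (Suc i)"
  have pP: "p P = i" and pR: "p R = Suc i" and ip: "inv p (p x) = x" for x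
    using assms by (auto simp: P_def R_def surj_f_inv_f[OF bij_is_surj] inv_f_f[OF bij_is_inj])
  have "P \<noteq> R" using pP pR by auto
  have inv: "inv (p \<circ> ?s) = ?s \<circ> inv p"
    using o_inv_distrib[OF assms, of ?s] by simp
  have pj: "p j \<noteq> p (Suc j)" using ip by (metis n_not_Suc_n)
  have "(p j > p (Suc j) \<and> ?s P > ?s R) \<longleftrightarrow> (P > R \<and> ?t (p j) > ?t (p (Suc j)))"
  proof (cases "{P, R} = {j, Suc j}")
    case True
    then have "(P = j \<and> R = Suc j) \<or> (P = Suc j \<and> R = j)" by (auto simp: doubleton_eq_iff)
    then show ?thesis using pP pR by auto
  next
    case False
    then have "?s R < ?s P \<longleftrightarrow> R < P" using \<open>P \<noteq> R\<close> by (intro transpose_less) auto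
    moreover have "{p (Suc j), p j} \<noteq> {i, Suc i}"
    proof
      assume "{p (Suc j), p j} = {i, Suc i}"
      then have "inv p ` {p (Suc j), p j} = inv p ` {i, Suc i}" by simp
      then show False using False by (simp add: ip P_def R_def insert_commute)
    qed
    then have "?t (p (Suc j)) < ?t (p j) \<longleftrightarrow> p (Suc j) < p j" using pj by (intro transpose_less) auto
    ultimately show ?thesis by auto
  qed
  then show ?thesis
    by (auto simp: uop_def rop_def inv P_def[symmetric] R_def[symmetric] comp_assoc)
qed

lemma hops_rop:
  "bij p \<Longrightarrow> hops x js (rop i F) p = rop i (hops x js F) p"
proof (induction js arbitrary: F p)
  case (Cons j js)
  have "hop j x (rop i F) p = rop i (hop j x F) p" if "bij p" for p
  proof -
    have "hop j x (rop i F) p = rop i F p + x * rop i (uop j F) p"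
      by (simp only: hop_def uop_rop[OF that])
    also have "\<dots> = rop i (hop j x F) p" by (simp add: rop_def hop_def)
    finally show ?thesis .
  qed
  then have "hops x js (hop j x (rop i F)) p = hops x js (rop i (hop j x F)) p"
    using Cons.prems by (intro hops_cong_bij) auto
  then show ?case using Cons by simp
qed simp

lemma hops_divdiff:
  assumes "swapvars i x = x" "\<And>p. bij p \<Longrightarrow> is_divdiff i (F p) (G p)" "bij p"
  shows "is_divdiff i (hops x js F p) (hops x js G p)"
  using assms(2,3)
proof (induction js arbitrary: F G p)
  case (Cons j js)
  have "is_divdiff i (hop j x F p) (hop j x G p)" if "bij p" for p
  proof -
    have "bij (p \<circ> adj_swap j)" using that by (simp add: bij_comp)
    then have "is_divdiff i (uop j F p) (uop j G p)"
      using Cons.prems(1) by (auto simp: uop_def is_divdiff_zero)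
    then show ?thesis
      unfolding hop_def using Cons.prems(1)[OF that] assms(1) by (intro is_divdiff_add is_divdiff_mult)
  qed
  then show ?case using Cons.IH[of "hop j x F" "hop j x G" p] Cons.prems(2) by simp
qed simp

section \<open>Schubert polynomials from the nilCoxeter algebra\<close>

text \<open>\<open>Gf n m p\<close> is the Schubert polynomial in the variables \<open>x\<^sub>m, \<dots>, x\<^sub>n\<close> of the inverse
  of \<open>p\<close>, a permutation of \<open>{m..n}\<close>, by the factorisation of Fomin and Stanley in the
  nilCoxeter algebra.\<close>
definition Gf :: "nat \<Rightarrow> nat \<Rightarrow> (nat \<Rightarrow> nat) \<Rightarrow> mpoly" where
  "Gf n m = foldr (\<lambda>i. Aop n i (Var i)) [m..<n] (\<lambda>p. if p = id then 1 else 0)"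

lemma Gf_ge: "n \<le> m \<Longrightarrow> Gf n m = (\<lambda>p. if p = id then 1 else 0)"
  by (simp add: Gf_def)

lemma Gf_rec: "Gf n m = Aop n m (Var m) (Gf n (Suc m))"
  by (cases "m < n") (simp_all add: Gf_def upt_conv_Cons)

lemma Gf_in_vars: "in_vars {m..<n} (Gf n m p)"
proof (induction "n - m" arbitrary: m p)
  case 0
  then show ?case by (simp add: Gf_ge)
next
  case (Suc d)
  then have "in_vars {Suc m..<n} (Gf n (Suc m) p)" for p by simp
  then have "in_vars {m..<n} (Gf n (Suc m) p)" for p
    by (rule in_vars_mono) auto
  moreover have "in_vars {m..<n} (Var m)" using Suc by (intro in_vars_Var) auto
  ultimately show ?case unfolding Gf_rec[of n m] Aop_def by (rule in_vars_hops)
qed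

lemma Gf_support: "Gf n m p \<noteq> 0 \<Longrightarrow> p permutes {m..n}"
proof (induction "n - m" arbitrary: m p)
  case 0
  then show ?case by (auto simp: Gf_ge id_def[symmetric] intro: permutes_id split: if_splits)
next
  case (Suc d)
  have sup: "q permutes {m..n}" if "Gf n (Suc m) q \<noteq> 0" for q
  proof -
    have "q permutes {Suc m..n}" using Suc.hyps(1)[of "Suc m" q] that Suc.hyps(2) by simp
    then show ?thesis by (rule permutes_subset) auto
  qed
  have "hops (Var m) [m..<n] (Gf n (Suc m)) p \<noteq> 0"
    using Suc.prems unfolding Gf_rec[of n m] Aop_def .
  then show ?case
    by (rule hops_support[where F = "Gf n (Suc m)" and js = "[m..<n]" and x = "Var m", rotated 2])
      (use sup in auto)
qed

text \<open>Outer factors do not involve the variables \<open>i\<close> and \<open>Suc i\<close> and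
  commute with left multiplication, so the claim reduces to \<open>m = i\<close>. There
  \<open>Aop n (Suc m) y\<close> is \<open>Aop n m y\<close> after \<open>hop m (- y)\<close>. As
  the operators \<open>Aop n m x\<close> and \<open>Aop n m y\<close> commute, swapping the
  variables changes only the term linear in \<open>uop m F\<close>, and the difference is
  \<open>x - y\<close> times that term.\<close>

lemma Gf_divdiff:
  assumes "m \<le> i" "i < n" "bij p"
  shows "is_divdiff i (Gf n m p) (rop i (Gf n m) p)"
  using assms
proof (induction "i - m" arbitrary: m p)
  case (Suc d)
  have "swapvars i (Var m) = Var m" using Suc by (simp add: swapvars_Var transpose_apply_other)
  moreover have "is_divdiff i (Gf n (Suc m) p) (rop i (Gf n (Suc m)) p)" if "bij p" for p
    using Suc that by simp
  ultimately have "is_divdiff i (Gf n m p) (hops (Var m) [m..<n] (rop i (Gf n (Suc m))) p)"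
    unfolding Gf_rec[of n m] Aop_def using Suc.prems(3) by (rule hops_divdiff)
  then show ?case
    by (simp only: hops_rop[OF Suc.prems(3)] Gf_rec[of n m, unfolded Aop_def, symmetric])
next
  case 0
  then have m: "m = i" by simp
  define F where "F = Gf n (Suc (Suc m))"
  define x y where "x = Var m" and "y = Var (Suc m)"
  have "in_vars {Suc (Suc m)..<n} (F p)" for p unfolding F_def by (rule Gf_in_vars)
  then have sF: "(\<lambda>p. swapvars i (F p)) = F"
    by (intro ext swapvars_in_vars) (auto simp: m)
  have G: "Gf n m = Aop n m x (Aop n (Suc m) y F)"
    unfolding x_def y_def F_def by (simp only: Gf_rec[of n m] Gf_rec[of n "Suc m"])
  have swap: "swapvars i (Gf n m p) = Aop n m y (Aop n (Suc m) x F) p"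
    unfolding G Aop_def swapvars_hops by (simp add: sF x_def y_def swapvars_Var m)
  \<comment> \<open>\<open>F\<close> lives on permutations that fix \<open>m\<close> and
    \<open>Suc m\<close>. They commute with the transposition of these, so left and right
    multiplication by \<open>u_m\<close> agree on \<open>F\<close>.\<close>
  have rF: "rop i F p = uop m F p" if "bij p" for p
  proof -
    have sup: "q m = m \<and> q (Suc m) = Suc m \<and> bij q \<and>
        adj_swap m \<circ> q = q \<circ> adj_swap m" if "F q \<noteq> 0" for q
    proof -
      have q: "q permutes {Suc (Suc m)..n}" using Gf_support that by (simp add: F_def)
      then have "q m = m" "q (Suc m) = Suc m" by (auto simp: permutes_not_in)
      moreover have "bij q" using q by (rule permutes_bij)
      moreover have "q x = m \<longleftrightarrow> x = m" "q x = Suc m \<longleftrightarrow> x = Suc m" for x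
        using inj_eq[OF bij_is_inj[OF \<open>bij q\<close>], of x m] inj_eq[OF bij_is_inj[OF \<open>bij q\<close>], of x "Suc m"]
          \<open>q m = m\<close> \<open>q (Suc m) = Suc m\<close> by simp_all
      ultimately have "(adj_swap m \<circ> q) x = (q \<circ> adj_swap m) x" for x
        by (simp add: Transposition.transpose_def) metis
      then show ?thesis using \<open>q m = m\<close> \<open>q (Suc m) = Suc m\<close> \<open>bij q\<close> by auto
    qed
    let ?s = "adj_swap m"
    have inv_eq: "inv p a = b \<longleftrightarrow> p b = a" for a b
      using that by (metis bij_inv_eq_iff)
    show ?thesis
    proof (cases "F (?s \<circ> p) \<noteq> 0 \<or> F (p \<circ> ?s) \<noteq> 0")
      case True
      then have "?s \<circ> p = p \<circ> ?s \<and> p m = Suc m \<and> p (Suc m) = m"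
      proof
        assume "F (?s \<circ> p) \<noteq> 0"
        from sup[OF this] have *: "?s (p m) = m" "?s (p (Suc m)) = Suc m" "?s \<circ> (?s \<circ> p) = (?s \<circ> p) \<circ> ?s" by auto
        then have "p m = ?s m" "p (Suc m) = ?s (Suc m)" by (metis transpose_involutory)+
        moreover have "p = ?s \<circ> p \<circ> ?s" using *(3) by (simp add: comp_assoc[symmetric])
        then have "?s \<circ> p = p \<circ> ?s" by (metis comp_assoc comp_id transpose_comp_involutory)
        ultimately show ?thesis by simp
      next
        assume "F (p \<circ> ?s) \<noteq> 0"
        from sup[OF this] have *: "p (?s m) = m" "p (?s (Suc m)) = Suc m" "?s \<circ> (p \<circ> ?s) = (p \<circ> ?s) \<circ> ?s" by auto
        then have "p (Suc m) = m" "p m = Suc m" by simp_all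
        moreover have "p = ?s \<circ> p \<circ> ?s" using *(3) by (simp add: comp_assoc)
        then have "?s \<circ> p = p \<circ> ?s" by (metis comp_assoc comp_id transpose_comp_involutory)
        ultimately show ?thesis by simp
      qed
      moreover from this have "inv p m = Suc m" "inv p (Suc m) = m" by (simp_all add: inv_eq)
      ultimately show ?thesis by (simp add: rop_def uop_def m[symmetric])
    next
      case False
      then show ?thesis by (simp add: rop_def uop_def m[symmetric])
    qed
  qed
  define B where "B = Aop n m x (Aop n m y (uop m F)) p"
  have lin: "Aop n m a (Aop n m b (hop m c F)) p = Aop n m a (Aop n m b F) p + c * Aop n m a (Aop n m b (uop m F)) p"
    for a b c
    using hops_linear[of b "[m..<n]" 1 F c "uop m F"]
      hops_linear[of a "[m..<n]" 1 "hops b [m..<n] F" c "hops b [m..<n] (uop m F)"]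
    by (simp add: Aop_def hop_eq)
  have mn: "m < n" using 0 by simp
  have e1: "Aop n m a (Aop n (Suc m) b F) p = Aop n m a (Aop n m b F) p - b * Aop n m a (Aop n m b (uop m F)) p" for a b
    using lin[of a b "- b"] by (simp add: Aop_rec'[OF mn])
  have e2: "Aop n (Suc m) y (uop m F) = Aop n m y (uop m F)"
    by (simp add: Aop_rec'[OF mn] hop_eq uop_uop)
  have "rop i (Gf n m) p = Aop n m x (Aop n (Suc m) y (rop i F)) p"
  proof -
    have "rop i (Gf n m) p = Aop n m x (rop i (Aop n (Suc m) y F)) p"
      unfolding G Aop_def by (rule hops_rop[OF 0(4), symmetric])
    also have "\<dots> = Aop n m x (Aop n (Suc m) y (rop i F)) p"
      unfolding Aop_def using 0(4) by (intro hops_cong_bij) (auto simp: hops_rop)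
    finally show ?thesis .
  qed
  also have "\<dots> = Aop n m x (Aop n (Suc m) y (uop m F)) p"
    unfolding Aop_def using 0(4) rF by (intro hops_cong_bij) (auto intro: hops_cong_bij)
  also have "\<dots> = B" by (simp add: e2 B_def)
  finally have r: "rop i (Gf n m) p = B" .
  have "Gf n m p - swapvars i (Gf n m p) = (x - y) * B"
    unfolding swap unfolding G e1 Aop_comm[of n m y x] B_def by (simp add: algebra_simps)
  then show ?case unfolding is_divdiff_def r by (simp add: x_def y_def m)
qed

section \<open>Expansion in the first variable\<close>

definition nxt :: "nat set \<Rightarrow> nat \<Rightarrow> nat" where
  "nxt E c = Min {e \<in> E. c < e}"

lemma nxt_props:
  assumes "finite E" "e \<in> E" "c < e"
  shows "nxt E c \<in> E" "c < nxt E c" "nxt E c \<le> e"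
proof -
  have f: "finite {e \<in> E. c < e}" "{e \<in> E. c < e} \<noteq> {}" using assms by auto
  then have "nxt E c \<in> {e \<in> E. c < e}" unfolding nxt_def by (rule Min_in)
  then show "nxt E c \<in> E" "c < nxt E c" by auto
  show "nxt E c \<le> e" unfolding nxt_def using f assms by (intro Min_le) auto
qed

lemma nxt_eqI:
  "finite E \<Longrightarrow> e \<in> E \<Longrightarrow> c < e \<Longrightarrow> (\<And>d. d \<in> E \<Longrightarrow> c < d \<Longrightarrow> e \<le> d) \<Longrightarrow> nxt E c = e"
  unfolding nxt_def by (rule Min_eqI) auto

text \<open>The columns outside \<open>E\<close> are the crossings. Removing crossings from right to
  left, the value that meets \<open>p c\<close> at position \<open>c + 1\<close> is
  \<open>p (nxt E c)\<close>; the condition says that every crossing removes an inversion. There is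
  no generator \<open>u_n\<close>, hence \<open>n \<in> E\<close>.\<close>

definition Es :: "nat \<Rightarrow> nat \<Rightarrow> (nat \<Rightarrow> nat) \<Rightarrow> nat set set" where
  "Es m n p = {E. E \<subseteq> {m..n} \<and> n \<in> E \<and> (\<forall>c\<in>{m..n} - E. p (nxt E c) < p c)}"

text \<open>In the language of pipe dreams, \<open>E\<close> is the set of columns in which the top row \<open>m\<close> has
  no crossing, and \<open>pE\<close> describes the permutation of the rows below.\<close>
definition pE :: "nat \<Rightarrow> nat \<Rightarrow> nat set \<Rightarrow> (nat \<Rightarrow> nat) \<Rightarrow> nat \<Rightarrow> nat" where
  "pE m n E p a = (if a = m then p (Min E)
     else if m < a \<and> a \<le> n then (if a - 1 \<in> E then p (nxt E (a - 1)) else p (a - 1))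
     else p a)"

lemma finite_Es: "finite (Es m n p)"
  by (rule finite_subset[of _ "Pow {m..n}"]) (auto simp: Es_def)

lemma EsD:
  assumes "E \<in> Es m n p"
  shows "E \<subseteq> {m..n}" "finite E" "n \<in> E" "c \<in> {m..n} \<Longrightarrow> c \<notin> E \<Longrightarrow> p (nxt E c) < p c"
  using assms finite_subset[of E "{m..n}"] by (auto simp: Es_def)

lemma nxt_insert_Suc:
  assumes "E \<subseteq> {m..n}" "n \<in> E" "c < n"
  shows "nxt (insert (Suc n) E) c = nxt E c"
proof -
  have "finite E" using assms(1) finite_subset by blast
  note nx = nxt_props[OF this assms(2,3)]
  show ?thesis
    by (rule nxt_eqI) (use nx nxt_props[OF \<open>finite E\<close>, of _ c] \<open>finite E\<close> in auto)
qed

lemma nxt_replace_Suc: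
  assumes "E \<subseteq> {m..n}" "n \<in> E" "c < n"
  shows "nxt (insert (Suc n) (E - {n})) c = adj_swap n (nxt E c)"
proof -
  have fE: "finite E" using assms(1) finite_subset by blast
  note nx = nxt_props[OF fE assms(2,3)]
  show ?thesis
  proof (cases "nxt E c = n")
    case True
    then have "e = n" if "e \<in> E" "c < e" for e
      using nxt_props(3)[OF fE that] assms(1) that by fastforce
    then show ?thesis using True fE assms(3) by (intro nxt_eqI) auto
  next
    case False
    then have "nxt E c < n" using nx by simp
    then have "adj_swap n (nxt E c) = nxt E c"
      by (simp add: Transposition.transpose_def)
    moreover have "nxt (insert (Suc n) (E - {n})) c = nxt E c"
      by (rule nxt_eqI) (use nx \<open>nxt E c < n\<close> nxt_props[OF fE, of _ c] fE in auto)
    ultimately show ?thesis by simp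
  qed
qed

lemma pE_insert:
  assumes E: "E \<subseteq> {m..n}" "n \<in> E" and "m \<le> n"
  shows "pE m (Suc n) (insert (Suc n) E) p = pE m n E p"
proof
  fix a
  have fE: "finite E" using E(1) finite_subset by blast
  have Min: "Min (insert (Suc n) E) = Min E"
  proof -
    have "Min E \<le> n" using fE E(2) by (rule Min_le)
    moreover have "E \<noteq> {}" using E(2) by auto
    ultimately show ?thesis using Min_insert[OF fE, of "Suc n"] by (simp add: min_def del: Min_insert)
  qed
  have last: "nxt (insert (Suc n) E) n = Suc n"
    using fE E(1) by (intro nxt_eqI) auto
  consider "a = m" | "m < a" "a \<le> n" | "a = Suc n" | "a < m \<or> a > Suc n" by linarith
  then show "pE m (Suc n) (insert (Suc n) E) p a = pE m n E p a"
  proof cases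
    case 2
    then have "a - 1 < n" by linarith
    then show ?thesis using 2 nxt_insert_Suc[OF E] by (simp add: pE_def)
  next
    case 3
    then show ?thesis using \<open>m \<le> n\<close> E(2) last by (simp add: pE_def)
  qed (use Min in \<open>auto simp: pE_def\<close>)
qed

lemma pE_replace:
  assumes E: "E \<subseteq> {m..n}" "n \<in> E" and "m \<le> n"
  shows "pE m (Suc n) (insert (Suc n) (E - {n})) p = pE m n E (p \<circ> adj_swap n)"
proof
  fix a
  let ?s = "adj_swap n" and ?E = "insert (Suc n) (E - {n})"
  have fE: "finite E" using E(1) finite_subset by blast
  have Min: "Min ?E = ?s (Min E)"
  proof (cases "E - {n} = {}")
    case True
    then have "E = {n}" using E(2) by auto
    then show ?thesis by simp
  next
    case False
    then obtain e where e: "e \<in> E" "e < n" using E(1) by fastforce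
    then have "Min E < n" using fE by (meson Min_le le_less_trans)
    then have "?s (Min E) = Min E" by (simp add: Transposition.transpose_def)
    moreover have "Min ?E = Min E"
    proof (rule Min_eqI)
      have "Min E \<in> E" using fE E(2) by (intro Min_in) auto
      then show "Min E \<in> ?E" using \<open>Min E < n\<close> by auto
      show "Min E \<le> y" if "y \<in> ?E" for y
        using that fE \<open>Min E < n\<close> Min_le[OF fE, of y] by auto
    qed (use fE in auto)
    ultimately show ?thesis by simp
  qed
  consider "a = m" | "m < a" "a \<le> n" | "a = Suc n" | "a < m \<or> a > Suc n" by linarith
  then show "pE m (Suc n) ?E p a = pE m n E (p \<circ> ?s) a"
  proof cases
    case 2
    then have "a - 1 < n" by linarith
    then show ?thesis using 2 nxt_replace_Suc[OF E, of "a - 1"] by (simp add: pE_def)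
  next
    case 3
    then show ?thesis using \<open>m \<le> n\<close> by (simp add: pE_def)
  next
    case 4
    then show ?thesis using \<open>m \<le> n\<close> by (auto simp: pE_def)
  qed (use Min in \<open>auto simp: pE_def\<close>)
qed

text \<open>Split by whether the additional column \<open>n\<close> carries a crossing. If it does,
  \<open>n\<close> is replaced by \<open>Suc n\<close> in a set for the permutation with that
  crossing removed.\<close>

lemma Es_Suc:
  assumes "m \<le> n"
  shows "Es m (Suc n) p = insert (Suc n) ` Es m n p \<union>
    (if p n > p (Suc n) then (\<lambda>E. insert (Suc n) (E - {n})) ` Es m n (p \<circ> adj_swap n) else {})"
    (is "_ = ?A \<union> ?B")
proof (intro equalityI subsetI)
  let ?s = "adj_swap n"
  fix E assume E: "E \<in> Es m (Suc n) p"
  note Ep = EsD[OF E]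
  have s_id: "?s c = c" if "c < n" for c using that by (simp add: Transposition.transpose_def)
  show "E \<in> ?A \<union> ?B"
  proof (cases "n \<in> E")
    case True
    define E1 where "E1 = E - {Suc n}"
    have E1: "E1 \<subseteq> {m..n}" "n \<in> E1" "insert (Suc n) E1 = E"
      using Ep(1,3) True by (auto simp: E1_def le_Suc_eq)
    have "p (nxt E1 c) < p c" if "c \<in> {m..n} - E1" for c
    proof -
      have "c < n" using that E1(2) by (cases "c = n") auto
      then have "nxt E1 c = nxt E c" using nxt_insert_Suc[OF E1(1,2)] E1(3) by metis
      then show ?thesis using Ep(4)[of c] that by (auto simp: E1_def)
    qed
    then have "E1 \<in> Es m n p" using E1 by (simp add: Es_def)
    then show ?thesis using E1(3) by blast
  next
    case False
    define E1 where "E1 = insert n (E - {Suc n})"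
    have E1: "E1 \<subseteq> {m..n}" "n \<in> E1" "insert (Suc n) (E1 - {n}) = E"
      using Ep(1,3) False assms by (auto simp: E1_def le_Suc_eq)
    have "(p \<circ> ?s) (nxt E1 c) < (p \<circ> ?s) c" if "c \<in> {m..n} - E1" for c
    proof -
      have "c < n" using that E1(2) by (cases "c = n") auto
      then have "?s (nxt E1 c) = nxt E c" using nxt_replace_Suc[OF E1(1,2)] E1(3) by metis
      moreover have "p (nxt E c) < p c" using Ep(4)[of c] that by (auto simp: E1_def)
      ultimately show ?thesis using s_id[OF \<open>c < n\<close>] by simp
    qed
    then have "E1 \<in> Es m n (p \<circ> ?s)" using E1 by (simp add: Es_def)
    moreover have "p n > p (Suc n)"
    proof -
      have "nxt E n = Suc n" using Ep(1,2,3) by (intro nxt_eqI) auto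
      then show ?thesis using Ep(4)[of n] False assms by simp
    qed
    ultimately have "E \<in> ?B" using E1(3) by auto
    then show ?thesis by blast
  qed
next
  let ?s = "adj_swap n"
  fix E assume "E \<in> ?A \<union> ?B"
  then consider E1 where "E1 \<in> Es m n p" "E = insert (Suc n) E1"
    | E1 where "E1 \<in> Es m n (p \<circ> ?s)" "E = insert (Suc n) (E1 - {n})" "p n > p (Suc n)"
    by (auto split: if_splits)
  then show "E \<in> Es m (Suc n) p"
  proof cases
    case 1
    note Ep = EsD[OF 1(1)]
    have "p (nxt E c) < p c" if "c \<in> {m..Suc n} - E" for c
    proof -
      have "c < n" using that 1(2) Ep(3) by (cases "c = n") auto
      then show ?thesis using Ep(4)[of c] that 1(2) nxt_insert_Suc[OF Ep(1,3), of c] by auto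
    qed
    then show ?thesis using 1 Ep(1) assms by (auto simp: Es_def)
  next
    case 2
    note Ep = EsD[OF 2(1)]
    have "p (nxt E c) < p c" if "c \<in> {m..Suc n} - E" for c
    proof (cases "c = n")
      case True
      have "nxt E n = Suc n" using Ep(1,2) 2(2) by (intro nxt_eqI) auto
      then show ?thesis using 2(3) True by simp
    next
      case False
      then have "c < n" using that 2(2) by auto
      then have "?s c = c" by (simp add: Transposition.transpose_def)
      then show ?thesis using Ep(4)[of c] that 2(2) \<open>c < n\<close> nxt_replace_Suc[OF Ep(1,3), of c] by auto
    qed
    then show ?thesis using 2 Ep(1) assms by (auto simp: Es_def)
  qed
qed

lemma Aop_expand:
  assumes "m \<le> n"
  shows "Aop n m x F p = (\<Sum>E\<in>Es m n p. x ^ (Suc n - m - card E) * F (pE m n E p))"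
  using assms
proof (induction n arbitrary: p rule: dec_induct)
  case base
  have "Es m m p = {{m}}" by (auto simp: Es_def)
  moreover have "pE m m {m} p = p" by (auto simp: pE_def fun_eq_iff)
  ultimately show ?case by simp
next
  case (step n)
  let ?s = "adj_swap n"
  let ?f = "insert (Suc n)" and ?g = "\<lambda>E. insert (Suc n) (E - {n})"
  define T where "T E = x ^ (Suc (Suc n) - m - card E) * F (pE m (Suc n) E p)" for E
  have injf: "inj_on ?f (Es m n q)" and injg: "inj_on ?g (Es m n q)" for q
  proof -
    show "inj_on ?f (Es m n q)"
    proof (rule inj_onI)
      fix A B assume AB: "A \<in> Es m n q" "B \<in> Es m n q" "?f A = ?f B"
      then have "Suc n \<notin> A" "Suc n \<notin> B" using EsD(1)[OF AB(1)] EsD(1)[OF AB(2)] by auto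
      then show "A = B" using AB(3) by (metis Diff_insert_absorb)
    qed
    show "inj_on ?g (Es m n q)"
    proof (rule inj_onI)
      fix A B assume AB: "A \<in> Es m n q" "B \<in> Es m n q" "?g A = ?g B"
      then have "Suc n \<notin> A - {n}" "Suc n \<notin> B - {n}" using EsD(1)[OF AB(1)] EsD(1)[OF AB(2)] by auto
      then have "A - {n} = B - {n}" using AB(3) by (metis Diff_insert_absorb)
      then show "A = B" using EsD(3)[OF AB(1)] EsD(3)[OF AB(2)] by (metis insert_Diff)
    qed
  qed
  have Tf: "T (?f E) = x ^ (Suc n - m - card E) * F (pE m n E p)" if "E \<in> Es m n p" for E
  proof -
    note E = EsD[OF that]
    have "Suc n \<notin> E" using E(1) by auto
    then show ?thesis using E(2) by (simp add: T_def pE_insert[OF E(1,3) step(1)])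
  qed
  have Tg: "T (?g E) = x * (x ^ (Suc n - m - card E) * F (pE m n E (p \<circ> ?s)))"
    if "E \<in> Es m n (p \<circ> ?s)" for E
  proof -
    note E = EsD[OF that]
    have "Suc n \<notin> E - {n}" using E(1) by auto
    then have "card (?g E) = card E"
      using E(2,3) card_Suc_Diff1[of E n] by simp
    moreover have "card E \<le> Suc n - m" using card_mono[OF _ E(1)] by simp
    then have "Suc (Suc n) - m - card E = Suc (Suc n - m - card E)" using step(1) by linarith
    ultimately show ?thesis by (simp add: T_def pE_replace[OF E(1,3) step(1)] mult.assoc)
  qed
  have disj: "?f ` Es m n p \<inter> ?g ` Es m n q = {}" for q
  proof -
    have "n \<in> X" if "X \<in> ?f ` Es m n p" for X using that by (auto simp: Es_def)
    moreover have "n \<notin> X" if "X \<in> ?g ` Es m n q" for X using that by auto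
    ultimately show ?thesis by blast
  qed
  have "Aop (Suc n) m x F p = Aop n m x F p + x * (if p n > p (Suc n) then Aop n m x F (p \<circ> ?s) else 0)"
    by (simp add: Aop_Suc[OF step(1)] hop_def uop_def)
  also have "\<dots> = (\<Sum>E\<in>Es m n p. T (?f E)) + (if p n > p (Suc n) then \<Sum>E\<in>Es m n (p \<circ> ?s). T (?g E) else 0)"
  proof -
    have "Aop n m x F p = (\<Sum>E\<in>Es m n p. T (?f E))"
      unfolding step.IH by (intro sum.cong refl Tf[symmetric])
    moreover have "x * Aop n m x F (p \<circ> ?s) = (\<Sum>E\<in>Es m n (p \<circ> ?s). T (?g E))"
      unfolding step.IH sum_distrib_left by (intro sum.cong refl Tg[symmetric])
    ultimately show ?thesis by (simp only: if_distrib[of "\<lambda>z. x * z"] mult_zero_right)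
  qed
  also have "\<dots> = (\<Sum>E\<in>?f ` Es m n p. T E) + (if p n > p (Suc n) then \<Sum>E\<in>?g ` Es m n (p \<circ> ?s). T E else 0)"
    by (simp add: sum.reindex[OF injf] sum.reindex[OF injg])
  also have "\<dots> = (\<Sum>E\<in>Es m (Suc n) p. T E)"
    unfolding Es_Suc[OF step(1)] using disj finite_Es by (simp add: sum.union_disjoint)
  finally show ?case by (simp add: T_def)
qed

lemma Gf_expand:
  "m \<le> n \<Longrightarrow> Gf n m p = (\<Sum>E\<in>Es m n p. Var m ^ (Suc n - m - card E) * Gf n (Suc m) (pE m n E p))"
  by (subst Gf_rec) (rule Aop_expand)

lemma lookup_monomial_mult:
  fixes g :: mpoly
  shows "Poly_Mapping.lookup (Poly_Mapping.single \<mu> 1 * g) (\<mu> + \<beta>) = Poly_Mapping.lookup g \<beta>"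
    and "(\<And>\<beta>. \<alpha> \<noteq> \<mu> + \<beta>) \<Longrightarrow> Poly_Mapping.lookup (Poly_Mapping.single \<mu> 1 * g) \<alpha> = 0"
proof -
  have eq: "Poly_Mapping.single \<mu> 1 * g = (\<Sum>m\<in>Poly_Mapping.keys g. Poly_Mapping.single (\<mu> + m) (Poly_Mapping.lookup g m))"
    by (subst poly_mapping_sum_single[of "Poly_Mapping.keys g" g])
      (auto simp: sum_distrib_left mult_single intro!: sum.cong)
  have "Poly_Mapping.lookup (Poly_Mapping.single \<mu> 1 * g) (\<mu> + \<beta>) =
      (\<Sum>m\<in>Poly_Mapping.keys g. Poly_Mapping.lookup g m when m = \<beta>)"
    unfolding eq by (simp add: lookup_sum lookup_single)
  also have "\<dots> = Poly_Mapping.lookup g \<beta>"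
    by (cases "\<beta> \<in> Poly_Mapping.keys g") (auto simp: when_def in_keys_iff)
  finally show "Poly_Mapping.lookup (Poly_Mapping.single \<mu> 1 * g) (\<mu> + \<beta>) = Poly_Mapping.lookup g \<beta>" .
  show "Poly_Mapping.lookup (Poly_Mapping.single \<mu> 1 * g) \<alpha> = 0" if "\<And>\<beta>. \<alpha> \<noteq> \<mu> + \<beta>"
    unfolding eq lookup_sum using that by (intro sum.neutral) (auto simp: lookup_single when_def)
qed

lemma Var_power: "Var j ^ k = Poly_Mapping.single (Poly_Mapping.single j k) 1"
  by (induction k) (auto simp: Var_def mult_single single_add[symmetric])

lemma lookup_Var_power_mult:
  assumes "in_vars V g" "m \<notin> V"
  shows "Poly_Mapping.lookup (Var m ^ k * g) \<alpha> =
    (if Poly_Mapping.lookup \<alpha> m = k then Poly_Mapping.lookup g (\<alpha> - Poly_Mapping.single m k) else 0)"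
proof (cases "k \<le> Poly_Mapping.lookup \<alpha> m")
  case True
  define \<beta> where "\<beta> = \<alpha> - Poly_Mapping.single m k"
  have \<alpha>: "\<alpha> = Poly_Mapping.single m k + \<beta>"
  proof (rule poly_mapping_eqI)
    fix l show "Poly_Mapping.lookup \<alpha> l = Poly_Mapping.lookup (Poly_Mapping.single m k + \<beta>) l"
      using True by (cases "l = m") (auto simp: \<beta>_def lookup_add lookup_minus lookup_single when_def)
  qed
  have eq: "Poly_Mapping.lookup (Var m ^ k * g) \<alpha> = Poly_Mapping.lookup g \<beta>"
    unfolding Var_power by (subst \<alpha>) (rule lookup_monomial_mult)
  show ?thesis
  proof (cases "Poly_Mapping.lookup \<alpha> m = k")
    case False
    then have "m \<in> Poly_Mapping.keys \<beta>"
      using True by (simp add: in_keys_iff \<beta>_def lookup_minus lookup_single)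
    then have "\<beta> \<notin> Poly_Mapping.keys g" using assms by (auto simp: in_vars_def)
    then show ?thesis using eq False by (simp add: in_keys_iff)
  qed (use eq \<beta>_def in simp)
next
  case False
  have "\<alpha> \<noteq> Poly_Mapping.single m k + \<beta>" for \<beta>
    using False by (auto simp: lookup_add lookup_single)
  then show ?thesis unfolding Var_power using False lookup_monomial_mult(2) by auto
qed

section \<open>Rothe diagrams and the choices of the top row\<close>

text \<open>The columns of the Rothe diagram of \<open>w\<close>; column \<open>w q\<close> is indexed by \<open>q\<close>.\<close>
definition cols :: "(nat \<Rightarrow> nat) \<Rightarrow> nat \<Rightarrow> nat list" where
  "cols w q = sorted_list_of_set {a. a < q \<and> w q < w a}"

lemma set_cols: "set (cols w q) = {a. a < q \<and> w q < w a}"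
  by (simp add: cols_def)

lemma mset_cols: "mset (cols w q) = mset_set {a. a < q \<and> w q < w a}"
  using mset_set_set[of "cols w q"] by (simp add: set_cols) (simp add: cols_def)

lemma sum_fibres:
  fixes f :: "'b \<Rightarrow> nat"
  assumes "finite C" "finite R" "\<And>q. q \<in> C \<Longrightarrow> \<beta> q \<in> R"
  shows "(\<Sum>q\<in>C. f (\<beta> q)) = (\<Sum>b\<in>R. card {q \<in> C. \<beta> q = b} * f b)"
proof -
  have "(\<Sum>q\<in>C. f (\<beta> q)) = (\<Sum>b\<in>R. \<Sum>q\<in>{q \<in> C. \<beta> q = b}. f (\<beta> q))"
    using assms by (intro sum.group[symmetric]) auto
  then show ?thesis by simp
qed

context
  fixes m n :: nat and w p :: "nat \<Rightarrow> nat"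
  assumes w: "w permutes {m..n}" and p: "p = inv w"
begin

lemma pw: "p (w a) = a" and wp: "w (p a) = a"
  using permutes_inverses[OF w] by (auto simp: p)

lemma w_eq: "w a = w b \<longleftrightarrow> a = b"
  using pw by metis

lemma w_mem: "w a \<in> {m..n} \<longleftrightarrow> a \<in> {m..n}" and p_mem: "p a \<in> {m..n} \<longleftrightarrow> a \<in> {m..n}"
  using permutes_in_image[OF w] permutes_in_image[OF permutes_inv[OF w]] by (auto simp: p)

lemma w_low: "a < m \<Longrightarrow> w a = a"
  using permutes_not_in[OF w, of a] by auto

text \<open>The positions of the crossings, that is, the diagram columns that receive the row
  \<open>m\<close> and lose a box.\<close>

definition cutset :: "nat set \<Rightarrow> nat set" where
  "cutset E = {q \<in> {m..n}. w q \<notin> E}"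

lemma inversion_range:
  assumes "a < q" "w q < w a"
  shows "a \<in> {m..n}" "q \<in> {m..n}"
proof -
  show q: "q \<in> {m..n}"
  proof (rule ccontr)
    assume "q \<notin> {m..n}"
    then have wq: "w q = q" using permutes_not_in[OF w] by blast
    then have "a < w a" using assms by simp
    then have "w a \<noteq> a" by simp
    then have "a \<in> {m..n}" using permutes_not_in[OF w] by blast
    then have "w a \<in> {m..n}" using w_mem by blast
    then show False using assms wq \<open>q \<notin> {m..n}\<close> \<open>a \<in> {m..n}\<close> by auto
  qed
  have "m \<le> a"
  proof (rule ccontr)
    assume "\<not> m \<le> a"
    then have "w a < m" using w_low by simp
    moreover have "m \<le> w q" using q w_mem by (meson atLeastAtMost_iff)
    ultimately show False using assms by simp
  qed
  then show "a \<in> {m..n}" using assms q by simp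
qed

lemma nxt_Es:
  assumes "E \<in> Es m n p" "c \<in> {m..n}" "c \<notin> E"
  shows "nxt E c \<in> E" "c < nxt E c" "p (nxt E c) < p c"
proof -
  have "c < n" using EsD(3)[OF assms(1)] assms(2,3) by (cases "c = n") auto
  then show "nxt E c \<in> E" "c < nxt E c" using nxt_props[OF EsD(2,3)[OF assms(1)]] by auto
  show "p (nxt E c) < p c" using EsD(4)[OF assms] .
qed

text \<open>Suppose the largest element \<open>x\<close> in which \<open>E\<close> and
  \<open>E'\<close> differ lies in \<open>E\<close>. The step to the next element of
  \<open>E\<close> never carries a value from below \<open>x\<close> to above \<open>x\<close>. For
  \<open>E'\<close>, however, \<open>\<beta>\<close> raises every value and carries \<open>x\<close>
  itself above \<open>x\<close>. So the numbers of chosen rows with value above \<open>x\<close>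
  differ, although the multisets of chosen rows agree.\<close>

lemma row_choice_order:
  assumes E: "E \<in> Es m n p" and E': "E' \<in> Es m n p"
    and \<beta>: "\<And>q. q \<in> cutset E' \<Longrightarrow> \<beta> q < q \<and> w q < w (\<beta> q)"
    and cnt: "\<And>b. b \<noteq> m \<Longrightarrow> card {q \<in> cutset E'. \<beta> q = b} = card {q \<in> cutset E. p (nxt E (w q)) = b}"
    and tot: "card (cutset E') = card (cutset E)"
  shows "(E = E' \<and> (\<forall>q\<in>cutset E. \<beta> q = p (nxt E (w q)))) \<or> (\<Sum>e\<in>E. 2 ^ e) < (\<Sum>e\<in>E'. 2 ^ e :: nat)"
proof (rule disjCI)
  assume le: "\<not> (\<Sum>e\<in>E. 2 ^ e) < (\<Sum>e\<in>E'. 2 ^ e :: nat)"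
  define st where "st q = p (nxt E (w q))" for q
  define R where "R = {m..n}"
  have fin: "finite R" "finite (cutset E)" "finite (cutset E')" by (auto simp: R_def cutset_def)
  have \<beta>R: "\<beta> q \<in> R" if "q \<in> cutset E'" for q
    using inversion_range[of "\<beta> q" q] \<beta>[OF that] by (auto simp: R_def)
  have st: "w (st q) \<in> E" "w q < w (st q)" "st q \<in> R" if "q \<in> cutset E" for q
  proof -
    have "w q \<in> {m..n}" "w q \<notin> E" using that w_mem by (auto simp: cutset_def)
    note nx = nxt_Es[OF E this]
    show "w (st q) \<in> E" "w q < w (st q)" using nx by (auto simp: st_def wp)
    have "nxt E (w q) \<in> {m..n}" using nx(1) EsD(1)[OF E] by blast
    then show "st q \<in> R" using p_mem by (simp add: st_def R_def)
  qed
  have cnt': "card {q \<in> cutset E'. \<beta> q = b} = card {q \<in> cutset E. st q = b}" for b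
  proof (cases "b \<in> R - {m}")
    case True
    then show ?thesis using cnt by (simp add: st_def)
  next
    case False
    show ?thesis
    proof (cases "b = m")
      case True
      have *: "card (cutset E') = (\<Sum>b\<in>R. card {q \<in> cutset E'. \<beta> q = b})"
        "card (cutset E) = (\<Sum>b\<in>R. card {q \<in> cutset E. st q = b})"
        using sum_fibres[where f = "\<lambda>_. 1", OF fin(3,1) \<beta>R] sum_fibres[where f = "\<lambda>_. 1", OF fin(2,1) st(3)] by simp_all
      have "(\<Sum>b\<in>R - {m}. card {q \<in> cutset E'. \<beta> q = b}) = (\<Sum>b\<in>R - {m}. card {q \<in> cutset E. st q = b})"
        using cnt by (intro sum.cong) (auto simp: st_def)
      moreover have "m \<in> R" using EsD(1,3)[OF E] by (auto simp: R_def)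
      ultimately show ?thesis using * tot True fin(1) by (simp add: sum.remove[of R m])
    next
      case False
      then show ?thesis using cnt by (simp add: st_def)
    qed
  qed
  have sums: "(\<Sum>q\<in>cutset E'. f (\<beta> q)) = (\<Sum>q\<in>cutset E. f (st q))" for f :: "nat \<Rightarrow> nat"
    using sum_fibres[where f = f, OF fin(3,1) \<beta>R] sum_fibres[where f = f, OF fin(2,1) st(3)] cnt' by simp
  have "E' = E"
  proof (rule ccontr)
    assume "E' \<noteq> E"
    then obtain x where x: "x \<in> E" "x \<notin> E'" "\<And>y. y > x \<Longrightarrow> y \<in> E' \<longleftrightarrow> y \<in> E"
      using colex_witness[of E' E] EsD(2)[OF E] EsD(2)[OF E'] le by (metis linorder_not_less)
    have "card {q \<in> cutset E'. x < w (\<beta> q)} = card {q \<in> cutset E. x < w (st q)}"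
    proof -
      have *: "(\<Sum>q\<in>C. if P q then 1 else 0) = card {q \<in> C. P q}" if "finite C" for C and P :: "nat \<Rightarrow> bool"
        using that by (simp add: sum.If_cases Int_def)
      show ?thesis
        using sums[of "\<lambda>b. if x < w b then 1 else 0"] *[OF fin(3), of "\<lambda>q. x < w (\<beta> q)"] *[OF fin(2), of "\<lambda>q. x < w (st q)"]
        by simp
    qed
    moreover have "{q \<in> cutset E. x < w (st q)} = {q \<in> cutset E'. x < w q}"
    proof (rule Collect_cong)
      fix q
      show "q \<in> cutset E \<and> x < w (st q) \<longleftrightarrow> q \<in> cutset E' \<and> x < w q"
      proof (cases "q \<in> {m..n} \<and> x < w q")
        case True
        then show ?thesis using x(3) st(2)[of q] by (auto simp: cutset_def)
      next
        case False
        have "\<not> x < w (st q)" if "q \<in> cutset E"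
        proof -
          have "w q < x" using False that x(1) by (auto simp: cutset_def not_less le_less)
          then have "nxt E (w q) \<le> x" using nxt_props(3)[OF EsD(2)[OF E] x(1)] by blast
          then show ?thesis by (simp add: st_def wp)
        qed
        then show ?thesis using False by (auto simp: cutset_def)
      qed
    qed
    moreover have "{q \<in> cutset E'. x < w q} \<subset> {q \<in> cutset E'. x < w (\<beta> q)}"
    proof
      show "{q \<in> cutset E'. x < w q} \<subseteq> {q \<in> cutset E'. x < w (\<beta> q)}" using \<beta> by force
      have "x \<in> {m..n}" using x(1) EsD(1)[OF E] by blast
      then have "p x \<in> cutset E'" using x(2) p_mem by (auto simp: cutset_def wp)
      moreover from this have "x < w (\<beta> (p x))" using \<beta>[of "p x"] by (simp add: wp)
      ultimately show "{q \<in> cutset E'. x < w q} \<noteq> {q \<in> cutset E'. x < w (\<beta> q)}"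
        using wp[of x] by (metis (mono_tags, lifting) less_irrefl mem_Collect_eq)
    qed
    then have "card {q \<in> cutset E'. x < w q} < card {q \<in> cutset E'. x < w (\<beta> q)}"
      using fin(3) by (intro psubset_card_mono) auto
    ultimately show False by simp
  qed
  \<comment> \<open>For \<open>E' = E\<close> every row chosen by \<open>\<beta>\<close> is also
    chosen by \<open>st\<close>, so its value lies in \<open>E\<close> above \<open>w q\<close> and
    is at least the next element. Equal sums of the values then force equality everywhere.\<close>
  have ge: "w (st q) \<le> w (\<beta> q)" if "q \<in> cutset E" for q
  proof -
    have "q \<in> {r \<in> cutset E'. \<beta> r = \<beta> q}" using that \<open>E' = E\<close> by simp
    then have "card {r \<in> cutset E. st r = \<beta> q} \<noteq> 0"
      unfolding cnt'[symmetric] using fin(3) by (auto simp: card_eq_0_iff)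
    then have "{r \<in> cutset E. st r = \<beta> q} \<noteq> {}" by (metis card.empty)
    then obtain r where "r \<in> cutset E" "st r = \<beta> q" by auto
    then have "w (\<beta> q) \<in> E" using st(1) by metis
    then have "nxt E (w q) \<le> w (\<beta> q)"
      using nxt_props(3)[OF EsD(2)[OF E]] \<beta>[of q] that \<open>E' = E\<close> by blast
    then show ?thesis by (simp add: st_def wp)
  qed
  have "w (st q) = w (\<beta> q)" if "q \<in> cutset E" for q
    by (rule sum_mono_inv[of "\<lambda>q. w (st q)" "cutset E" "\<lambda>q. w (\<beta> q)"])
      (use sums[of w] \<open>E' = E\<close> ge that fin(2) in auto)
  then show "E = E' \<and> (\<forall>q\<in>cutset E. \<beta> q = p (nxt E (w q)))"
    using \<open>E' = E\<close> w_eq by (auto simp: st_def)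
qed

lemma inv_pE:
  assumes E: "E \<in> Es m n p" and V: "bij (pE m n E p)" and q: "q \<in> {m..n}"
  defines "V \<equiv> inv (pE m n E p)"
  shows "w q \<notin> E \<Longrightarrow> V q = Suc (w q)"
    and "w q \<in> E \<Longrightarrow> (\<exists>e\<in>E. e < w q \<and> V q = Suc e \<and> (\<forall>d\<in>E. d < w q \<longrightarrow> d \<le> e)) \<or>
           (V q = m \<and> (\<forall>d\<in>E. w q \<le> d))"
proof -
  have eq: "V q = a" if "pE m n E p a = q" for a
    using that V inv_f_f[OF bij_is_inj[OF V]] by (auto simp: V_def)
  have wq: "m \<le> w q" "w q \<le> n" using q w_mem[of q] by auto
  note Ep = EsD[OF E]
  show "V q = Suc (w q)" if "w q \<notin> E"
  proof (rule eq)
    have "w q < n" using that Ep(3) wq by (cases "w q = n") auto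
    then show "pE m n E p (Suc (w q)) = q" using wq that by (simp add: pE_def pw)
  qed
  assume wE: "w q \<in> E"
  show "(\<exists>e\<in>E. e < w q \<and> V q = Suc e \<and> (\<forall>d\<in>E. d < w q \<longrightarrow> d \<le> e)) \<or>
      (V q = m \<and> (\<forall>d\<in>E. w q \<le> d))"
  proof (cases "\<exists>d\<in>E. d < w q")
    case True
    define e where "e = Max {d \<in> E. d < w q}"
    have f: "finite {d \<in> E. d < w q}" "{d \<in> E. d < w q} \<noteq> {}" using True Ep(2) by auto
    have e: "e \<in> E" "e < w q" using Max_in[OF f] by (auto simp: e_def)
    have max: "d \<le> e" if "d \<in> E" "d < w q" for d using f(1) that by (auto simp: e_def)
    have "nxt E e = w q"
      using Ep(2) wE e(2)
    proof (rule nxt_eqI)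
      fix d assume "d \<in> E" "e < d"
      then show "w q \<le> d" using max[of d] by (cases "d < w q") auto
    qed
    then have "pE m n E p (Suc e) = q" using e Ep(1) wq by (auto simp: pE_def pw)
    then have "V q = Suc e" by (rule eq)
    then show ?thesis using e max by blast
  next
    case False
    then have "Min E = w q" using wE Ep(2) by (intro Min_eqI) (auto simp: not_less)
    then have "V q = m" by (intro eq) (simp add: pE_def pw)
    then show ?thesis using False by (auto simp: not_less)
  qed
qed

text \<open>By \<open>inv_pE\<close>, a value \<open>c\<close> outside \<open>E\<close> moves to
  \<open>c + 1\<close>, and an element of \<open>E\<close> moves to one above its predecessor in
  \<open>E\<close>, or to \<open>m\<close>. The only comparisons affected are those between some
  \<open>c\<close> outside \<open>E\<close> and \<open>nxt E c\<close>, so each cut column loses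
  exactly that box.\<close>

lemma inversions_pE:
  assumes E: "E \<in> Es m n p" and V: "pE m n E p permutes {Suc m..n}" and q: "q \<in> {m..n}"
  defines "V \<equiv> inv (pE m n E p)"
  shows "{a. a < q \<and> V q < V a} =
    {a. a < q \<and> w q < w a} - (if w q \<in> E then {} else {p (nxt E (w q))})"
proof -
  have bij: "bij (pE m n E p)" using V by (rule permutes_bij)
  have Vp: "V permutes {Suc m..n}" unfolding V_def using V by (rule permutes_inv)
  note Ep = EsD[OF E]
  have iff: "V q < V a \<longleftrightarrow> w q < w a \<and> (w q \<in> E \<or> a \<noteq> p (nxt E (w q)))"
    if a: "a \<in> {m..n}" "a < q" for a
  proof -
    note Vq = inv_pE[OF E bij q, folded V_def] and Va = inv_pE[OF E bij a(1), folded V_def]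
    have wm: "w q \<in> {m..n}" "w a \<in> {m..n}" using q a(1) w_mem by blast+
    have ne: "w q \<noteq> w a" using a(2) w_eq by auto
    have val: "q < a" if "w a \<notin> E" "nxt E (w a) = w q"
      using nxt_Es(3)[OF E wm(2) that(1)] that(2) by (simp add: pw)
    have a_nxt: "a = p (nxt E (w q)) \<longleftrightarrow> w a = nxt E (w q)"
      using pw[of a] wp[of "nxt E (w q)"] by auto
    show ?thesis
    proof (cases "w a \<in> E")
      case aE: True
      show ?thesis
      proof (cases "w q \<in> E")
        case True
        from Vq(2)[OF True] Va(2)[OF aE] have "V q < V a \<longleftrightarrow> w q < w a"
        proof (elim disjE bexE conjE)
          fix e d
          assume "e \<in> E" "e < w q" "V q = Suc e" "\<forall>d\<in>E. d < w q \<longrightarrow> d \<le> e"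
            "d \<in> E" "d < w a" "V a = Suc d" "\<forall>e\<in>E. e < w a \<longrightarrow> e \<le> d"
          moreover from this have "w q < w a \<Longrightarrow> w q \<le> d" "w a < w q \<Longrightarrow> w a \<le> e"
            using True aE by blast+
          ultimately show ?thesis using ne by linarith
        next
          fix e assume "e \<in> E" "V q = Suc e" "V a = m" "\<forall>d\<in>E. w a \<le> d"
          moreover from this have "w a \<le> w q" "m \<le> e" using True Ep(1) by auto
          ultimately show ?thesis by linarith
        next
          fix e assume "e \<in> E" "V a = Suc e" "V q = m" "\<forall>d\<in>E. w q \<le> d"
          moreover from this have "w q \<le> w a" "m \<le> e" using aE Ep(1) by auto
          ultimately show ?thesis using ne by linarith
        next
          assume "\<forall>d\<in>E. w q \<le> d" "\<forall>d\<in>E. w a \<le> d"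
          then have "w q \<le> w a" "w a \<le> w q" using True aE by auto
          then show ?thesis using ne by simp
        qed
        then show ?thesis using True by simp
      next
        case False
        note nx = nxt_Es[OF E wm(1) False]
        have nle: "nxt E (w q) \<le> d" if "d \<in> E" "w q < d" for d
          using nxt_props(3)[OF Ep(2) that] .
        from Va(2)[OF aE] show ?thesis
        proof (elim disjE bexE conjE)
          fix e assume e: "e \<in> E" "e < w a" "V a = Suc e" "\<forall>d\<in>E. d < w a \<longrightarrow> d \<le> e"
          have "w q < e \<longleftrightarrow> w q < w a \<and> w a \<noteq> nxt E (w q)"
          proof
            assume "w q < e"
            then show "w q < w a \<and> w a \<noteq> nxt E (w q)" using e(2) nle[OF e(1)] by auto
          next
            assume *: "w q < w a \<and> w a \<noteq> nxt E (w q)"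
            then have "nxt E (w q) < w a" using nle[OF aE] by auto
            then have "nxt E (w q) \<le> e" using e(4) nx(1) by blast
            then show "w q < e" using nx(2) by simp
          qed
          then show ?thesis using Vq(1)[OF False] e(3) False a_nxt by simp
        next
          assume m: "V a = m" "\<forall>d\<in>E. w a \<le> d"
          have "\<not> (w q < w a \<and> w a \<noteq> nxt E (w q))"
            using m(2) nx(1) nle[OF aE] by force
          then show ?thesis using Vq(1)[OF False] m(1) False a_nxt wm(1) by auto
        qed
      qed
    next
      case aE: False
      note nx = nxt_Es[OF E wm(2) aE]
      have nle: "nxt E (w a) \<le> d" if "d \<in> E" "w a < d" for d
        using nxt_props(3)[OF Ep(2) that] .
      show ?thesis
      proof (cases "w q \<in> E")
        case True
        have "nxt E (w a) \<noteq> w q" using val[OF aE] a(2) by auto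
        from Vq(2)[OF True] show ?thesis
        proof (elim disjE bexE conjE)
          fix e assume e: "e \<in> E" "e < w q" "V q = Suc e" "\<forall>d\<in>E. d < w q \<longrightarrow> d \<le> e"
          have "e < w a \<longleftrightarrow> w q < w a"
          proof
            assume "e < w a"
            show "w q < w a"
            proof (rule ccontr)
              assume "\<not> w q < w a"
              then have "nxt E (w a) < w q" using nle[OF True] \<open>nxt E (w a) \<noteq> w q\<close> ne by auto
              then show False using e(4) nx \<open>e < w a\<close> by fastforce
            qed
          qed (use e(2) in simp)
          then show ?thesis using Va(1)[OF aE] e(3) True by simp
        next
          assume m: "V q = m" "\<forall>d\<in>E. w q \<le> d"
          have "w q < w a"
          proof (rule ccontr)
            assume "\<not> w q < w a"
            then show False using nle[OF True] m(2) nx(1) \<open>nxt E (w a) \<noteq> w q\<close> ne by fastforce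
          qed
          then show ?thesis using Va(1)[OF aE] m(1) True wm(2) by simp
        qed
      next
        case False
        have "w a \<noteq> nxt E (w q)" using aE nxt_Es(1)[OF E wm(1) False] by auto
        then show ?thesis using Va(1)[OF aE] Vq(1)[OF False] False a_nxt by simp
      qed
    qed
  qed
  have low: "\<not> V q < V a" "\<not> w q < w a" if "a < m" for a
  proof -
    have "V a = a" "w a = a" using that permutes_not_in[OF Vp, of a] w_low by auto
    moreover have "V q \<in> {m..n}" "w q \<in> {m..n}"
    proof -
      have "V permutes {m..n}" using Vp by (rule permutes_subset) auto
      then show "V q \<in> {m..n}" using permutes_in_image[of V "{m..n}" q] q by auto
      show "w q \<in> {m..n}" using q w_mem by blast
    qed
    ultimately show "\<not> V q < V a" "\<not> w q < w a" using that by auto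
  qed
  show ?thesis
  proof (intro set_eqI)
    fix a
    consider "a < m" | "a \<ge> q" | "a \<in> {m..n}" "a < q" using q by force
    then show "a \<in> {a. a < q \<and> V q < V a} \<longleftrightarrow>
        a \<in> {a. a < q \<and> w q < w a} - (if w q \<in> E then {} else {p (nxt E (w q))})"
    proof cases
      case 1
      then show ?thesis using low by auto
    next
      case 3
      then show ?thesis using iff[OF 3] by auto
    qed auto
  qed
qed

end

lemma wdim_empty_diagram:
  assumes "finite Q" "\<And>q. q \<in> Q \<Longrightarrow> D q = []"
  shows "1 \<le> wdim Q D 0"
proof -
  have "indep {()} (\<lambda>i. minors Q D (\<lambda>q. {}))"
    using assms(2) by (auto simp: indep_def minors_def)
  then have "card {()} \<le> wdim Q D 0"
    using assms(1) by (intro wdim_ge_family[where f = "\<lambda>_ _. {}"]) (auto simp: fillings_def)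
  then show ?thesis by simp
qed

lemma Gf_le_wdim:
  assumes "w permutes {m..n}" "1 \<le> m" "m \<le> n"
  shows "Poly_Mapping.lookup (Gf n m (inv w)) \<alpha> \<le> int (wdim {1..n} (cols w) \<alpha>)"
  using assms
proof (induction "n - m" arbitrary: m w \<alpha>)
  case 0
  then have "m = n" by simp
  then have "w = id" using 0(2) permutes_sing by simp
  then have "Gf n m (inv w) = 1" by (simp add: Gf_ge \<open>m = n\<close>)
  moreover have "1 \<le> wdim {1..n} (cols w) 0"
    by (rule wdim_empty_diagram) (auto simp: cols_def \<open>w = id\<close>)
  ultimately show ?case by (cases "\<alpha> = 0") (auto simp: lookup_one when_def)
next
  case (Suc d)
  define p where "p = inv w"
  define Q where "Q = {1..n}"
  show ?case
  proof (cases "Poly_Mapping.keys \<alpha> \<subseteq> {m..<n}")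
    case False
    then have "\<alpha> \<notin> Poly_Mapping.keys (Gf n m (inv w))"
      using Gf_in_vars[of m n "inv w"] by (auto simp: in_vars_def)
    then show ?thesis by (simp add: in_keys_iff)
  next
    case True
    define k where "k = Poly_Mapping.lookup \<alpha> m"
    define \<alpha>' where "\<alpha>' = \<alpha> - Poly_Mapping.single m k"
    \<comment> \<open>Only these \<open>E\<close> contribute to the coefficient. Nonvanishing of
      \<open>Gf\<close> makes \<open>pE m n E p\<close> a permutation of \<open>{Suc m..n}\<close>
      by \<open>Gf_support\<close>, so that the induction hypothesis applies.\<close>
    define S where "S = {E \<in> Es m n p. Suc n - m - card E = k \<and> Gf n (Suc m) (pE m n E p) \<noteq> 0}"
    define DE where "DE E = cols (inv (pE m n E p))" for E
    have perm: "pE m n E p permutes {Suc m..n}" if "E \<in> S" for E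
      using that Gf_support by (auto simp: S_def)
    have inEs: "E \<in> Es m n p" if "E \<in> S" for E using that by (simp add: S_def)
    have "Poly_Mapping.lookup (Gf n m p) \<alpha> =
        (\<Sum>E\<in>Es m n p. if Suc n - m - card E = k then Poly_Mapping.lookup (Gf n (Suc m) (pE m n E p)) \<alpha>' else 0)"
      unfolding Gf_expand[OF Suc.prems(3)] lookup_sum
      by (intro sum.cong refl, subst lookup_Var_power_mult[OF Gf_in_vars]) (auto simp: k_def \<alpha>'_def)
    also have "\<dots> = (\<Sum>E\<in>S. Poly_Mapping.lookup (Gf n (Suc m) (pE m n E p)) \<alpha>')"
      using finite_Es by (intro sum.mono_neutral_cong_right) (auto simp: S_def)
    also have "\<dots> \<le> (\<Sum>E\<in>S. int (wdim Q (DE E) \<alpha>'))"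
    proof (rule sum_mono)
      fix E assume E: "E \<in> S"
      have "inv (pE m n E p) permutes {Suc m..n}" using perm[OF E] by (rule permutes_inv)
      moreover have "inv (inv (pE m n E p)) = pE m n E p"
        using perm[OF E] permutes_bij inv_inv_eq by blast
      ultimately show "Poly_Mapping.lookup (Gf n (Suc m) (pE m n E p)) \<alpha>' \<le> int (wdim Q (DE E) \<alpha>')"
        using Suc.hyps(1)[of "Suc m" "inv (pE m n E p)" \<alpha>'] Suc.hyps(2) Suc.prems
        by (simp add: DE_def Q_def)
    qed
    also have "\<dots> \<le> int (wdim Q (cols w) \<alpha>)"
    proof -
      note ctx = Suc.prems(1) p_def
      have cut_card: "card (cutset m n w E) = k" if "E \<in> S" for E
      proof -
        have Ep: "E \<subseteq> {m..n}" using EsD(1)[OF inEs[OF that]] .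
        have "cutset m n w E = p ` ({m..n} - E)"
        proof (intro set_eqI iffI)
          fix q assume "q \<in> cutset m n w E"
          then have "w q \<in> {m..n} - E" using w_mem[OF ctx] by (auto simp: cutset_def[OF ctx])
          then show "q \<in> p ` ({m..n} - E)" using pw[OF ctx, of q] by (metis imageI)
        next
          fix q assume "q \<in> p ` ({m..n} - E)"
          then obtain c where "q = p c" "c \<in> {m..n}" "c \<notin> E" by auto
          then show "q \<in> cutset m n w E" using p_mem[OF ctx] wp[OF ctx] by (simp add: cutset_def[OF ctx])
        qed
        moreover have "inj_on p ({m..n} - E)" using wp[OF ctx] by (metis inj_onI)
        ultimately have "card (cutset m n w E) = card ({m..n} - E)" by (simp add: card_image)
        also have "\<dots> = Suc n - m - card E" using Ep finite_subset[OF Ep] by (simp add: card_Diff_subset)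
        finally show ?thesis using that by (simp add: S_def)
      qed
      have inv: "{a. a < q \<and> inv (pE m n E p) q < inv (pE m n E p) a} =
          {a. a < q \<and> w q < w a} - (if w q \<in> E then {} else {p (nxt E (w q))})"
        if "E \<in> S" "q \<in> {m..n}" for E q
        using inversions_pE[OF ctx inEs[OF that(1)] perm[OF that(1)] that(2)] .
      have st_in: "p (nxt E (w q)) < q \<and> w q < w (p (nxt E (w q)))" if "E \<in> S" "q \<in> cutset m n w E" for E q
      proof -
        have "w q \<in> {m..n}" "w q \<notin> E" using that(2) w_mem[OF ctx] by (auto simp: cutset_def[OF ctx])
        note nx = nxt_Es[OF ctx inEs[OF that(1)] this]
        then show ?thesis by (simp add: pw[OF ctx] wp[OF ctx])
      qed
      have "(\<Sum>E\<in>S. wdim Q (DE E) \<alpha>') \<le> wdim Q (cols w) \<alpha>"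
      proof (rule wdim_first_row[where m = m and cut = "cutset m n w" and st = "\<lambda>E q. p (nxt E (w q))"
            and \<rho> = "\<lambda>E. \<Sum>e\<in>E. 2 ^ e"])
        show "finite Q" "finite S" using finite_Es by (auto simp: Q_def S_def)
        show "cutset m n w E \<subseteq> Q" for E using Suc.prems(2) by (auto simp: cutset_def[OF ctx] Q_def)
        show "card (cutset m n w E) = Poly_Mapping.lookup \<alpha> m" if "E \<in> S" for E
          using cut_card[OF that] by (simp add: k_def)
        show "distinct (cols w q)" for q by (simp add: cols_def)
        show "m \<le> b" if "q \<in> Q" "b \<in> set (cols w q)" for q b
          using that inversion_range[OF ctx, of b q] by (auto simp: set_cols)
        show "mset (cols w q) = add_mset (p (nxt E (w q))) (mset (DE E q))"
          if "E \<in> S" "q \<in> cutset m n w E" for E q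
        proof -
          have q: "q \<in> {m..n}" "w q \<notin> E" using that(2) by (auto simp: cutset_def[OF ctx])
          define X where "X = {a. a < q \<and> w q < w a}"
          have "finite X" by (simp add: X_def)
          moreover have "p (nxt E (w q)) \<in> X" using st_in[OF that] by (simp add: X_def)
          ultimately have "mset_set X = add_mset (p (nxt E (w q))) (mset_set (X - {p (nxt E (w q))}))"
            by (rule mset_set.remove)
          then show ?thesis using inv[OF that(1) q(1)] q(2) by (simp add: mset_cols DE_def X_def)
        qed
        show "mset (cols w q) = mset (DE E q)" if "E \<in> S" "q \<in> Q" "q \<notin> cutset m n w E" for E q
        proof (cases "q \<in> {m..n}")
          case True
          then show ?thesis using inv[OF that(1) True] that(3) by (simp add: mset_cols DE_def cutset_def[OF ctx])
        next
          case False
          have "inv (pE m n E p) permutes {Suc m..n}" using perm[OF that(1)] by (rule permutes_inv)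
          then have "inv (pE m n E p) permutes {m..n}" by (rule permutes_subset) auto
          then have "{a. a < q \<and> inv (pE m n E p) q < inv (pE m n E p) a} = {}"
            using inversion_range(2)[OF _ refl, of "inv (pE m n E p)" m n] False by blast
          moreover have "{a. a < q \<and> w q < w a} = {}" using inversion_range(2)[OF ctx] False by blast
          ultimately show ?thesis by (simp only: mset_cols DE_def)
        qed
        show "Poly_Mapping.lookup \<alpha>' l = Poly_Mapping.lookup \<alpha> l" if "l \<noteq> m" for l
          using that by (simp add: \<alpha>'_def lookup_minus lookup_single)
        show "Poly_Mapping.lookup \<alpha>' l = 0" if "l \<le> m" for l
        proof (cases "l = m")
          case True
          then show ?thesis by (simp add: \<alpha>'_def lookup_minus k_def)
        next
          case False
          then have "l \<notin> Poly_Mapping.keys \<alpha>" using True that by auto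
          then show ?thesis by (simp add: \<alpha>'_def lookup_minus in_keys_iff)
        qed
        show "E = E' \<and> (\<forall>q\<in>cutset m n w E. \<beta> q = p (nxt E (w q))) \<or> (\<Sum>e\<in>E. 2 ^ e) < (\<Sum>e\<in>E'. (2::nat) ^ e)"
          if "E \<in> S" "E' \<in> S" "\<And>q. q \<in> cutset m n w E' \<Longrightarrow> \<beta> q \<in> set (cols w q)"
            "\<And>b. b \<noteq> m \<Longrightarrow> card {q \<in> cutset m n w E'. \<beta> q = b} = card {q \<in> cutset m n w E. p (nxt E (w q)) = b}"
          for E E' \<beta>
          by (rule row_choice_order[OF ctx inEs[OF that(1)] inEs[OF that(2)] _ that(4)])
            (use that(1,2,3) cut_card set_cols in auto)
      qed
      then show ?thesis by (simp flip: of_nat_sum)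
    qed
    finally show ?thesis by (simp add: p_def Q_def)
  qed
qed

section \<open>Divided differences of Schubert polynomials\<close>

definition Sch :: "nat \<Rightarrow> (nat \<Rightarrow> nat) \<Rightarrow> mpoly" where
  "Sch n w = Gf n 1 (inv w)"

text \<open>The longest permutation of \<open>{m..n}\<close>; for \<open>m = 1\<close> it is
  \<open>w_0\<close>.\<close>

definition rv :: "nat \<Rightarrow> nat \<Rightarrow> nat \<Rightarrow> nat" where
  "rv m n a = (if m \<le> a \<and> a \<le> n then m + n - a else a)"

lemma Sch_divdiff:
  assumes w: "w permutes {1..n}" and i: "1 \<le> i" "i < n"
  shows "is_divdiff i (Sch n w)
    (if w i > w (Suc i) then Sch n (w \<circ> adj_swap i) else 0)"
proof -
  have bij: "bij w" using w by (rule permutes_bij)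
  have "inv (w \<circ> adj_swap i) = adj_swap i \<circ> inv w"
    using o_inv_distrib[OF bij, of "adj_swap i"] by simp
  then have "rop i (Gf n 1) (inv w) =
      (if w i > w (Suc i) then Sch n (w \<circ> adj_swap i) else 0)"
    by (simp add: rop_def Sch_def inv_inv_eq[OF bij])
  then show ?thesis
    using Gf_divdiff[of 1 i n "inv w"] i bij_imp_bij_inv[OF bij] by (simp add: Sch_def)
qed

lemma rv_inverse: "rv m n \<circ> rv m n = id"
  by (auto simp: rv_def fun_eq_iff)

lemma inv_rv: "inv (rv m n) = rv m n"
  using rv_inverse by (rule inv_unique_comp) (rule rv_inverse)

lemma rv_permutes: "rv m n permutes {m..n}"
proof (rule bij_imp_permutes)
  show "bij_betw (rv m n) {m..n} {m..n}"
    by (rule bij_betw_byWitness[where f' = "rv m n"]) (auto simp: rv_def)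
qed (auto simp: rv_def)

text \<open>Only \<open>E = {n}\<close> contributes: the remaining factor is supported on
  permutations of \<open>{Suc m..n}\<close>, so \<open>pE\<close> has to fix \<open>m\<close>, and
  the reversal takes the value \<open>m\<close> only at \<open>n\<close>.\<close>

lemma Gf_rv:
  assumes "m \<le> n"
  shows "Gf n m (rv m n) = (\<Prod>j\<in>{m..<n}. Var j ^ (n - j))"
  using assms
proof (induction "n - m" arbitrary: m)
  case 0
  then have "rv m n = id" by (auto simp: rv_def fun_eq_iff)
  then show ?case using 0 by (simp add: Gf_ge id_def)
next
  case (Suc d)
  then have "m < n" by simp
  define p where "p = rv m n"
  have nx: "nxt {n} c = n" if "c < n" for c using that by (intro nxt_eqI) auto
  have "{n} \<in> Es m n p"
    using \<open>m < n\<close> nx by (auto simp: Es_def p_def rv_def)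
  have zero: "Gf n (Suc m) (pE m n E p) = 0" if "E \<in> Es m n p - {{n}}" for E
  proof (rule ccontr)
    assume "Gf n (Suc m) (pE m n E p) \<noteq> 0"
    then have "pE m n E p permutes {Suc m..n}" by (rule Gf_support)
    then have "pE m n E p m = m" by (rule permutes_not_in) simp
    then have "p (Min E) = m" by (simp add: pE_def)
    have inE: "E \<in> Es m n p" using that by simp
    note E = EsD(1,2,3)[OF inE]
    have "Min E \<in> E" using E by (intro Min_in) auto
    then have "Min E \<in> {m..n}" using E(1) by blast
    then have "Min E = n" using \<open>p (Min E) = m\<close> by (auto simp: p_def rv_def)
    have "e = n" if "e \<in> E" for e
      using subsetD[OF E(1) that] Min_le[OF E(2) that] \<open>Min E = n\<close> by simp
    then have "E = {n}" using E(3) by blast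
    then show False using that by simp
  qed
  have pE: "pE m n {n} p = rv (Suc m) n"
  proof
    fix a
    show "pE m n {n} p a = rv (Suc m) n a"
    proof (cases "m < a \<and> a \<le> n")
      case True
      then have "a - 1 \<noteq> n" "m \<le> a - 1" "a - 1 \<le> n" by auto
      then show ?thesis using True by (auto simp: pE_def p_def rv_def)
    next
      case False
      then show ?thesis using \<open>m < n\<close> by (auto simp: pE_def p_def rv_def)
    qed
  qed
  have "Gf n m p = (\<Sum>E\<in>{{n}}. Var m ^ (Suc n - m - card E) * Gf n (Suc m) (pE m n E p))"
    unfolding Gf_expand[OF Suc.prems]
    using finite_Es \<open>{n} \<in> Es m n p\<close> zero by (intro sum.mono_neutral_right) auto
  also have "\<dots> = Var m ^ (n - m) * (\<Prod>j\<in>{Suc m..<n}. Var j ^ (n - j))"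
    using Suc.hyps(1)[of "Suc m"] Suc.hyps(2) \<open>m < n\<close> by (simp add: pE)
  also have "\<dots> = (\<Prod>j\<in>{m..<n}. Var j ^ (n - j))"
    using \<open>m < n\<close> by (simp add: prod.atLeast_Suc_lessThan)
  finally show ?case by (simp add: p_def)
qed

lemma Sch_rv: "Sch n (rv 1 n) = stair n"
proof (cases "n = 0")
  case True
  moreover have "rv 1 0 = id" by (auto simp: rv_def fun_eq_iff)
  ultimately show ?thesis by (simp add: Sch_def Gf_ge stair_def)
next
  case False
  then show ?thesis using Gf_rv[of 1 n] by (simp add: Sch_def inv_rv stair_def)
qed

lemma no_ascent_rv:
  assumes w: "w permutes {1..n}" and na: "\<not> has_ascent n w"
  shows "w = rv 1 n"
proof -
  have dec: "w (Suc i) < w i" if "1 \<le> i" "i < n" for i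
  proof -
    have "w i \<noteq> w (Suc i)" using inj_eq[OF permutes_inj[OF w], of i "Suc i"] by simp
    moreover have "\<not> w i < w (Suc i)" using na that unfolding has_ascent_def by blast
    ultimately show ?thesis by linarith
  qed
  have rng: "w i \<in> {1..n}" if "i \<in> {1..n}" for i using permutes_in_image[OF w] that by blast
  have up: "w i + i \<le> Suc n" if "1 \<le> i" "i \<le> n" for i
    using that
  proof (induction i rule: nat_induct_at_least)
    case base
    then show ?case using rng[of 1] by auto
  next
    case (Suc i)
    then show ?case using dec[of i] by auto
  qed
  have down: "Suc n \<le> w i + i" if "i \<le> n" "1 \<le> i" for i
    using that
  proof (induction i rule: inc_induct)
    case base
    then show ?case using rng[of n] by auto
  next
    case (step i)
    then show ?case using dec[of i] by auto
  qed
  show ?thesis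
  proof
    fix a show "w a = rv 1 n a"
    proof (cases "1 \<le> a \<and> a \<le> n")
      case True
      then show ?thesis using up[of a] down[of a] by (simp add: rv_def)
    next
      case False
      then show ?thesis using permutes_not_in[OF w, of a] by (auto simp: rv_def)
    qed
  qed
qed

section \<open>Inversions and induction from the longest permutation\<close>

definition invs :: "nat \<Rightarrow> (nat \<Rightarrow> nat) \<Rightarrow> (nat \<times> nat) set" where
  "invs n w = {(i, j). 1 \<le> i \<and> i < j \<and> j \<le> n \<and> w i > w j}"

lemma card_pairs: "card {(i, j). 1 \<le> i \<and> i < j \<and> j \<le> (n::nat)} = n * (n - 1) div 2"
proof -
  have "{(i, j). 1 \<le> i \<and> i < j \<and> j \<le> n} = (\<lambda>(j, i). (i, j)) ` (SIGMA j:{1..n}. {1..<j})"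
    by (auto simp: image_iff)
  moreover have "inj_on (\<lambda>(j, i). (i, j)) (SIGMA j:{1..n}. {1..<j})" by (auto simp: inj_on_def)
  ultimately have "card {(i, j). 1 \<le> i \<and> i < j \<and> j \<le> n} = (\<Sum>j\<in>{1..n}. j - 1)"
    by (simp add: card_image)
  also have "\<dots> = (\<Sum>j<n. j)"
    by (rule sum.reindex_bij_witness[where i = Suc and j = "\<lambda>j. j - 1"]) auto
  also have "\<dots> = n * (n - 1) div 2"
    by (cases n) (simp_all add: lessThan_Suc_atMost gauss_sum_nat atMost_atLeast0 mult.commute)
  finally show ?thesis .
qed

lemma finite_pairs: "finite {(i, j). 1 \<le> i \<and> i < j \<and> j \<le> (n::nat)}"
  by (rule finite_subset[of _ "{1..n} \<times> {1..n}"]) auto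

lemma ninv_max_no_ascent:
  assumes "n * (n - 1) div 2 \<le> ninv n w"
  shows "\<not> has_ascent n w"
proof -
  have "{(i, j). 1 \<le> i \<and> i < j \<and> j \<le> n \<and> w i > w j} = {(i, j). 1 \<le> i \<and> i < j \<and> j \<le> n}"
    by (rule card_seteq[OF finite_pairs])
      (use assms in \<open>auto simp: ninv_def card_pairs[unfolded One_nat_def]\<close>)
  then have "w j < w i" if "1 \<le> i" "i < j" "j \<le> n" for i j
    using that by (auto simp: set_eq_iff)
  then have "w (Suc i) < w i" if "1 \<le> i" "i < n" for i using that by simp
  then show ?thesis unfolding has_ascent_def by (meson less_asym)
qed

text \<open>Applying the transposition to both coordinates matches the inversions of
  \<open>w\<close> with those of the swapped permutation other than
  \<open>(i, Suc i)\<close>.\<close>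

lemma ninv_swap:
  assumes "1 \<le> i" "i < n" "w i < w (Suc i)"
  shows "ninv n (w \<circ> adj_swap i) = Suc (ninv n w)"
proof -
  let ?s = "adj_swap i"
  have rng: "1 \<le> ?s a \<longleftrightarrow> 1 \<le> a" "?s a \<le> n \<longleftrightarrow> a \<le> n" for a
    using assms by (auto simp: Transposition.transpose_def)
  have less: "?s a < ?s b \<longleftrightarrow> a < b" if "a \<noteq> b" "{a, b} \<noteq> {i, Suc i}" for a b
    using transpose_less[OF that] .
  have "invs n (w \<circ> ?s) = insert (i, Suc i) ((\<lambda>(a, b). (?s a, ?s b)) ` invs n w)"
  proof (intro set_eqI iffI)
    fix x assume x: "x \<in> invs n (w \<circ> ?s)"
    obtain a b where ab: "x = (a, b)" by force
    have p: "1 \<le> a" "a < b" "b \<le> n" "w (?s a) > w (?s b)" using x by (auto simp: ab invs_def)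
    show "x \<in> insert (i, Suc i) ((\<lambda>(a, b). (?s a, ?s b)) ` invs n w)"
    proof (cases "a = i \<and> b = Suc i")
      case False
      then have "{a, b} \<noteq> {i, Suc i}" using p(2) by (auto simp: doubleton_eq_iff)
      then have "?s a < ?s b" using less p(2) by simp
      then have "(?s a, ?s b) \<in> invs n w" using p rng by (auto simp: invs_def simp del: One_nat_def)
      then have "(\<lambda>(a, b). (?s a, ?s b)) (?s a, ?s b) \<in> (\<lambda>(a, b). (?s a, ?s b)) ` invs n w" by (rule imageI)
      then show ?thesis by (simp add: ab)
    qed (simp add: ab)
  next
    fix x assume "x \<in> insert (i, Suc i) ((\<lambda>(a, b). (?s a, ?s b)) ` invs n w)"
    then consider "x = (i, Suc i)" | a b where "(a, b) \<in> invs n w" "x = (?s a, ?s b)" by auto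
    then show "x \<in> invs n (w \<circ> ?s)"
    proof cases
      case 1
      then show ?thesis using assms by (simp add: invs_def)
    next
      case 2
      have p: "1 \<le> a" "a < b" "b \<le> n" "w a > w b" using 2(1) by (auto simp: invs_def)
      then have "{a, b} \<noteq> {i, Suc i}" using assms(3) by (auto simp: doubleton_eq_iff)
      then have "?s a < ?s b" using less p(2) by simp
      then show ?thesis using p rng 2(2) by (auto simp: invs_def simp del: One_nat_def)
    qed
  qed
  moreover have "(i, Suc i) \<notin> (\<lambda>(a, b). (?s a, ?s b)) ` invs n w"
  proof
    assume "(i, Suc i) \<in> (\<lambda>(a, b). (?s a, ?s b)) ` invs n w"
    then obtain a b where "(a, b) \<in> invs n w" "?s a = i" "?s b = Suc i" by auto
    moreover from this have "a = Suc i" "b = i" by (metis transpose_apply_first transpose_apply_second transpose_involutory)+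
    ultimately show False by (simp add: invs_def)
  qed
  moreover have "finite (invs n w)"
    by (rule finite_subset[OF _ finite_pairs[of n]]) (auto simp: invs_def)
  moreover have "inj_on (\<lambda>(a, b). (?s a, ?s b)) (invs n w)"
    by (auto simp: inj_on_def dest: injD[OF inj_transpose])
  ultimately have "card (invs n (w \<circ> ?s)) = Suc (card (invs n w))"
    by (simp add: card_image)
  then show ?thesis by (simp add: ninv_def invs_def)
qed

lemma permutes_swap:
  assumes "w permutes {1..n}" "1 \<le> i" "i < n"
  shows "w \<circ> adj_swap i permutes {1..n}"
  using assms by (intro permutes_compose permutes_swap_id) auto

text \<open>The recursion for Schubert polynomials as an induction rule; it terminates because every
  step removes one of the missing inversions.\<close>

lemma perm_ascent_induct [consumes 1, case_names rv ascent]: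
  assumes "w permutes {1..n}"
    and base: "P (rv 1 n)"
    and step: "\<And>u i. u permutes {1..n} \<Longrightarrow> 1 \<le> i \<Longrightarrow> i < n \<Longrightarrow> u i < u (Suc i) \<Longrightarrow>
      P (u \<circ> adj_swap i) \<Longrightarrow> P u"
  shows "P w"
  using assms(1)
proof (induction "n * (n - 1) div 2 - ninv n w" arbitrary: w rule: less_induct)
  case less
  show ?case
  proof (cases "has_ascent n w")
    case False
    then show ?thesis using no_ascent_rv[OF less.prems] base by simp
  next
    case True
    then obtain i where i: "1 \<le> i" "i < n" "w i < w (Suc i)" by (auto simp: has_ascent_def)
    have "ninv n w < n * (n - 1) div 2" using ninv_max_no_ascent[of n w] True by linarith
    then have "P (w \<circ> adj_swap i)"
      using ninv_swap[OF i] by (intro less.hyps permutes_swap[OF less.prems i(1,2)]) linarith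
    then show ?thesis using step[OF less.prems i] by blast
  qed
qed

lemma Sch_ascent:
  assumes w: "w permutes {1..n}" and i: "1 \<le> i" "i < n" "w i < w (Suc i)"
  shows "is_divdiff i (Sch n (w \<circ> adj_swap i)) (Sch n w)"
proof -
  have "w \<circ> adj_swap i \<circ> adj_swap i = w"
    by (simp add: comp_assoc)
  then show ?thesis
    using Sch_divdiff[OF permutes_swap[OF w i(1,2)] i(1,2)] i(3) by simp
qed

text \<open>The fuel counts the missing inversions and hence runs out exactly at \<open>w_0\<close>.
  \<open>Sch_ascent\<close> holds at every ascent, so choosing the first one is harmless.\<close>

lemma schubert_eq_Sch:
  assumes "w permutes {1..n}"
  shows "schubert n w = Sch n w"
proof -
  have "schub_aux d n w = Sch n w" if "w permutes {1..n}" "n * (n - 1) div 2 - ninv n w = d" for d w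
    using that
  proof (induction d arbitrary: w)
    case 0
    then have "w = rv 1 n" using ninv_max_no_ascent[of n w] no_ascent_rv by simp
    then show ?case using Sch_rv[of n] by simp
  next
    case (Suc d)
    show ?case
    proof (cases "has_ascent n w")
      case False
      then have "w = rv 1 n" using no_ascent_rv[OF Suc.prems(1)] by blast
      then show ?thesis using False Sch_rv[of n] by simp
    next
      case True
      define i where "i = first_ascent n w"
      have i: "1 \<le> i" "i < n" "w i < w (Suc i)"
        using LeastI_ex[OF True[unfolded has_ascent_def]] by (auto simp: i_def first_ascent_def)
      have "schub_aux d n (w \<circ> adj_swap i) = Sch n (w \<circ> adj_swap i)"
        using ninv_swap[OF i] Suc.prems(2) by (intro Suc.IH permutes_swap[OF Suc.prems(1) i(1,2)]) linarith
      then show ?thesis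
        using True divdiff_eq[OF Sch_ascent[OF Suc.prems(1) i]] by (simp add: i_def[symmetric] Let_def)
    qed
  qed
  then show ?thesis using assms by (simp add: schubert_def)
qed

section \<open>The Pieri rule\<close>

text \<open>Values are shifted cyclically upwards along the positions in \<open>G\<close>, the new position
  \<open>Suc k\<close> receiving the smallest of them.\<close>
definition lvals :: "nat \<Rightarrow> (nat \<Rightarrow> nat) \<Rightarrow> nat set \<Rightarrow> nat set" where
  "lvals k u G = insert (Suc k) (u ` G)"

definition lift :: "nat \<Rightarrow> (nat \<Rightarrow> nat) \<Rightarrow> nat set \<Rightarrow> nat \<Rightarrow> nat" where
  "lift k u G q = (if q \<in> G then nxt (lvals k u G) (u q)
     else if q = Suc k then Min (lvals k u G) else u q)"

text \<open>The lift can be performed by swapping each position of \<open>G\<close> with position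
  \<open>Suc k\<close>, larger values first. The condition makes each swap a cover in the Bruhat
  order, adding exactly one inversion.\<close>

definition lifts :: "nat \<Rightarrow> (nat \<Rightarrow> nat) \<Rightarrow> nat set set" where
  "lifts k u = {G. G \<subseteq> {1..k} \<and>
     (\<forall>g\<in>G. \<forall>a. g < a \<and> a \<le> k \<longrightarrow> \<not> (u g < u a \<and> u a < nxt (lvals k u G) (u g)))}"

lemma finite_lifts: "finite (lifts k u)"
  by (rule finite_subset[of _ "Pow {1..k}"]) (auto simp: lifts_def)

context
  fixes k :: nat and u :: "nat \<Rightarrow> nat"
  assumes u: "u permutes {1..k}"
begin

lemma u_eq: "u a = u b \<longleftrightarrow> a = b"
  using inj_eq[OF permutes_inj[OF u]] .

lemma u_mem: "u a \<in> {1..k} \<longleftrightarrow> a \<in> {1..k}"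
  using permutes_in_image[OF u] .

lemma u_range: "a \<in> {1..k} \<Longrightarrow> 1 \<le> u a" "a \<in> {1..k} \<Longrightarrow> u a \<le> k"
  using u_mem[of a] by auto

lemma lvals_props:
  assumes "G \<subseteq> {1..k}"
  shows "finite (lvals k u G)" "lvals k u G \<subseteq> {1..Suc k}" "Suc k \<in> lvals k u G"
    "q \<in> {1..k} \<Longrightarrow> u q \<in> lvals k u G \<longleftrightarrow> q \<in> G"
proof -
  have G: "finite G" using assms finite_subset by blast
  then show "finite (lvals k u G)" by (simp add: lvals_def)
  show "lvals k u G \<subseteq> {1..Suc k}"
    using assms u_range by (fastforce simp: lvals_def)
  show "Suc k \<in> lvals k u G" by (simp add: lvals_def)
  show "u q \<in> lvals k u G \<longleftrightarrow> q \<in> G" if "q \<in> {1..k}"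
    using u_range(2)[OF that] u_eq by (auto simp: lvals_def)
qed

lemma nxt_lvals:
  assumes "G \<subseteq> {1..k}" "c \<le> k"
  shows "nxt (lvals k u G) c \<in> lvals k u G" "c < nxt (lvals k u G) c"
    "d \<in> lvals k u G \<Longrightarrow> c < d \<Longrightarrow> nxt (lvals k u G) c \<le> d"
  using nxt_props[OF lvals_props(1,3)[OF assms(1)], of c] assms(2)
    nxt_props(3)[OF lvals_props(1)[OF assms(1)], of d c] by auto

lemma Min_lvals:
  assumes "G \<subseteq> {1..k}"
  shows "Min (lvals k u G) \<in> lvals k u G" "d \<in> lvals k u G \<Longrightarrow> Min (lvals k u G) \<le> d"
proof -
  note L = lvals_props[OF assms]
  show "Min (lvals k u G) \<in> lvals k u G" using L(1,3) by (intro Min_in) auto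
  show "d \<in> lvals k u G \<Longrightarrow> Min (lvals k u G) \<le> d" using L(1) by simp
qed

lemma lift_permutes:
  assumes G: "G \<subseteq> {1..k}"
  shows "lift k u G permutes {1..Suc k}"
proof -
  let ?E = "lvals k u G"
  note L = lvals_props[OF G] and nx = nxt_lvals[OF G]
  have GE: "u g \<in> ?E" "u g \<le> k" "g \<noteq> Suc k" if "g \<in> G" for g
    using that G u_range(2)[of g] by (auto simp: lvals_def)
  have map: "lift k u G q \<in> {1..Suc k}" if "q \<in> {1..Suc k}" for q
  proof -
    consider "q \<in> G" | "q \<notin> G" "q = Suc k" | "q \<notin> G" "q \<in> {1..k}" using \<open>q \<in> {1..Suc k}\<close> by (metis atLeastAtMost_iff le_Suc_eq)
    then show ?thesis
    proof cases
      case 1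
      then show ?thesis using nx(1)[of "u q"] GE(2)[OF 1] L(2) by (auto simp: lift_def)
    next
      case 2
      then show ?thesis using Min_lvals(1)[OF G] L(2) by (auto simp: lift_def)
    next
      case 3
      then show ?thesis using u_range[of q] by (auto simp: lift_def)
    qed
  qed
  have inE: "lift k u G q \<in> ?E \<longleftrightarrow> q \<in> G \<or> q = Suc k" if "q \<in> {1..Suc k}" for q
  proof -
    consider "q \<in> G" | "q \<notin> G" "q = Suc k" | "q \<notin> G" "q \<in> {1..k}" using \<open>q \<in> {1..Suc k}\<close> by (metis atLeastAtMost_iff le_Suc_eq)
    then show ?thesis
    proof cases
      case 1
      then show ?thesis using nx(1)[of "u q"] GE(2)[OF 1] by (simp add: lift_def)
    next
      case 2
      then show ?thesis using Min_lvals(1)[OF G] by (simp add: lift_def)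
    next
      case 3
      then show ?thesis using L(4)[of q] by (auto simp: lift_def)
    qed
  qed
  have GG: "g = h" if "g \<in> G" "h \<in> G" "nxt ?E (u g) = nxt ?E (u h)" for g h
  proof (rule ccontr)
    assume "g \<noteq> h"
    then have "u g \<noteq> u h" using u_eq by simp
    moreover have "\<not> u g < u h"
      using nx(3)[OF GE(2)[OF that(1)] GE(1)[OF that(2)]] nx(2)[OF GE(2)[OF that(2)]] that(3) by linarith
    moreover have "\<not> u h < u g"
      using nx(3)[OF GE(2)[OF that(2)] GE(1)[OF that(1)]] nx(2)[OF GE(2)[OF that(1)]] that(3) by linarith
    ultimately show False by simp
  qed
  have GM: "nxt ?E (u g) \<noteq> Min ?E" if "g \<in> G" for g
    using nx(2)[OF GE(2)[OF that]] Min_lvals(2)[OF G GE(1)[OF that]] by simp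
  have inj: "inj_on (lift k u G) {1..Suc k}"
  proof (rule inj_onI)
    fix a b assume ab: "a \<in> {1..Suc k}" "b \<in> {1..Suc k}" "lift k u G a = lift k u G b"
    have iff: "(a \<in> G \<or> a = Suc k) \<longleftrightarrow> (b \<in> G \<or> b = Suc k)"
      using inE[OF ab(1)] inE[OF ab(2)] ab(3) by simp
    show "a = b"
    proof (cases "a \<in> G \<or> a = Suc k")
      case True
      then have "b \<in> G \<or> b = Suc k" using iff by simp
      then show ?thesis
        using True ab(3) GG[of a b] GM[of a] GM[of b] GE(3)[of a] GE(3)[of b]
        by (auto simp: lift_def split: if_splits)
    next
      case False
      then have "u a = u b" using ab(3) iff by (auto simp: lift_def)
      then show ?thesis using u_eq by simp
    qed
  qed
  show ?thesis
  proof (rule bij_imp_permutes)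
    have "lift k u G ` {1..Suc k} = {1..Suc k}"
      using inj map by (intro endo_inj_surj) auto
    then show "bij_betw (lift k u G) {1..Suc k} {1..Suc k}" using inj by (simp add: bij_betw_def)
    show "lift k u G q = q" if "q \<notin> {1..Suc k}" for q
    proof -
      have "q \<notin> {1..k}" "q \<notin> G" "q \<noteq> Suc k" using that G by auto
      then show ?thesis using permutes_not_in[OF u] by (simp add: lift_def)
    qed
  qed
qed

lemma lvals_swap: "lvals k (u \<circ> Transposition.transpose i j) (Transposition.transpose i j ` G) = lvals k u G"
  by (simp add: lvals_def image_comp comp_assoc)

lemma lift_swap:
  assumes "i < k"
  shows "lift k (u \<circ> adj_swap i) (adj_swap i ` G) =
    lift k u G \<circ> adj_swap i"
proof
  fix q
  let ?s = "adj_swap i"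
  have "q \<in> ?s ` G \<longleftrightarrow> ?s q \<in> G" by (metis imageE imageI transpose_involutory)
  moreover have "?s q = Suc k \<longleftrightarrow> q = Suc k"
    using assms by (auto simp: Transposition.transpose_def)
  ultimately show "lift k (u \<circ> ?s) (?s ` G) q = (lift k u G \<circ> ?s) q"
    unfolding lift_def lvals_swap by simp
qed

text \<open>Swapping positions changes the order of the pair \<open>i\<close>, \<open>Suc i\<close>
  only. The descent of \<open>u\<close> rules out a forbidden pair \<open>(i, Suc i)\<close>; that
  \<open>(Suc i, i)\<close> is not forbidden either means that the lift still has a descent at
  \<open>i\<close>. These are the lifts that survive the divided difference.\<close>

lemma lifts_swap:
  assumes i: "1 \<le> i" "i < k" "u (Suc i) < u i" and G: "G \<subseteq> {1..k}"
  shows "adj_swap i ` G \<in> lifts k (u \<circ> adj_swap i) \<longleftrightarrow>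
    G \<in> lifts k u \<and> lift k u G (Suc i) < lift k u G i"
proof -
  let ?s = "adj_swap i" and ?E = "lvals k u G"
  define bad where "bad g a \<longleftrightarrow> u g < u a \<and> u a < nxt ?E (u g)" for g a
  have rng: "?s a \<in> {1..k} \<longleftrightarrow> a \<in> {1..k}" for a
    using i by (auto simp: Transposition.transpose_def)
  have sG: "?s ` G \<subseteq> {1..k}" using G rng by blast
  have ss: "?s (?s a) = a" for a by simp
  have 1: "?s ` G \<in> lifts k (u \<circ> ?s) \<longleftrightarrow> (\<forall>g\<in>G. \<forall>a\<in>{1..k}. ?s g < ?s a \<longrightarrow> \<not> bad g a)"
  proof -
    have "?s ` G \<in> lifts k (u \<circ> ?s) \<longleftrightarrow> (\<forall>g\<in>G. \<forall>a. ?s g < a \<and> a \<le> k \<longrightarrow> \<not> bad g (?s a))"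
      using sG by (simp add: lifts_def lvals_swap bad_def)
    also have "\<dots> \<longleftrightarrow> (\<forall>g\<in>G. \<forall>a\<in>{1..k}. ?s g < ?s a \<longrightarrow> \<not> bad g a)"
    proof (intro ball_cong refl iffI ballI impI allI)
      fix g a assume "\<forall>a. ?s g < a \<and> a \<le> k \<longrightarrow> \<not> bad g (?s a)" "a \<in> {1..k}" "?s g < ?s a"
      then show "\<not> bad g a" using rng[of a] ss[of a] by (metis atLeastAtMost_iff)
    next
      fix g a assume *: "\<forall>a\<in>{1..k}. ?s g < ?s a \<longrightarrow> \<not> bad g a" "?s g < a \<and> a \<le> k"
      then have "?s a \<in> {1..k}" using rng by auto
      then show "\<not> bad g (?s a)" using *(1) *(2) ss[of a] by auto
    qed
    finally show ?thesis .
  qed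
  have 2: "G \<in> lifts k u \<longleftrightarrow> (\<forall>g\<in>G. \<forall>a\<in>{1..k}. g < a \<longrightarrow> \<not> bad g a)"
    using G by (auto simp: lifts_def bad_def)
  have nb: "\<not> bad i (Suc i)" using i(3) by (simp add: bad_def)
  have pair: "(?s g < ?s a \<longleftrightarrow> g < a) \<or> (g = i \<and> a = Suc i) \<or> (g = Suc i \<and> a = i)" if "bad g a" for g a
  proof -
    have "g \<noteq> a" using that by (auto simp: bad_def)
    then show ?thesis using transpose_less[of g a i] by (auto simp: doubleton_eq_iff)
  qed
  have "(\<forall>g\<in>G. \<forall>a\<in>{1..k}. ?s g < ?s a \<longrightarrow> \<not> bad g a) \<longleftrightarrow>
      (\<forall>g\<in>G. \<forall>a\<in>{1..k}. g < a \<longrightarrow> \<not> bad g a) \<and> (Suc i \<in> G \<longrightarrow> \<not> bad (Suc i) i)"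
  proof (intro iffI conjI ballI impI)
    fix g a assume *: "\<forall>g\<in>G. \<forall>a\<in>{1..k}. ?s g < ?s a \<longrightarrow> \<not> bad g a" "g \<in> G" "a \<in> {1..k}" "g < a"
    show "\<not> bad g a" using * pair[of g a] nb by auto
  next
    assume *: "\<forall>g\<in>G. \<forall>a\<in>{1..k}. ?s g < ?s a \<longrightarrow> \<not> bad g a" "Suc i \<in> G"
    have "i \<in> {1..k}" "?s (Suc i) < ?s i" using i by auto
    then show "\<not> bad (Suc i) i" using * by blast
  next
    fix g a assume *: "(\<forall>g\<in>G. \<forall>a\<in>{1..k}. g < a \<longrightarrow> \<not> bad g a) \<and> (Suc i \<in> G \<longrightarrow> \<not> bad (Suc i) i)"
      "g \<in> G" "a \<in> {1..k}" "?s g < ?s a"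
    show "\<not> bad g a" using * pair[of g a] nb by auto
  qed
  moreover have "(Suc i \<in> G \<longrightarrow> \<not> bad (Suc i) i) \<longleftrightarrow> lift k u G (Suc i) < lift k u G i"
  proof -
    have ik: "i \<in> {1..k}" "Suc i \<in> {1..k}" using i by auto
    note ur = u_range(2)[OF ik(1)] u_range(2)[OF ik(2)]
    show ?thesis
    proof (cases "Suc i \<in> G")
      case False
      have "u i \<le> lift k u G i" using nxt_lvals(2)[OF G ur(1)] ik by (auto simp: lift_def)
      moreover have "lift k u G (Suc i) = u (Suc i)" using False i(2) by (simp add: lift_def)
      ultimately show ?thesis using False i(3) by simp
    next
      case True
      have l: "lift k u G (Suc i) = nxt ?E (u (Suc i))" using True by (simp add: lift_def)
      show ?thesis
      proof (cases "i \<in> G")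
        case iG: True
        then have "u i \<in> ?E" by (simp add: lvals_def)
        then have "nxt ?E (u (Suc i)) \<le> u i" using nxt_lvals(3)[OF G ur(2)] i(3) by blast
        moreover have "u i < lift k u G i" using nxt_lvals(2)[OF G ur(1)] iG by (simp add: lift_def)
        ultimately show ?thesis by (simp add: l bad_def)
      next
        case iG: False
        then have "u i \<notin> ?E" using lvals_props(4)[OF G ik(1)] by simp
        then have "u i \<noteq> nxt ?E (u (Suc i))" using nxt_lvals(1)[OF G ur(2)] by auto
        moreover have "lift k u G i = u i" using iG i(2) by (simp add: lift_def)
        ultimately show ?thesis using True i(3) by (auto simp: l bad_def)
      qed
    qed
  qed
  ultimately show ?thesis using 1 2 by blast
qed

end

section \<open>The Pieri rule, starting from the longest permutation\<close>

lemma swapvars_prod_Var: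
  assumes "\<And>j. e (adj_swap i j) = e j" "i \<in> A" "Suc i \<in> A" "finite A"
  shows "swapvars i (\<Prod>j\<in>A. Var j ^ e j) = (\<Prod>j\<in>A. Var j ^ e j)"
proof -
  let ?s = "adj_swap i"
  have "swapvars i (\<Prod>j\<in>A. Var j ^ e j) = (\<Prod>j\<in>A. Var (?s j) ^ e (?s j))"
    by (simp add: swapvars_def swapvars_simps assms(1))
  also have "\<dots> = (\<Prod>j\<in>A. Var j ^ e j)"
    using prod.permute[OF permutes_swap_id[OF assms(2,3)], of "\<lambda>j. Var j ^ e j"] by (simp add: comp_def)
  finally show ?thesis .
qed

lemma stair_Suc: "stair (Suc k) = stair k * (\<Prod>j\<in>{1..k}. Var j)"
proof -
  have "stair (Suc k) = (\<Prod>j\<in>{1..k}. Var j ^ (k - j) * Var j)"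
    unfolding stair_def atLeastLessThanSuc_atLeastAtMost
    by (intro prod.cong) (auto simp: Suc_diff_le mult.commute)
  also have "\<dots> = (\<Prod>j\<in>{1..k}. Var j ^ (k - j)) * (\<Prod>j\<in>{1..k}. Var j)" by (rule prod.distrib)
  also have "(\<Prod>j\<in>{1..k}. Var j ^ (k - j)) = stair k"
    unfolding stair_def by (rule prod.mono_neutral_right) auto
  finally show ?thesis .
qed

text \<open>Induction downwards from \<open>G = {1..k}\<close>, whose lift is the longest
  permutation of \<open>{1..Suc k}\<close>. Removing one element from \<open>G\<close> swaps two
  adjacent positions of the lift and divides the monomial by one variable.\<close>

lemma Sch_lift_rv:
  assumes "G \<subseteq> {1..k}"
  shows "Sch (Suc k) (lift k (rv 1 k) G) = stair k * (\<Prod>j\<in>G. Var j)"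
  using assms
proof (induction "card ({1..k} - G)" arbitrary: G rule: less_induct)
  case less
  note G = less.prems
  define u where "u = rv 1 k"
  have u: "u permutes {1..k}" unfolding u_def by (rule rv_permutes)
  show ?case
  proof (cases "G = {1..k}")
    case True
    have "rv 1 k ` {1..k} = {1..k}" by (rule permutes_image[OF rv_permutes])
    then have E: "lvals k (rv 1 k) {1..k} = {1..Suc k}" by (auto simp: lvals_def)
    have nx: "nxt {1..Suc k} c = Suc c" if "c \<le> k" for c using that by (intro nxt_eqI) auto
    have M: "Min {1..Suc k} = 1" by (intro Min_eqI) auto
    have "lift k (rv 1 k) {1..k} = rv 1 (Suc k)"
      unfolding lift_def[abs_def] E M by (auto simp: rv_def fun_eq_iff nx simp del: One_nat_def)
    then show ?thesis using Sch_rv[of "Suc k"] by (simp only: stair_Suc True)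
  next
    case False
    \<comment> \<open>The largest missing position: either \<open>i = k\<close> or
      \<open>Suc i\<close> belongs to \<open>G\<close>. This makes the lifts for \<open>G\<close>
      and \<open>insert i G\<close> differ by the transposition at \<open>i\<close>.\<close>
    define i where "i = Max ({1..k} - G)"
    have ne: "{1..k} - G \<noteq> {}" using False G by auto
    have i: "i \<in> {1..k}" "i \<notin> G" using Max_in[OF _ ne] by (auto simp: i_def)
    have i_max: "j \<in> G" if "j \<in> {1..k}" "i < j" for j
    proof (rule ccontr)
      assume "j \<notin> G"
      then have "j \<le> i" using that(1) by (simp add: i_def)
      then show False using that(2) by simp
    qed
    define G1 where "G1 = insert i G"
    have G1: "G1 \<subseteq> {1..k}" using G i by (simp add: G1_def)
    have "card ({1..k} - G1) < card ({1..k} - G)"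
    proof -
      have "{1..k} - G1 = ({1..k} - G) - {i}" by (auto simp: G1_def)
      moreover have "i \<in> {1..k} - G" using i by blast
      ultimately show ?thesis using card_Diff1_less[of "{1..k} - G" i] by simp
    qed
    then have IH: "Sch (Suc k) (lift k u G1) = stair k * (\<Prod>j\<in>G1. Var j)"
      unfolding u_def using less.hyps G1 by blast
    let ?s = "adj_swap i"
    let ?E = "lvals k u G" and ?E1 = "lvals k u G1"
    have E1: "?E1 = insert (u i) ?E" by (auto simp: lvals_def G1_def)
    have ui: "u i = Suc k - i" using i by (simp add: u_def rv_def)
    note nx = nxt_lvals[OF u G] and nx1 = nxt_lvals[OF u G1]
    have uE: "u i \<notin> ?E" using lvals_props(4)[OF u G i(1)] i(2) by simp
    have ge: "nxt ?E1 c = nxt ?E c" if "c \<le> k" "u i \<le> c" for c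
    proof (rule nxt_eqI)
      show "finite ?E1" using lvals_props(1)[OF u G1] .
      show "nxt ?E c \<in> ?E1" "c < nxt ?E c" using nx(1,2)[OF that(1)] by (auto simp: E1)
      show "nxt ?E c \<le> d" if "d \<in> ?E1" "c < d" for d
        using that \<open>u i \<le> c\<close> nx(3)[OF \<open>c \<le> k\<close>, of d] by (auto simp: E1)
    qed
    have key: "lift k u G1 (Suc i) < lift k u G1 i \<and> lift k u G = lift k u G1 \<circ> ?s"
    proof (cases "i = k")
      case True
      then have u1: "u i = 1" using ui by simp
      have E_gt: "1 < d" if "d \<in> ?E" for d
        using that lvals_props(2)[OF u G] uE u1 by (cases "d = 1") auto
      have M1: "Min ?E1 = 1"
        using lvals_props(1)[OF u G1] by (intro Min_eqI) (use E_gt in \<open>force simp: E1 u1\<close>)+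
      have n1: "nxt ?E1 1 = Min ?E"
      proof (rule nxt_eqI)
        show "finite ?E1" using lvals_props(1)[OF u G1] .
        show "Min ?E \<in> ?E1" using Min_lvals(1)[OF u G] by (simp add: E1)
        show "1 < Min ?E" using E_gt Min_lvals(1)[OF u G] by blast
        show "Min ?E \<le> d" if "d \<in> ?E1" "1 < d" for d
          using that Min_lvals(2)[OF u G, of d] u1 by (auto simp: E1)
      qed
      have a: "lift k u G1 i = Min ?E" "lift k u G1 (Suc i) = 1"
        using G1 True n1 M1 u1 by (auto simp: lift_def G1_def)
      have b: "lift k u G i = 1" "lift k u G (Suc i) = Min ?E"
        using G True i(2) u1 by (auto simp: lift_def)
      have c: "lift k u G q = lift k u G1 q" if "q \<noteq> i" "q \<noteq> Suc i" for q
      proof (cases "q \<in> G")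
        case qG: True
        then have "q \<in> {1..k}" using G by blast
        then have "u q \<le> k" "1 \<le> u q" using u_range[OF u] by auto
        then have "nxt ?E1 (u q) = nxt ?E (u q)" using ge[of "u q"] u1 by simp
        then show ?thesis using qG by (simp add: lift_def G1_def)
      next
        case False
        then show ?thesis using that True by (simp add: lift_def G1_def)
      qed
      have "lift k u G q = (lift k u G1 \<circ> ?s) q" for q
        using a b c[of q] by (auto simp: Transposition.transpose_def)
      moreover have "1 < Min ?E" using E_gt Min_lvals(1)[OF u G] by blast
      ultimately show ?thesis using a by auto
    next
      case False
      then have ik: "Suc i \<in> {1..k}" using i by auto
      then have iG: "Suc i \<in> G" using i_max by simp
      have us: "u (Suc i) = u i - 1" "1 < u i" using i ik by (auto simp: u_def rv_def)
      have usE: "u (Suc i) \<in> ?E" using iG by (simp add: lvals_def)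
      have n1: "nxt ?E1 (u (Suc i)) = u i"
        using lvals_props(1)[OF u G1] us by (intro nxt_eqI) (auto simp: E1)
      have n2: "nxt ?E1 (u i) = nxt ?E (u i)" using u_range(2)[OF u i(1)] by (intro ge) auto
      have n3: "nxt ?E (u (Suc i)) = nxt ?E (u i)"
      proof (rule nxt_eqI)
        have "u i \<le> k" using u_range(2)[OF u i(1)] .
        then show "nxt ?E (u i) \<in> ?E" "u (Suc i) < nxt ?E (u i)"
          using nx(1,2)[of "u i"] us by auto
        fix d assume d: "d \<in> ?E" "u (Suc i) < d"
        then have "d \<noteq> u i" using uE by auto
        then have "u i < d" using d us by linarith
        then show "nxt ?E (u i) \<le> d" using nx(3)[OF \<open>u i \<le> k\<close> d(1)] by blast
      qed (use lvals_props(1)[OF u G] in simp)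
      have M: "Min ?E1 = Min ?E"
      proof (rule Min_eqI)
        show "Min ?E \<le> d" if "d \<in> ?E1" for d
        proof (cases "d = u i")
          case True
          then show ?thesis using Min_lvals(2)[OF u G usE] us by simp
        next
          case False
          then show ?thesis using that Min_lvals(2)[OF u G, of d] by (simp add: E1)
        qed
      qed (use Min_lvals(1)[OF u G] lvals_props(1)[OF u G1] in \<open>auto simp: E1\<close>)
      have a: "lift k u G1 i = nxt ?E (u i)" "lift k u G1 (Suc i) = u i"
        using n1 n2 iG by (auto simp: lift_def G1_def)
      have b: "lift k u G i = u i" "lift k u G (Suc i) = nxt ?E (u i)"
        using n3 iG i False by (auto simp: lift_def)
      have c: "lift k u G q = lift k u G1 q" if "q \<noteq> i" "q \<noteq> Suc i" for q
      proof (cases "q \<in> G")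
        case qG: True
        then have q: "q \<in> {1..k}" using G by blast
        have qk: "u q \<le> k" using u_range(2)[OF u q] .
        have "nxt ?E1 (u q) = nxt ?E (u q)"
        proof (cases "u i \<le> u q")
          case True
          then show ?thesis using ge qk by blast
        next
          case False
          moreover have "u q \<noteq> u (Suc i)" using u_eq[OF u] that by simp
          ultimately have lt: "u q < u (Suc i)" using us by linarith
          show ?thesis
          proof (rule nxt_eqI)
            show "finite ?E1" using lvals_props(1)[OF u G1] .
            show "nxt ?E (u q) \<in> ?E1" "u q < nxt ?E (u q)" using nx(1,2)[OF qk] by (auto simp: E1)
            fix d assume "d \<in> ?E1" "u q < d"
            then show "nxt ?E (u q) \<le> d"
              using nx(3)[OF qk, of d] nx(3)[OF qk usE lt] us by (auto simp: E1)
          qed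
        qed
        then show ?thesis using qG by (simp add: lift_def G1_def)
      next
        case False
        then show ?thesis using that M by (simp add: lift_def G1_def)
      qed
      have "lift k u G q = (lift k u G1 \<circ> ?s) q" for q
        using a b c[of q] by (auto simp: Transposition.transpose_def)
      moreover have "u i < nxt ?E (u i)" using nx(2) u_range(2)[OF u i(1)] by blast
      ultimately show ?thesis using a by auto
    qed
    have d1: "is_divdiff i (stair k * (\<Prod>j\<in>G1. Var j)) (Sch (Suc k) (lift k u G))"
      using Sch_divdiff[OF lift_permutes[OF u G1], of i] i key by (simp add: IH)
    \<comment> \<open>The exponents of the expected monomial \<open>c\<close>. They agree at
      \<open>i\<close> and \<open>Suc i\<close>, so \<open>c\<close> is invariant and the divided
      difference of \<open>c * Var i\<close> is \<open>c\<close>.\<close>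
    define e where "e j = (if j = Suc k then 0 else k - j) + (if j \<in> G then 1 else 0)" for j
    define c where "c = (\<Prod>j\<in>{1..Suc k}. Var j ^ e j)"
    have c_eq: "c = stair k * (\<Prod>j\<in>G. Var j)"
    proof -
      have "c = (\<Prod>j\<in>{1..Suc k}. Var j ^ (if j = Suc k then 0 else k - j)) * (\<Prod>j\<in>{1..Suc k}. Var j ^ (if j \<in> G then 1 else 0))"
        by (simp add: c_def e_def power_add prod.distrib)
      moreover have "(\<Prod>j\<in>{1..Suc k}. Var j ^ (if j = Suc k then 0 else k - j)) = stair k"
        unfolding stair_def by (rule prod.mono_neutral_cong_right) auto
      moreover have "(\<Prod>j\<in>{1..Suc k}. Var j ^ (if j \<in> G then 1 else 0)) = (\<Prod>j\<in>G. Var j)"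
        using G by (intro prod.mono_neutral_cong_right) auto
      ultimately show ?thesis by simp
    qed
    have "e (Suc i) = e i"
    proof (cases "i = k")
      case True
      then show ?thesis using i G by (auto simp: e_def)
    next
      case False
      then have "Suc i \<in> G" using i i_max by simp
      then show ?thesis using i False by (auto simp: e_def)
    qed
    then have "swapvars i c = c"
      unfolding c_def using i by (intro swapvars_prod_Var) (auto simp: Transposition.transpose_def)
    moreover have "is_divdiff i (Var i) 1"
      by (simp add: is_divdiff_def swapvars_Var)
    ultimately have "is_divdiff i (c * Var i) (c * 1)" by (rule is_divdiff_mult)
    moreover have "c * Var i = stair k * (\<Prod>j\<in>G1. Var j)"
      using i G finite_subset[OF G] by (simp add: c_eq G1_def mult_ac)
    ultimately have "is_divdiff i (stair k * (\<Prod>j\<in>G1. Var j)) c" by simp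
    then show ?thesis using is_divdiff_unique[OF d1] c_eq unfolding u_def by simp
  qed
qed

text \<open>For the longest permutation every subset gives a lift, and the identity is the expansion
  of the product. Applying a divided difference propagates it to all \<open>u\<close>: the product
  is symmetric in its variables, and \<open>lifts_swap\<close> matches the surviving terms.\<close>

lemma Sch_pieri:
  assumes "u permutes {1..k}"
  shows "(\<Prod>i\<in>{1..k}. 1 + Var i) * Sch k u = (\<Sum>G\<in>lifts k u. Sch (Suc k) (lift k u G))"
  using assms
proof (induction rule: perm_ascent_induct)
  case rv
  have "lifts k (rv 1 k) = Pow {1..k}"
    by (auto simp: lifts_def rv_def)
  moreover have "(\<Sum>G\<in>Pow {1..k}. Sch (Suc k) (lift k (rv 1 k) G)) = (\<Sum>G\<in>Pow {1..k}. stair k * (\<Prod>j\<in>G. Var j))"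
    by (intro sum.cong refl Sch_lift_rv) auto
  moreover have "(\<Prod>i\<in>{1..k}. 1 + Var i) = (\<Sum>G\<in>Pow {1..k}. \<Prod>j\<in>G. Var j)"
    using prod_add[of "{1..k}" Var "\<lambda>_. 1"] by (simp add: add.commute)
  ultimately show ?case using Sch_rv[of k] by (simp only: sum_distrib_left mult.commute)
next
  case (ascent u' i)
  let ?s = "adj_swap i"
  define u where "u = u' \<circ> ?s"
  have u: "u permutes {1..k}" unfolding u_def using ascent by (intro permutes_swap)
  have u': "u \<circ> ?s = u'" by (simp add: u_def comp_assoc)
  have desc: "u (Suc i) < u i" using ascent(4) by (simp add: u_def)
  define P where "P = (\<Prod>j\<in>{1..k}. 1 + Var j)"
  have "swapvars i P = (\<Prod>j\<in>{1..k}. 1 + Var (?s j))"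
    by (simp add: P_def swapvars_def swapvars_simps)
  also have "\<dots> = P"
    using prod.permute[OF permutes_swap_id[of i "{1..k}" "Suc i"], of "\<lambda>j. 1 + Var j"] ascent(2,3)
    by (simp add: P_def comp_def)
  finally have A: "is_divdiff i (P * Sch k u) (P * Sch k u')"
    using Sch_ascent[OF ascent(1-4)] by (intro is_divdiff_mult) (auto simp: u_def)
  have B: "is_divdiff i (\<Sum>G\<in>lifts k u. Sch (Suc k) (lift k u G))
      (\<Sum>G\<in>lifts k u. if lift k u G i > lift k u G (Suc i) then Sch (Suc k) (lift k u G \<circ> ?s) else 0)"
    by (intro is_divdiff_sum Sch_divdiff lift_permutes[OF u]) (use ascent in \<open>auto simp: lifts_def\<close>)
  have eq: "P * Sch k u = (\<Sum>G\<in>lifts k u. Sch (Suc k) (lift k u G))"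
    using ascent(5) by (simp only: P_def u_def)
  have "P * Sch k u' =
      (\<Sum>G\<in>lifts k u. if lift k u G i > lift k u G (Suc i) then Sch (Suc k) (lift k u G \<circ> ?s) else 0)"
    by (rule is_divdiff_unique[OF A[unfolded eq] B])
  also have "\<dots> = (\<Sum>G\<in>{G \<in> lifts k u. lift k u G i > lift k u G (Suc i)}. Sch (Suc k) (lift k u G \<circ> ?s))"
    using finite_lifts by (intro sum.mono_neutral_cong_right) auto
  also have "\<dots> = (\<Sum>G\<in>lifts k u'. Sch (Suc k) (lift k u' G))"
  proof (rule sum.reindex_bij_witness[where i = "image ?s" and j = "image ?s"])
    fix G assume "G \<in> {G \<in> lifts k u. lift k u G i > lift k u G (Suc i)}"
    then have G: "G \<in> lifts k u" "G \<subseteq> {1..k}" "lift k u G i > lift k u G (Suc i)" by (auto simp: lifts_def)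
    show "?s ` ?s ` G = G" by (simp add: image_comp)
    show "?s ` G \<in> lifts k u'"
      using lifts_swap[OF u ascent(2,3) desc G(2)] G(1,3) by (simp add: u')
    show "Sch (Suc k) (lift k u' (?s ` G)) = Sch (Suc k) (lift k u G \<circ> ?s)"
      using lift_swap[OF u ascent(3), of G] by (simp add: u')
  next
    fix G assume G: "G \<in> lifts k u'"
    show id: "?s ` ?s ` G = G" by (simp add: image_comp)
    have "?s ` G \<subseteq> {1..k}"
    proof
      fix x assume "x \<in> ?s ` G"
      then show "x \<in> {1..k}" using G ascent(2,3) by (auto simp: lifts_def Transposition.transpose_def)
    qed
    from lifts_swap[OF u ascent(2,3) desc this]
    show "?s ` G \<in> {G \<in> lifts k u. lift k u G i > lift k u G (Suc i)}"
      using G by (simp add: u' id)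
  qed
  finally show ?case by (simp add: P_def)
qed

section \<open>Diagrams of the lifted permutations\<close>

lemma ordered_enumeration:
  fixes f :: "nat \<Rightarrow> nat"
  assumes "finite G" "inj_on f G"
  obtains gs where "set gs = G" "distinct gs" "sorted_wrt (\<lambda>a b. f b < f a) gs"
proof (rule that[of "rev (sort_key f (sorted_list_of_set G))"])
  let ?l = "sort_key f (sorted_list_of_set G)"
  show "set (rev ?l) = G" "distinct (rev ?l)" using assms(1) by auto
  have "distinct (map f ?l)" using assms by (simp add: distinct_map)
  moreover have "sorted (map f ?l)" by simp
  ultimately have "sorted_wrt (<) (map f ?l)" by (simp add: strict_sorted_iff del: sorted_sort_key)
  then show "sorted_wrt (\<lambda>a b. f b < f a) (rev ?l)"
    by (simp add: sorted_wrt_map sorted_wrt_rev)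
qed

lemma distinct_moved:
  "distinct gs \<Longrightarrow> (\<And>g. g \<in> set gs \<Longrightarrow> distinct (A g)) \<Longrightarrow>
   (\<And>g h. g \<in> set gs \<Longrightarrow> h \<in> set gs \<Longrightarrow> g \<noteq> h \<Longrightarrow> set (A g) \<inter> set (A h) = {}) \<Longrightarrow> distinct (moved A gs)"
proof (induction gs)
  case Nil
  then show ?case by (simp add: moved_def)
next
  case (Cons g gs)
  have "moved A (g # gs) = moved A gs @ rev (A g)" by (simp add: moved_def)
  moreover have "set (A h) \<inter> set (A g) = {}" if "h \<in> set gs" for h
    using Cons.prems(1,3) that by auto
  ultimately show ?case using Cons by (auto simp: set_moved)
qed

context
  fixes k :: nat and u :: "nat \<Rightarrow> nat"
  assumes u: "u permutes {1..k}"
begin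

text \<open>The positions whose values are passed when \<open>g\<close> is raised. For a lift these
  are the boxes that leave the column \<open>g\<close> and enter the new column
  \<open>Suc k\<close>.\<close>

definition gap :: "nat set \<Rightarrow> nat \<Rightarrow> nat set" where
  "gap G g = {a \<in> {1..k}. u g < u a \<and> u a < nxt (lvals k u G) (u g)}"

lemma u_not_in: "a \<notin> {1..k} \<Longrightarrow> u a = a"
  using permutes_not_in[OF u] .

lemma gap_disjoint:
  assumes G: "G \<subseteq> {1..k}" and g: "g \<in> G"
  shows "gap G g \<inter> G = {}" "h \<in> G \<Longrightarrow> h \<noteq> g \<Longrightarrow> gap G g \<inter> gap G h = {}"
proof -
  have le: "nxt (lvals k u G) (u g) \<le> u a" if "g \<in> G" "a \<in> G" "u g < u a" for g a
  proof (rule nxt_lvals(3)[OF u G _ _ that(3)])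
    show "u g \<le> k" using u_range(2)[OF u, of g] that(1) G by blast
    show "u a \<in> lvals k u G" using that by (simp add: lvals_def)
  qed
  show "gap G g \<inter> G = {}" using le[OF g] by (fastforce simp: gap_def)
  assume h: "h \<in> G" "h \<noteq> g"
  then have "u g < u h \<or> u h < u g" using u_eq[OF u, of g h] by auto
  then show "gap G g \<inter> gap G h = {}"
    using le[OF g h(1)] le[OF h(1) g] by (fastforce simp: gap_def)
qed

text \<open>The witness carries the largest element of \<open>lvals k u G\<close> below
  \<open>u a\<close>. That it is at least \<open>c\<close> later shows that its column is processed
  earlier.\<close>

lemma gap_exists:
  assumes G: "G \<subseteq> {1..k}" and a: "a \<in> {1..k}" "a \<notin> G" and c: "c \<in> lvals k u G" "c < u a"
  obtains h where "h \<in> G" "a \<in> gap G h" "c \<le> u h"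
proof -
  let ?E = "lvals k u G"
  define e where "e = Max {e \<in> ?E. e < u a}"
  have fin: "finite {e \<in> ?E. e < u a}" using lvals_props(1)[OF u G] by simp
  have "e \<in> {e \<in> ?E. e < u a}" unfolding e_def using fin c by (intro Max_in) auto
  then have e: "e \<in> ?E" "e < u a" by auto
  have ak: "u a \<le> k" using u_range(2)[OF u a(1)] .
  then have "e \<noteq> Suc k" using e(2) by simp
  then obtain h where h: "h \<in> G" "e = u h" using e(1) by (auto simp: lvals_def)
  have ek: "e \<le> k" using e(2) ak by simp
  have "u a < nxt ?E e"
  proof (rule ccontr)
    assume "\<not> u a < nxt ?E e"
    moreover have "nxt ?E e \<noteq> u a"
      using nxt_lvals(1)[OF u G ek] lvals_props(4)[OF u G a(1)] a(2) by auto
    ultimately have "nxt ?E e \<in> {e \<in> ?E. e < u a}" using nxt_lvals(1)[OF u G ek] by simp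
    then have "nxt ?E e \<le> e" unfolding e_def using fin by (intro Max_ge)
    then show False using nxt_lvals(2)[OF u G ek] by simp
  qed
  then have "a \<in> gap G h" using a(1) e(2) h(2) by (simp add: gap_def)
  moreover have "c \<le> u h" unfolding h(2)[symmetric] e_def using fin c by (intro Max_ge) auto
  ultimately show ?thesis using that h(1) by blast
qed

lemma nxt_le_member:
  assumes "G \<subseteq> {1..k}" "g \<in> G" "h \<in> G" "u g < u h"
  shows "nxt (lvals k u G) (u g) \<le> u h"
proof (rule nxt_lvals(3)[OF u assms(1) _ _ assms(4)])
  show "u g \<le> k" using u_range(2)[OF u, of g] assms by blast
  show "u h \<in> lvals k u G" using assms by (simp add: lvals_def)
qed

context
  fixes G :: "nat set"
  assumes G: "G \<in> lifts k u"
begin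

lemma G_sub: "G \<subseteq> {1..k}"
  using G by (simp add: lifts_def)

lemma lift_G: "g \<in> G \<Longrightarrow> lift k u G g = nxt (lvals k u G) (u g)"
  by (simp add: lift_def)

lemma lift_not_G: "q \<notin> G \<Longrightarrow> q \<noteq> Suc k \<Longrightarrow> lift k u G q = u q"
  by (simp add: lift_def)

lemma G_le: "g \<in> G \<Longrightarrow> u g \<le> k"
  using G_sub u_range(2)[OF u, of g] by blast

lemma gap_less: "g \<in> G \<Longrightarrow> a \<in> gap G g \<Longrightarrow> a < g"
proof (rule ccontr)
  assume g: "g \<in> G" "a \<in> gap G g" "\<not> a < g"
  then have "a \<noteq> g" by (auto simp: gap_def)
  then have "g < a \<and> a \<le> k" using g by (auto simp: gap_def)
  then have "\<not> (u g < u a \<and> u a < nxt (lvals k u G) (u g))" using G g(1) unfolding lifts_def by blast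
  then show False using g(2) by (simp add: gap_def)
qed

lemma cols_lift_other:
  assumes "q \<in> {1..k}" "q \<notin> G"
  shows "cols (lift k u G) q = cols u q"
proof -
  have "lift k u G q < lift k u G a \<longleftrightarrow> u q < u a" if "a < q" for a
  proof (cases "a \<in> G")
    case True
    have "\<not> (u a < u q \<and> u q < nxt (lvals k u G) (u a))"
      using G True that assms(1) unfolding lifts_def by auto
    moreover have "u q \<noteq> u a" using u_eq[OF u] that by simp
    moreover have "u q \<noteq> nxt (lvals k u G) (u a)"
      using nxt_lvals(1)[OF u G_sub G_le[OF True]] lvals_props(4)[OF u G_sub assms(1)] assms(2) by auto
    moreover have "u a < nxt (lvals k u G) (u a)" using nxt_lvals(2)[OF u G_sub G_le[OF True]] .
    ultimately show ?thesis using assms True by (simp add: lift_G lift_not_G) linarith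
  next
    case False
    then show ?thesis using assms that by (simp add: lift_not_G)
  qed
  then have "{a. a < q \<and> lift k u G q < lift k u G a} = {a. a < q \<and> u q < u a}" by auto
  then show ?thesis by (simp add: cols_def)
qed

lemma lift_less_G:
  assumes g: "g \<in> G" and a: "a < g"
  shows "lift k u G g < lift k u G a \<longleftrightarrow> u g < u a \<and> nxt (lvals k u G) (u g) \<le> u a"
proof -
  have ak: "a \<noteq> Suc k" using a g G_sub by auto
  note n1 = nxt_lvals(1)[OF u G_sub G_le[OF g]] and n2 = nxt_lvals(2)[OF u G_sub G_le[OF g]]
  show ?thesis
  proof (cases "a \<in> G")
    case True
    have ne: "u g \<noteq> u a" using u_eq[OF u] a by simp
    show ?thesis
    proof (cases "u g < u a")
      case lt: True
      have "nxt (lvals k u G) (u g) \<le> u a" using nxt_le_member[OF G_sub g True lt] .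
      moreover have "u a < nxt (lvals k u G) (u a)" using nxt_lvals(2)[OF u G_sub G_le[OF True]] .
      ultimately show ?thesis using lt g True by (simp add: lift_G)
    next
      case False
      then have "nxt (lvals k u G) (u a) \<le> u g" using nxt_le_member[OF G_sub True g] ne by simp
      then show ?thesis using False n2 g True by (simp add: lift_G)
    qed
  next
    case False
    have "u a \<noteq> nxt (lvals k u G) (u g)"
    proof (cases "a \<in> {1..k}")
      case True
      then show ?thesis using n1 lvals_props(4)[OF u G_sub True] False by auto
    next
      case False
      then have "u a = a" using u_not_in by blast
      moreover have "a < 1" using False a g G_sub by auto
      ultimately show ?thesis using n2 by simp
    qed
    then show ?thesis using n2 g False ak by (simp add: lift_G lift_not_G) linarith
  qed
qed

lemma inversions_lift_G:
  assumes g: "g \<in> G"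
  shows "{a. a < g \<and> u g < u a} = gap G g \<union> {a. a < g \<and> lift k u G g < lift k u G a}"
    and "gap G g \<inter> {a. a < g \<and> lift k u G g < lift k u G a} = {}"
proof -
  have rng: "a \<in> {1..k}" if "a < g" "u g < u a" for a
  proof -
    have "a \<noteq> 0" using that u_not_in[of 0] by (metis atLeastAtMost_iff not_less_zero not_one_le_zero)
    then show ?thesis using that g G_sub by fastforce
  qed
  have gap: "a \<in> gap G g \<longleftrightarrow> a < g \<and> u g < u a \<and> u a < nxt (lvals k u G) (u g)" for a
    using rng[of a] gap_less[OF g, of a] unfolding gap_def by blast
  have iff: "a < g \<and> lift k u G g < lift k u G a \<longleftrightarrow>
      a < g \<and> u g < u a \<and> \<not> u a < nxt (lvals k u G) (u g)" for a
    using lift_less_G[OF g, of a] by (auto simp: not_less)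
  show "{a. a < g \<and> u g < u a} = gap G g \<union> {a. a < g \<and> lift k u G g < lift k u G a}"
    unfolding iff set_eq_iff Un_iff gap mem_Collect_eq by blast
  show "gap G g \<inter> {a. a < g \<and> lift k u G g < lift k u G a} = {}"
    unfolding iff using gap by blast
qed

lemma inversions_lift_last:
  "{a. a < Suc k \<and> lift k u G (Suc k) < lift k u G a} = G \<union> (\<Union>g\<in>G. gap G g)"
proof -
  let ?E = "lvals k u G"
  have last: "lift k u G (Suc k) = Min ?E" using G_sub by (auto simp: lift_def)
  note M = Min_lvals[OF u G_sub]
  show ?thesis
  proof (intro equalityI subsetI)
    fix a assume "a \<in> {a. a < Suc k \<and> lift k u G (Suc k) < lift k u G a}"
    then have a: "a < Suc k" "Min ?E < lift k u G a" using last by auto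
    show "a \<in> G \<union> (\<Union>g\<in>G. gap G g)"
    proof (cases "a \<in> G")
      case False
      then have lt: "Min ?E < u a" using a by (simp add: lift_not_G)
      have "a \<noteq> 0"
      proof
        assume "a = 0"
        then have "u a = 0" using u_not_in[of 0] by simp
        then show False using lt by simp
      qed
      then have "a \<in> {1..k}" using a by auto
      then obtain h where "h \<in> G" "a \<in> gap G h"
        using gap_exists[OF G_sub _ False M(1) lt] by blast
      then show ?thesis by blast
    qed simp
  next
    fix a assume "a \<in> G \<union> (\<Union>g\<in>G. gap G g)"
    then show "a \<in> {a. a < Suc k \<and> lift k u G (Suc k) < lift k u G a}"
    proof
      assume a: "a \<in> G"
      have "Min ?E \<le> u a" using a M(2) by (simp add: lvals_def)
      then have "Min ?E < lift k u G a" using nxt_lvals(2)[OF u G_sub G_le[OF a]] a by (simp add: lift_G)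
      moreover have "a < Suc k" using a G_sub by auto
      ultimately show ?thesis using last by simp
    next
      assume "a \<in> (\<Union>g\<in>G. gap G g)"
      then obtain g where g: "g \<in> G" "a \<in> gap G g" by blast
      then have "a \<notin> G" using gap_disjoint(1)[OF G_sub g(1)] by blast
      moreover have a: "a \<in> {1..k}" "u g < u a" using g(2) by (auto simp: gap_def)
      moreover have "Min ?E \<le> u g" using g(1) M(2) by (simp add: lvals_def)
      ultimately show ?thesis using last by (simp add: lift_not_G)
    qed
  qed
qed

text \<open>Columns are processed by decreasing value. A box that stays in the column
  \<open>g\<close> either belongs to \<open>G\<close>, where \<open>H\<close> takes care of it, or
  lies in the gap of a position with larger value, whose boxes have already been moved. The bound
  \<open>c\<close> allows \<open>H\<close> to be another set that contains the elements of
  \<open>G\<close> above \<open>c\<close> only.\<close>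

lemma movable_prefix:
  assumes gs: "set gs = G" "sorted_wrt (\<lambda>a b. u b < u a) gs"
    and pre: "gs = zs @ zs'" and H: "\<And>b. b \<in> G \<Longrightarrow> c < u b \<Longrightarrow> b \<in> H"
    and c: "\<And>g. g \<in> set zs \<Longrightarrow> c < nxt (lvals k u G) (u g)" and Gl: "set Gl = H"
  shows "movable (\<lambda>g. sorted_list_of_set (gap G g)) (cols (lift k u G)) zs Gl"
  unfolding movable_def
proof (intro allI impI subsetI)
  fix xs g ys b
  assume zs: "zs = xs @ g # ys" and b: "b \<in> set (cols (lift k u G) g)"
  have g: "g \<in> G" using gs(1) pre zs by auto
  have bg: "b < g" "u g < u b" "nxt (lvals k u G) (u g) \<le> u b"
    using b lift_less_G[OF g] by (auto simp: set_cols)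
  note n1 = nxt_lvals(1)[OF u G_sub G_le[OF g]] and n2 = nxt_lvals(2)[OF u G_sub G_le[OF g]]
  show "b \<in> set Gl \<union> (\<Union>h\<in>set xs. set (sorted_list_of_set (gap G h)))"
  proof (cases "b \<in> G")
    case True
    have "c < u b" using c[of g] zs bg(3) by simp
    then show ?thesis using H[OF True] Gl by simp
  next
    case False
    have "b \<noteq> 0"
    proof
      assume "b = 0"
      then have "u b = 0" using u_not_in[of 0] by simp
      then show False using bg(2) by simp
    qed
    then have bk: "b \<in> {1..k}" using bg(1) g G_sub by fastforce
    have "u b \<noteq> nxt (lvals k u G) (u g)" using n1 lvals_props(4)[OF u G_sub bk] False by auto
    then have "nxt (lvals k u G) (u g) < u b" using bg(3) by simp
    then obtain h where h: "h \<in> G" "b \<in> gap G h" "nxt (lvals k u G) (u g) \<le> u h"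
      using gap_exists[OF G_sub bk False n1] by blast
    have "u g < u h" using h(3) n2 by simp
    have "h \<in> set (xs @ g # (ys @ zs'))" using h(1) gs(1) pre zs by simp
    moreover have "h \<noteq> g" using \<open>u g < u h\<close> by auto
    moreover have "h \<notin> set (ys @ zs')"
    proof
      assume "h \<in> set (ys @ zs')"
      moreover have "gs = xs @ g # (ys @ zs')" using pre zs by simp
      then have "sorted_wrt (\<lambda>a b. u b < u a) (g # (ys @ zs'))"
        using gs(2) sorted_wrt_append by metis
      ultimately have "u h < u g" by simp
      then show False using \<open>u g < u h\<close> by simp
    qed
    ultimately have "h \<in> set xs" by auto
    moreover have "b \<in> set (sorted_list_of_set (gap G h))" using h(2) by (simp add: gap_def)
    ultimately show ?thesis by blast
  qed
qed

end

lemma wdim_lifts: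
  "(\<Sum>G\<in>lifts k u. wdim {1..Suc k} (cols (lift k u G)) \<alpha>) \<le>
   (\<Sum>B\<in>Pow (Poly_Mapping.keys \<alpha>). wdim {1..k} (cols u) (\<alpha> - bsum B))"
proof -
  have "\<exists>gs. set gs = G \<and> distinct gs \<and> sorted_wrt (\<lambda>a b. u b < u a) gs" if "G \<in> lifts k u" for G
  proof -
    have "finite G" using G_sub[OF that] finite_subset by blast
    moreover have "inj_on u G" using u_eq[OF u] by (auto simp: inj_on_def)
    ultimately show ?thesis using ordered_enumeration by metis
  qed
  then obtain gs where gs: "\<And>G. G \<in> lifts k u \<Longrightarrow> set (gs G) = G" "\<And>G. G \<in> lifts k u \<Longrightarrow> distinct (gs G)"
      "\<And>G. G \<in> lifts k u \<Longrightarrow> sorted_wrt (\<lambda>a b. u b < u a) (gs G)"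
    by metis
  define A where "A G g = sorted_list_of_set (gap G g)" for G g
  have fgap: "finite (gap G g)" for G g by (simp add: gap_def)
  have ins: "{1..Suc k} = insert (Suc k) {1..k}" by auto
  show ?thesis
    unfolding ins
  proof (rule wdim_pieri[where gs = gs and Gl = gs and A = A and X = "\<lambda>G. cols (lift k u G)"
        and \<rho> = "\<lambda>G. \<Sum>e\<in>u ` G. 2 ^ e"])
    show "finite {1..k}" "finite (lifts k u)" "Suc k \<notin> {1..k}" by (simp_all add: finite_lifts)
    show "set (gs G) \<subseteq> {1..k}" "distinct (gs G)" if "G \<in> lifts k u" for G
      using that gs G_sub[OF that] by simp_all
    show "mset (cols u g) = mset (A G g @ cols (lift k u G) g)" if "G \<in> lifts k u" "g \<in> set (gs G)" for G g
    proof -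
      have g: "g \<in> G" using that gs(1) by simp
      have "mset_set {a. a < g \<and> u g < u a} =
          mset_set (gap G g) + mset_set {a. a < g \<and> lift k u G g < lift k u G a}"
        unfolding inversions_lift_G(1)[OF that(1) g]
        using inversions_lift_G(2)[OF that(1) g] fgap by (intro mset_set_Union) auto
      moreover have "mset (A G g) = mset_set (gap G g)"
        using mset_set_set[of "A G g"] fgap by (simp add: A_def)
      ultimately show ?thesis by (simp add: mset_cols)
    qed
    show "movable (A G) (cols (lift k u G)) (gs G) (gs G)" if "G \<in> lifts k u" for G
      unfolding A_def
      by (rule movable_prefix[OF that gs(1)[OF that] gs(3)[OF that], where c = 0 and zs' = "[]" and H = G])
        (use that gs(1) G_sub[OF that] nxt_lvals(2)[OF u G_sub[OF that] G_le[OF that]] in fastforce)+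
    show "mset (cols (lift k u G) q) = mset (if q \<in> set (gs G) then cols (lift k u G) q else cols u q)"
      if "G \<in> lifts k u" "q \<in> {1..k}" for G q
      using cols_lift_other[OF that(1,2)] gs(1)[OF that(1)] by simp
    show "mset (cols (lift k u G) (Suc k)) = mset (moved (A G) (gs G) @ gs G)" if "G \<in> lifts k u" for G
    proof (rule set_eq_iff_mset_eq_distinct[THEN iffD1])
      note sub = G_sub[OF that]
      show "distinct (cols (lift k u G) (Suc k))" by (simp add: cols_def)
      have "distinct (moved (A G) (gs G))"
        using gs(1,2)[OF that] gap_disjoint(2)[OF sub] fgap by (intro distinct_moved) (auto simp: A_def)
      moreover have "set (moved (A G) (gs G)) \<inter> G = {}"
        using gap_disjoint(1)[OF sub] gs(1)[OF that] fgap by (auto simp: set_moved A_def)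
      ultimately show "distinct (moved (A G) (gs G) @ gs G)" using gs(1,2)[OF that] by simp
      show "set (cols (lift k u G) (Suc k)) = set (moved (A G) (gs G) @ gs G)"
        unfolding set_cols inversions_lift_last[OF that]
        using gs(1)[OF that] fgap by (auto simp: set_moved A_def)
    qed
  next
    fix G G'
    assume GG: "G \<in> lifts k u" "G' \<in> lifts k u" "G \<noteq> G'" "(\<Sum>e\<in>u ` G. 2 ^ e) \<le> (\<Sum>e\<in>u ` G'. (2::nat) ^ e)"
    note sub = G_sub[OF GG(1)] and sub' = G_sub[OF GG(2)]
    have fin: "finite G" "finite G'" using sub sub' finite_subset by blast+
    have mem: "u a \<in> u ` H \<longleftrightarrow> a \<in> H" for a H using u_eq[OF u] by auto
    have "u ` G \<noteq> u ` G'" using GG(3) mem by blast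
    then obtain x where x: "x \<in> u ` G'" "x \<notin> u ` G" "\<And>y. y > x \<Longrightarrow> y \<in> u ` G \<longleftrightarrow> y \<in> u ` G'"
      using colex_witness[of "u ` G" "u ` G'"] fin GG(4) by blast
    \<comment> \<open>\<open>a\<close> is the position at which \<open>G\<close> and
      \<open>G'\<close> first differ, counted from the largest values; above it the two sets
      agree.\<close>
    then obtain a where a: "x = u a" "a \<in> G'" "a \<notin> G" using mem by blast
    have up: "b \<in> G'" if "b \<in> G" "x < u b" for b using x(3)[OF that(2)] mem that(1) by simp
    show "(\<exists>xs g ys. gs G = xs @ g # ys \<and> movable (A G) (cols (lift k u G)) (xs @ [g]) (gs G') \<and>
          set (A G g) \<inter> set (gs G') \<noteq> {}) \<or>
        (movable (A G) (cols (lift k u G)) (gs G) (gs G') \<and> length (gs G') \<noteq> length (gs G))"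
    proof (cases "\<exists>g\<in>G. u g < x")
      case True
      \<comment> \<open>Here \<open>a\<close> lies in the gap of some \<open>h\<close> in
        \<open>G\<close>, so the chain for \<open>G\<close> moves the box \<open>a\<close> into a
        column that already contains it.\<close>
      then obtain g0 where g0: "g0 \<in> G" "u g0 < u a" using a(1) by blast
      have "u g0 \<in> lvals k u G" using g0(1) by (simp add: lvals_def)
      then obtain h where h: "h \<in> G" "a \<in> gap G h"
        using gap_exists[OF sub _ a(3) _ g0(2)] a(2) sub' by blast
      then obtain xs ys where xy: "gs G = xs @ h # ys" using gs(1)[OF GG(1)] by (metis split_list)
      have "movable (A G) (cols (lift k u G)) (xs @ [h]) (gs G')"
        unfolding A_def
      proof (rule movable_prefix[OF GG(1) gs(1)[OF GG(1)] gs(3)[OF GG(1)], where c = x and zs' = ys and H = G'])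
        show "gs G = (xs @ [h]) @ ys" using xy by simp
        show "b \<in> G'" if "b \<in> G" "x < u b" for b using up that .
        show "set (gs G') = G'" using gs(1)[OF GG(2)] .
        have xh: "x < nxt (lvals k u G) (u h)" using h(2) by (simp add: gap_def a(1))
        show "x < nxt (lvals k u G) (u g)" if "g \<in> set (xs @ [h])" for g
        proof (cases "g = h")
          case False
          then have "g \<in> set xs" using that by simp
          moreover have "sorted_wrt (\<lambda>a b. u b < u a) (xs @ h # ys)" using gs(3)[OF GG(1)] xy by simp
          ultimately have "u h < u g" by (simp add: sorted_wrt_append)
          moreover have "g \<in> G" using \<open>g \<in> set xs\<close> gs(1)[OF GG(1)] xy by auto
          ultimately have "nxt (lvals k u G) (u h) \<le> u g" "u g < nxt (lvals k u G) (u g)"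
            using nxt_le_member[OF sub h(1)] nxt_lvals(2)[OF u sub G_le[OF GG(1)]] by auto
          then show ?thesis using xh by simp
        qed (use xh in simp)
      qed
      moreover have "a \<in> set (A G h) \<inter> set (gs G')" using h(2) a(2) gs(1)[OF GG(2)] fgap by (simp add: A_def)
      ultimately show ?thesis using xy by blast
    next
      case False
      \<comment> \<open>Now all of \<open>G\<close> lies above \<open>x\<close>, where it agrees
        with \<open>G'\<close>. So \<open>G\<close> is a proper subset of \<open>G'\<close>, the
        chain works, and the lengths differ.\<close>
      have "x < u b" if "b \<in> G" for b using False x(2) that by (metis imageI linorder_neqE_nat)
      then have "G \<subset> G'" using up a(2,3) by blast
      then have "card G < card G'" using fin(2) by (rule psubset_card_mono[rotated])
      then have "length (gs G') \<noteq> length (gs G)"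
        using distinct_card[OF gs(2)[OF GG(1)]] distinct_card[OF gs(2)[OF GG(2)]] gs(1)[OF GG(1)] gs(1)[OF GG(2)] by simp
      moreover have "movable (A G) (cols (lift k u G)) (gs G) (gs G')"
        unfolding A_def
      proof (rule movable_prefix[OF GG(1) gs(1)[OF GG(1)] gs(3)[OF GG(1)], where c = 0 and zs' = "[]" and H = G'])
        show "gs G = gs G @ []" by simp
        show "b \<in> G'" if "b \<in> G" for b using that \<open>G \<subset> G'\<close> by blast
        show "set (gs G') = G'" using gs(1)[OF GG(2)] .
        show "0 < nxt (lvals k u G) (u g)" if "g \<in> set (gs G)" for g
        proof -
          have "g \<in> G" using that gs(1)[OF GG(1)] by simp
          then show ?thesis using nxt_lvals(2)[OF u sub G_le[OF GG(1)]] by (metis gr_zeroI not_less_zero)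
        qed
      qed
      ultimately show ?thesis by blast
    qed
  qed
qed

end

section \<open>The theorem of Kraskiewicz and Pragacz\<close>

lemma rnk_le_card: "finite I \<Longrightarrow> rnk I x \<le> card I"
  by (metis card_mono rnk_basis)

text \<open>Row \<open>l\<close> of an upper triangular matrix is zero in all columns before
  \<open>l\<close>, so every product that uses the row \<open>l\<close> vanishes.\<close>

lemma wdim_eq_0:
  assumes "finite Q" "l \<in> Poly_Mapping.keys \<alpha>" "\<And>q d. q \<in> Q \<Longrightarrow> d \<in> set (D q) \<Longrightarrow> d < l"
  shows "wdim Q D \<alpha> = 0"
proof -
  obtain J where J: "J \<subseteq> fillings Q \<alpha>" "finite J" "indep J (minors Q D)" "card J = wdim Q D \<alpha>"
    by (rule wdim_basis[OF assms(1), where D = D and \<alpha> = \<alpha>])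
  have "J = {}"
  proof (rule ccontr)
    assume "J \<noteq> {}"
    then obtain C where C: "C \<in> J" by blast
    then have CF: "C \<in> fillings Q \<alpha>" using J(1) by blast
    then have "card {q \<in> Q. l \<in> C q} \<noteq> 0" using assms(2) by (simp add: fillings_def in_keys_iff)
    then have "{q \<in> Q. l \<in> C q} \<noteq> {}" by (metis card.empty)
    then obtain q where q: "q \<in> Q" "l \<in> C q" by blast
    have "minors Q D C y = 0" for y
    proof -
      have "minor (unitri y) (C q) (D q) = 0"
        by (rule minor_zero_row[OF finite_filling[OF CF assms(1)] q(2)])
          (use assms(3)[OF q(1)] in \<open>force simp: unitri_def\<close>)
      then show ?thesis unfolding minors_def using assms(1) q(1) by (meson prod_zero)
    qed
    then show False using indep_nonzero[OF J(2,3) C] by blast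
  qed
  then show ?thesis using J(4) by simp
qed

section \<open>Patterns obtained by deleting an entry\<close>

lemma pattern_del_skip:
  assumes w: "w permutes {1..n}" and k: "k \<in> {1..n}" and i: "i \<in> {1..n - 1}"
  shows "skip (w k) (pattern_del n w k i) = w (skip k i)"
proof -
  have "w (skip k i) \<noteq> w k" using inj_eq[OF permutes_inj[OF w]] by simp
  then show ?thesis using i by (auto simp: pattern_del_def skip_def Let_def)
qed

lemma skip_mem:
  assumes "k \<in> {1..n}"
  shows "skip k i \<in> {1..n} \<longleftrightarrow> i \<in> {1..n - 1}"
  using assms by (auto simp: skip_def)

lemma pattern_del_permutes:
  assumes w: "w permutes {1..n}" and k: "k \<in> {1..n}"
  shows "pattern_del n w k permutes {1..n - 1}"
proof -
  have wk: "w k \<in> {1..n}" using permutes_in_image[OF w] k by blast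
  note sk = pattern_del_skip[OF w k]
  have map: "pattern_del n w k i \<in> {1..n - 1}" if "i \<in> {1..n - 1}" for i
  proof -
    have "w (skip k i) \<in> {1..n}" using that skip_mem[OF k] permutes_in_image[OF w] by blast
    then show ?thesis using sk[OF that] skip_mem[OF wk] by metis
  qed
  have inj: "inj_on (pattern_del n w k) {1..n - 1}"
  proof (rule inj_onI)
    fix i j assume ij: "i \<in> {1..n - 1}" "j \<in> {1..n - 1}" "pattern_del n w k i = pattern_del n w k j"
    then have "w (skip k i) = w (skip k j)" using sk by metis
    then show "i = j" using inj_eq[OF permutes_inj[OF w]] by simp
  qed
  show ?thesis
  proof (rule bij_imp_permutes)
    have "pattern_del n w k ` {1..n - 1} = {1..n - 1}"
      by (rule endo_inj_surj[OF _ _ inj]) (use map in blast)+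
    then show "bij_betw (pattern_del n w k) {1..n - 1} {1..n - 1}"
      using inj by (simp add: bij_betw_def)
  qed (auto simp: pattern_del_def)
qed

lemma pattern_del_less:
  assumes w: "w permutes {1..n}" and k: "k \<in> {1..n}" and "i \<in> {1..n - 1}" "j \<in> {1..n - 1}"
  shows "pattern_del n w k i < pattern_del n w k j \<longleftrightarrow> w (skip k i) < w (skip k j)"
  using pattern_del_skip[OF w k] assms(3,4) skip_less_iff by metis

text \<open>\<open>G\<close> consists of the positions with values above the last one,
  \<open>c\<close>. Deleting \<open>c\<close> lowers these values by one; the lift raises them
  again, because \<open>lvals\<close> is the interval from \<open>c\<close> to \<open>Suc k\<close>.
  All gaps are empty, so the condition in \<open>lifts\<close> is trivial.\<close>

lemma lift_pattern_del:
  assumes w: "w permutes {1..Suc k}"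
  defines "u \<equiv> pattern_del (Suc k) w (Suc k)"
  obtains G where "G \<in> lifts k u" "lift k u G = w"
proof -
  define c where "c = w (Suc k)"
  define G where "G = {q \<in> {1..k}. c < w q}"
  have weq: "w a = w b \<longleftrightarrow> a = b" for a b using inj_eq[OF permutes_inj[OF w]] .
  have wmem: "w a \<in> {1..Suc k} \<longleftrightarrow> a \<in> {1..Suc k}" for a using permutes_in_image[OF w] .
  have c: "1 \<le> c" "c \<le> Suc k" using wmem[of "Suc k"] by (auto simp: c_def)
  have uq: "u q = (if w q < c then w q else w q - 1)" if "q \<in> {1..k}" for q
    using that by (simp add: u_def pattern_del_def skip_def c_def Let_def)
  have uG: "Suc (u q) = w q" if "q \<in> G" for q using that uq[of q] by (auto simp: G_def)
  have u_other: "u q = w q" if "q \<in> {1..k}" "q \<notin> G" for q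
  proof -
    have "w q \<noteq> c" using weq that(1) by (auto simp: c_def)
    then show ?thesis using that uq by (auto simp: G_def)
  qed
  have E: "lvals k u G = {c..Suc k}"
  proof (intro equalityI subsetI)
    fix e assume "e \<in> lvals k u G"
    then consider "e = Suc k" | q where "q \<in> G" "e = u q" by (auto simp: lvals_def)
    then show "e \<in> {c..Suc k}"
    proof cases
      case 2
      then have "c < w q" "w q \<le> Suc k" using wmem[of q] by (auto simp: G_def)
      then show ?thesis using uG[OF 2(1)] 2(2) by auto
    qed (use c in auto)
  next
    fix e assume e: "e \<in> {c..Suc k}"
    show "e \<in> lvals k u G"
    proof (cases "e = Suc k")
      case False
      then have "Suc e \<in> {1..Suc k}" using e by auto
      then obtain q where q: "q \<in> {1..Suc k}" "w q = Suc e" using permutes_image[OF w] by (metis imageE)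
      have "q \<noteq> Suc k" using q(2) e by (auto simp: c_def)
      then have "q \<in> G" using q e by (auto simp: G_def)
      then have "u q = e" using uG q(2) by fastforce
      then show ?thesis using \<open>q \<in> G\<close> by (auto simp: lvals_def)
    qed (simp add: lvals_def)
  qed
  have nx: "nxt (lvals k u G) (u q) = Suc (u q)" if "q \<in> G" for q
  proof -
    have "w q \<le> Suc k" "c < w q" using that wmem[of q] by (auto simp: G_def)
    then show ?thesis using uG[OF that] unfolding E by (intro nxt_eqI) auto
  qed
  show ?thesis
  proof (rule that)
    show "G \<in> lifts k u" using nx by (auto simp: lifts_def G_def)
    show "lift k u G = w"
    proof
      fix q
      consider "q \<in> G" | "q \<notin> G" "q = Suc k" | "q \<notin> G" "q \<in> {1..k}" | "q \<notin> G" "q \<notin> {1..Suc k}"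
        by (metis atLeastAtMost_iff le_Suc_eq)
      then show "lift k u G q = w q"
      proof cases
        case 1
        then show ?thesis using nx uG by (simp add: lift_def)
      next
        case 2
        have "Min {c..Suc k} = c" using c by (intro Min_eqI) auto
        then show ?thesis using 2 by (simp add: lift_def E c_def)
      next
        case 3
        then show ?thesis using u_other by (simp add: lift_def)
      next
        case 4
        then have "u q = q" by (auto simp: u_def pattern_del_def)
        moreover have "q \<noteq> Suc k" using 4(2) by auto
        ultimately show ?thesis using 4(1) permutes_not_in[OF w 4(2)] by (simp add: lift_def)
      qed
    qed
  qed
qed

lemma bsum_add_diff:
  assumes "finite B" "B \<subseteq> Poly_Mapping.keys \<alpha>"
  shows "bsum B + (\<alpha> - bsum B) = \<alpha>"
proof (rule poly_mapping_eqI)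
  fix l
  show "Poly_Mapping.lookup (bsum B + (\<alpha> - bsum B)) l = Poly_Mapping.lookup \<alpha> l"
    using assms by (auto simp: lookup_add lookup_minus lookup_bsum in_keys_iff dest!: subsetD)
qed

lemma prod_Var_bsum: "finite B \<Longrightarrow> (\<Prod>j\<in>B. Var j) = Poly_Mapping.single (bsum B) 1"
  by (induction B rule: finite_induct) (auto simp: bsum_def Var_def mult_single)

lemma lookup_prod_Var_mult:
  assumes "finite B"
  shows "Poly_Mapping.lookup ((\<Prod>j\<in>B. Var j) * g) \<alpha> =
    (if B \<subseteq> Poly_Mapping.keys \<alpha> then Poly_Mapping.lookup g (\<alpha> - bsum B) else 0)"
proof (cases "B \<subseteq> Poly_Mapping.keys \<alpha>")
  case True
  then show ?thesis
    using lookup_monomial_mult(1)[of "bsum B" g "\<alpha> - bsum B"]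
    by (simp add: prod_Var_bsum[OF assms] bsum_add_diff[OF assms True])
next
  case False
  then obtain l where l: "l \<in> B" "l \<notin> Poly_Mapping.keys \<alpha>" by blast
  have "\<alpha> \<noteq> bsum B + \<beta>" for \<beta>
    using l by (auto simp: lookup_add lookup_bsum[OF assms] in_keys_iff)
  then show ?thesis using False lookup_monomial_mult(2) by (simp add: prod_Var_bsum[OF assms])
qed

lemma lookup_Sch_outside:
  assumes "Poly_Mapping.lookup (Sch n w) \<alpha> \<noteq> 0"
  shows "Poly_Mapping.keys \<alpha> \<subseteq> {1..<n}"
  using Gf_in_vars[of 1 n "inv w"] assms by (simp add: Sch_def in_vars_def in_keys_iff)

text \<open>The hypothesis on \<open>\<alpha>\<close> excludes the row \<open>0\<close>: it is not
  zero in the matrix, whereas the variable with index \<open>0\<close> does not occur in the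
  polynomial.\<close>

theorem Sch_eq_wdim:
  assumes "w permutes {1..n}" "0 \<notin> Poly_Mapping.keys \<alpha>"
  shows "Poly_Mapping.lookup (Sch n w) \<alpha> = int (wdim {1..n} (cols w) \<alpha>)"
  using assms
proof (induction n arbitrary: w \<alpha>)
  case 0
  have one: "Sch 0 w = 1" using 0 by (simp add: Sch_def Gf_ge)
  show ?case
  proof (cases "\<alpha> = 0")
    case True
    have "fillings {1..0} \<alpha> \<subseteq> {\<lambda>_. {}}" by (auto simp: fillings_def)
    then have "card (fillings {1..0} \<alpha>) \<le> card {\<lambda>_ :: nat. {} :: nat set}"
      by (rule card_mono[rotated]) simp
    then have "wdim {1..0} (cols w) \<alpha> \<le> 1"
      using rnk_le_card[OF finite_fillings[of "{1..0}" \<alpha>], of "minors {1..0} (cols w)"] by (simp add: wdim_def)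
    moreover have "1 \<le> wdim {1..0} (cols w) 0" by (rule wdim_empty_diagram) auto
    ultimately show ?thesis using True by (simp add: one lookup_one)
  next
    case False
    then have "Poly_Mapping.keys \<alpha> \<noteq> {}" by simp
    then obtain l where "l \<in> Poly_Mapping.keys \<alpha>" by blast
    then have "wdim {1..0} (cols w) \<alpha> = 0" by (rule wdim_eq_0[rotated]) auto
    then show ?thesis using False by (simp add: one lookup_one when_def)
  qed
next
  case (Suc k)
  have ge: "Poly_Mapping.lookup (Sch (Suc k) w) \<alpha> \<le> int (wdim {1..Suc k} (cols w) \<alpha>)"
    if "w permutes {1..Suc k}" for w
    unfolding Sch_def by (rule Gf_le_wdim[OF that]) auto
  show ?case
  proof (cases "Poly_Mapping.keys \<alpha> \<subseteq> {1..k}")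
    case False
    then obtain l where l: "l \<in> Poly_Mapping.keys \<alpha>" "l \<notin> {1..k}" by blast
    then have "k < l" using Suc.prems(2) by (cases "l = 0") auto
    then have "wdim {1..Suc k} (cols w) \<alpha> = 0"
      using l(1) by (intro wdim_eq_0) (auto simp: set_cols)
    moreover have "Poly_Mapping.lookup (Sch (Suc k) w) \<alpha> = 0"
      using lookup_Sch_outside[of "Suc k" w \<alpha>] False by (auto simp: atLeastLessThanSuc_atLeastAtMost)
    ultimately show ?thesis by simp
  next
    case True
    define u where "u = pattern_del (Suc k) w (Suc k)"
    have u: "u permutes {1..k}" using pattern_del_permutes[OF Suc.prems(1), of "Suc k"] by (simp add: u_def)
    obtain G where G: "G \<in> lifts k u" "lift k u G = w"
      using lift_pattern_del[OF Suc.prems(1)] unfolding u_def by blast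
    have lp: "lift k u G permutes {1..Suc k}" if "G \<in> lifts k u" for G
      using that by (intro lift_permutes[OF u]) (simp add: lifts_def)
    have "int (\<Sum>G\<in>lifts k u. wdim {1..Suc k} (cols (lift k u G)) \<alpha>) \<le>
        int (\<Sum>B\<in>Pow (Poly_Mapping.keys \<alpha>). wdim {1..k} (cols u) (\<alpha> - bsum B))"
      using wdim_lifts[OF u, of \<alpha>] by (simp only: of_nat_le_iff)
    also have "\<dots> = (\<Sum>B\<in>Pow (Poly_Mapping.keys \<alpha>). Poly_Mapping.lookup (Sch k u) (\<alpha> - bsum B))"
    proof -
      have "0 \<notin> Poly_Mapping.keys (\<alpha> - bsum B)" for B
        using Suc.prems(2) by (simp add: in_keys_iff lookup_minus)
      then show ?thesis using Suc.IH[OF u] by simp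
    qed
    also have "\<dots> = (\<Sum>B\<in>Pow {1..k}. Poly_Mapping.lookup ((\<Prod>j\<in>B. Var j) * Sch k u) \<alpha>)"
    proof (rule sum.mono_neutral_cong_left)
      show "\<forall>B\<in>Pow {1..k} - Pow (Poly_Mapping.keys \<alpha>). Poly_Mapping.lookup ((\<Prod>j\<in>B. Var j) * Sch k u) \<alpha> = 0"
      proof
        fix B assume B: "B \<in> Pow {1..k} - Pow (Poly_Mapping.keys \<alpha>)"
        then have "finite B" using finite_subset by blast
        then show "Poly_Mapping.lookup ((\<Prod>j\<in>B. Var j) * Sch k u) \<alpha> = 0"
          using B by (simp add: lookup_prod_Var_mult)
      qed
    next
      fix B assume "B \<in> Pow (Poly_Mapping.keys \<alpha>)"
      then have B: "B \<subseteq> Poly_Mapping.keys \<alpha>" by simp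
      then have "finite B" by (rule finite_subset) simp
      then show "Poly_Mapping.lookup (Sch k u) (\<alpha> - bsum B) = Poly_Mapping.lookup ((\<Prod>j\<in>B. Var j) * Sch k u) \<alpha>"
        using B by (simp add: lookup_prod_Var_mult)
    qed (use True in auto)
    also have "\<dots> = Poly_Mapping.lookup ((\<Prod>i\<in>{1..k}. 1 + Var i) * Sch k u) \<alpha>"
      using prod_add[of "{1..k}" Var "\<lambda>_. 1"]
      by (simp add: add.commute sum_distrib_right lookup_sum)
    also have "\<dots> = (\<Sum>G\<in>lifts k u. Poly_Mapping.lookup (Sch (Suc k) (lift k u G)) \<alpha>)"
      by (simp only: Sch_pieri[OF u] lookup_sum)
    finally have le: "(\<Sum>G\<in>lifts k u. int (wdim {1..Suc k} (cols (lift k u G)) \<alpha>)) \<le>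
        (\<Sum>G\<in>lifts k u. Poly_Mapping.lookup (Sch (Suc k) (lift k u G)) \<alpha>)" by simp
    moreover have "(\<Sum>G\<in>lifts k u. Poly_Mapping.lookup (Sch (Suc k) (lift k u G)) \<alpha>) \<le>
        (\<Sum>G\<in>lifts k u. int (wdim {1..Suc k} (cols (lift k u G)) \<alpha>))"
      by (intro sum_mono ge lp)
    ultimately have "Poly_Mapping.lookup (Sch (Suc k) (lift k u G)) \<alpha> = int (wdim {1..Suc k} (cols (lift k u G)) \<alpha>)"
      using ge[OF lp] G(1) finite_lifts
      by (intro sum_mono_inv[of "\<lambda>G. Poly_Mapping.lookup (Sch (Suc k) (lift k u G)) \<alpha>" "lifts k u"
            "\<lambda>G. int (wdim {1..Suc k} (cols (lift k u G)) \<alpha>)" G] antisym) auto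
    then show ?thesis by (simp only: G(2))
  qed
qed

lemma lookup_Sch_nonneg:
  assumes "w permutes {1..n}"
  shows "0 \<le> Poly_Mapping.lookup (Sch n w) \<alpha>"
proof (cases "Poly_Mapping.lookup (Sch n w) \<alpha> = 0")
  case False
  then have "Poly_Mapping.keys \<alpha> \<subseteq> {1..<n}" by (rule lookup_Sch_outside)
  then have "0 \<notin> Poly_Mapping.keys \<alpha>" by auto
  then show ?thesis using Sch_eq_wdim[OF assms] by simp
qed simp

section \<open>Deleting an entry of a permutation\<close>

lemma wdim_mset_le:
  assumes "finite Q" "\<And>q. q \<in> Q \<Longrightarrow> mset (D q) = mset (D' q)"
  shows "wdim Q D \<alpha> \<le> wdim Q D' \<alpha>"
proof -
  obtain J where J: "J \<subseteq> fillings Q \<alpha>" "finite J" "indep J (minors Q D)" "card J = wdim Q D \<alpha>"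
    by (rule wdim_basis[OF assms(1), where D = D and \<alpha> = \<alpha>])
  obtain s where s: "\<And>y. s y \<noteq> 0" "\<And>C y. (\<And>q. q \<in> Q \<Longrightarrow> finite (C q)) \<Longrightarrow> minors Q D' C y = s y * minors Q D C y"
    using minors_perm[OF assms(1), of D' D] assms(2) by metis
  have "indep J (minors Q D')"
  proof (rule indep_scale[OF J(3) s(1)])
    fix C y assume "C \<in> J"
    then have "finite (C q)" for q using finite_filling[OF _ assms(1)] J(1) by blast
    then show "minors Q D' C y = s y * minors Q D C y" by (rule s(2))
  qed
  then show ?thesis using wdim_ge[OF assms(1) J(1)] J(4) by simp
qed

section \<open>Exponents under the relabelling of variables\<close>

definition spread :: "nat \<Rightarrow> (nat \<Rightarrow>\<^sub>0 nat) \<Rightarrow> (nat \<Rightarrow>\<^sub>0 nat)" where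
  "spread k m = (\<Sum>j\<in>Poly_Mapping.keys m. Poly_Mapping.single (skip k j) (Poly_Mapping.lookup m j))"

lemma lookup_spread [simp]: "Poly_Mapping.lookup (spread k m) (skip k l) = Poly_Mapping.lookup m l"
  "Poly_Mapping.lookup (spread k m) k = 0"
proof -
  have "Poly_Mapping.lookup (spread k m) (skip k l) = (\<Sum>j\<in>Poly_Mapping.keys m. Poly_Mapping.lookup m j when j = l)"
    by (simp add: spread_def lookup_sum lookup_single)
  also have "\<dots> = Poly_Mapping.lookup m l"
    by (cases "l \<in> Poly_Mapping.keys m") (auto simp: when_def in_keys_iff)
  finally show "Poly_Mapping.lookup (spread k m) (skip k l) = Poly_Mapping.lookup m l" .
  show "Poly_Mapping.lookup (spread k m) k = 0"
    by (simp add: spread_def lookup_sum lookup_single)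
qed

lemma spread_inj: "spread k m = spread k m' \<Longrightarrow> m = m'"
  by (rule poly_mapping_eqI) (metis lookup_spread(1))

lemma mon_skip: "mon (\<lambda>j. Var (skip k j)) m = Poly_Mapping.single (spread k m) 1"
proof -
  have "(\<Prod>j\<in>K. Poly_Mapping.single (f j) (1::int)) = Poly_Mapping.single (\<Sum>j\<in>K. f j) 1"
    for f :: "nat \<Rightarrow> nat \<Rightarrow>\<^sub>0 nat" and K
    by (induction K rule: infinite_finite_induct) (auto simp: mult_single)
  then show ?thesis by (simp add: mon_def Var_power spread_def)
qed

lemma lookup_mult_psubst_skip:
  "Poly_Mapping.lookup (Poly_Mapping.single \<mu> 1 * psubst (\<lambda>j. Var (skip k j)) p) (\<mu> + spread k m) =
     Poly_Mapping.lookup p m"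
  "(\<And>m. \<beta> \<noteq> \<mu> + spread k m) \<Longrightarrow>
     Poly_Mapping.lookup (Poly_Mapping.single \<mu> 1 * psubst (\<lambda>j. Var (skip k j)) p) \<beta> = 0"
proof -
  have p: "psubst (\<lambda>j. Var (skip k j)) p =
      (\<Sum>m\<in>Poly_Mapping.keys p. Poly_Mapping.single (spread k m) (Poly_Mapping.lookup p m))"
    by (simp add: psubst_def mon_def[symmetric] mon_skip mult_single)
  have "Poly_Mapping.lookup (psubst (\<lambda>j. Var (skip k j)) p) (spread k m) =
      (\<Sum>m'\<in>Poly_Mapping.keys p. Poly_Mapping.lookup p m' when m' = m)"
    unfolding p lookup_sum
    by (intro sum.cong refl) (auto simp: lookup_single when_def dest: spread_inj)
  also have "\<dots> = Poly_Mapping.lookup p m"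
    by (cases "m \<in> Poly_Mapping.keys p") (auto simp: when_def in_keys_iff)
  finally show "Poly_Mapping.lookup (Poly_Mapping.single \<mu> 1 * psubst (\<lambda>j. Var (skip k j)) p) (\<mu> + spread k m) =
     Poly_Mapping.lookup p m" by (simp only: lookup_monomial_mult(1))
  assume no: "\<And>m. \<beta> \<noteq> \<mu> + spread k m"
  show "Poly_Mapping.lookup (Poly_Mapping.single \<mu> 1 * psubst (\<lambda>j. Var (skip k j)) p) \<beta> = 0"
  proof (cases "\<exists>\<gamma>. \<beta> = \<mu> + \<gamma>")
    case True
    then obtain \<gamma> where \<gamma>: "\<beta> = \<mu> + \<gamma>" by blast
    then have "\<gamma> \<noteq> spread k m" for m using no by auto
    then have "Poly_Mapping.lookup (psubst (\<lambda>j. Var (skip k j)) p) \<gamma> = 0"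
      unfolding p lookup_sum by (intro sum.neutral) (auto simp: lookup_single when_def)
    then show ?thesis unfolding \<gamma> by (simp only: lookup_monomial_mult(1))
  next
    case False
    then show ?thesis by (intro lookup_monomial_mult(2)) blast
  qed
qed

context
  fixes n k :: nat and w :: "nat \<Rightarrow> nat"
  assumes w: "w permutes {1..n}" and k: "k \<in> {1..n}"
begin

lemma w_zero: "w 0 = 0"
  by (rule permutes_not_in[OF w]) simp

text \<open>As diagram columns are indexed by positions, removing row \<open>k\<close> and column
  \<open>w k\<close> removes the same index \<open>k\<close> from rows and columns; apart from a
  possible box in row \<open>k\<close>, the column is only relabelled.\<close>

lemma cols_pattern_del:
  assumes q: "q \<in> {1..n - 1}"
  shows "mset (cols w (skip k q)) =
    mset ((if k \<in> set (cols w (skip k q)) then [k] else []) @ map (skip k) (cols (pattern_del n w k) q))"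
proof (rule set_eq_iff_mset_eq_distinct[THEN iffD1])
  let ?\<sigma> = "pattern_del n w k"
  show "distinct (cols w (skip k q))" by (simp add: cols_def)
  show "distinct ((if k \<in> set (cols w (skip k q)) then [k] else []) @ map (skip k) (cols ?\<sigma> q))"
    using inj_skip by (auto simp: distinct_map cols_def)
  have iff: "w (skip k q) < w (skip k b) \<longleftrightarrow> ?\<sigma> q < ?\<sigma> b" if "b < q" for b
  proof (cases "b = 0")
    case True
    then show ?thesis using k w_zero by (auto simp: skip_def pattern_del_def)
  next
    case False
    then show ?thesis using pattern_del_less[OF w k q, of b] that q by auto
  qed
  show "set (cols w (skip k q)) = set ((if k \<in> set (cols w (skip k q)) then [k] else []) @ map (skip k) (cols ?\<sigma> q))"
  proof (intro set_eqI)
    fix a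
    show "a \<in> set (cols w (skip k q)) \<longleftrightarrow>
      a \<in> set ((if k \<in> set (cols w (skip k q)) then [k] else []) @ map (skip k) (cols ?\<sigma> q))"
    proof (cases "a = k")
      case True
      then show ?thesis by auto
    next
      case False
      then obtain b where b: "a = skip k b" by (rule skip_surj)
      have "a \<in> set (cols w (skip k q)) \<longleftrightarrow> b \<in> set (cols ?\<sigma> q)"
        using iff[of b] by (auto simp: set_cols b)
      then show ?thesis using False by (auto simp: b)
    qed
  qed
qed

lemma rothe_column: "{i. (i, w k) \<in> rothe n w} = set (cols w k)"
proof -
  have "inv w (w k) = k" using permutes_inverses[OF w] by simp
  moreover have "w k \<in> {1..n}" using permutes_in_image[OF w] k by blast
  moreover have "i \<in> {1..n}" if "i < k" "w k < w i" for i
    using that k w_zero by (cases "i = 0") auto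
  ultimately show ?thesis by (auto simp: rothe_def set_cols)
qed

text \<open>The boxes of row \<open>k\<close> are counted by the columns that contain them, which is
  the form of the exponent in \<open>wdim_delete\<close>.\<close>

lemma card_rothe_row: "card {i. (k, i) \<in> rothe n w} = card {q \<in> {1..n - 1}. k \<in> set (cols w (skip k q))}"
proof -
  have inv: "inv w (w a) = a" "w (inv w a) = a" for a using permutes_inverses[OF w] by auto
  have "bij_betw (\<lambda>q. w (skip k q)) {q \<in> {1..n - 1}. k \<in> set (cols w (skip k q))} {i. (k, i) \<in> rothe n w}"
    unfolding bij_betw_def
  proof
    show "inj_on (\<lambda>q. w (skip k q)) {q \<in> {1..n - 1}. k \<in> set (cols w (skip k q))}"
      using inj_eq[OF permutes_inj[OF w]] by (auto simp: inj_on_def)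
    show "(\<lambda>q. w (skip k q)) ` {q \<in> {1..n - 1}. k \<in> set (cols w (skip k q))} = {i. (k, i) \<in> rothe n w}"
    proof (intro equalityI subsetI)
      fix i assume "i \<in> (\<lambda>q. w (skip k q)) ` {q \<in> {1..n - 1}. k \<in> set (cols w (skip k q))}"
      then obtain q where q: "i = w (skip k q)" "q \<in> {1..n - 1}" "k < skip k q" "w (skip k q) < w k"
        by (auto simp: set_cols)
      have "i \<in> {1..n}" using q(1,2) skip_mem[OF k] permutes_in_image[OF w] by blast
      then show "i \<in> {i. (k, i) \<in> rothe n w}" using q k by (simp add: rothe_def inv)
    next
      fix i assume "i \<in> {i. (k, i) \<in> rothe n w}"
      then have i: "i \<in> {1..n}" "k < inv w i" "i < w k" by (auto simp: rothe_def)
      then obtain q where q: "inv w i = skip k q" using skip_surj[of "inv w i" k] by auto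
      have "inv w i \<in> {1..n}" using i(1) permutes_in_image[OF permutes_inv[OF w]] by blast
      then have "q \<in> {1..n - 1}" using q skip_mem[OF k] by simp
      moreover have "w (skip k q) = i" using q inv(2) by metis
      ultimately show "i \<in> (\<lambda>q. w (skip k q)) ` {q \<in> {1..n - 1}. k \<in> set (cols w (skip k q))}"
        using i q by (auto simp: set_cols image_iff)
    qed
  qed
  then show ?thesis by (simp add: bij_betw_same_card)
qed

definition rothe_exponent :: "nat \<Rightarrow>\<^sub>0 nat" where
  "rothe_exponent = Poly_Mapping.single k (card {i. (k, i) \<in> rothe n w}) + bsum (set (cols w k))"

lemma prod_rothe:
  "(\<Prod>i\<in>{i. (k, i) \<in> rothe n w}. Var k) * (\<Prod>i\<in>{i. (i, w k) \<in> rothe n w}. Var i) = Poly_Mapping.single rothe_exponent 1"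
  unfolding rothe_column by (simp add: Var_power prod_Var_bsum mult_single rothe_exponent_def)

lemma wdim_pattern_del_le:
  "wdim {1..n - 1} (cols (pattern_del n w k)) \<alpha> \<le> wdim {1..n} (cols w) (rothe_exponent + spread k \<alpha>)"
proof -
  define S where "S q = set (cols w (skip k q))" for q
  \<comment> \<open>The columns of \<open>w\<close> with a possible box \<open>k\<close> put in
    front, the order that \<open>wdim_delete\<close> expects.\<close>
  define D where "D q = (if q = k then cols w k
      else let q' = (THE q'. q = skip k q') in (if k \<in> S q' then [k] else []) @ map (skip k) (cols (pattern_del n w k) q'))" for q
  have D: "D (skip k q) = (if k \<in> S q then [k] else []) @ map (skip k) (cols (pattern_del n w k) q)" for q
    by (simp add: D_def)
  have Q: "{1..n} = insert k (skip k ` {1..n - 1})"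
  proof (intro equalityI subsetI)
    fix q assume q: "q \<in> {1..n}"
    show "q \<in> insert k (skip k ` {1..n - 1})"
    proof (cases "q = k")
      case False
      then obtain q' where "q = skip k q'" by (rule skip_surj)
      then show ?thesis using q skip_mem[OF k] by blast
    qed simp
  qed (use k skip_mem[OF k] in blast)
  have kk: "k \<notin> set (cols w k)" by (simp add: set_cols)
  have "wdim {1..n - 1} (cols (pattern_del n w k)) \<alpha> \<le> wdim {1..n} D (rothe_exponent + spread k \<alpha>)"
  proof (rule wdim_delete[where S = S and k = k, OF _ Q])
    show "D (skip k q) = (if k \<in> S q then [k] else []) @ map (skip k) (cols (pattern_del n w k) q)" for q
      by (rule D)
    show "sorted_wrt (<) (D k)" by (simp add: D_def cols_def strict_sorted_iff)
    show "k \<notin> set (D k)" using kk by (simp add: D_def)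
    show "Poly_Mapping.lookup (rothe_exponent + spread k \<alpha>) (skip k l) =
        Poly_Mapping.lookup \<alpha> l + (if skip k l \<in> set (D k) then 1 else 0)" for l
      by (simp add: rothe_exponent_def lookup_add lookup_single lookup_bsum D_def)
    show "Poly_Mapping.lookup (rothe_exponent + spread k \<alpha>) k = card {q \<in> {1..n - 1}. k \<in> S q}"
      using kk card_rothe_row by (simp add: rothe_exponent_def lookup_add lookup_bsum S_def)
  qed simp
  also have "\<dots> \<le> wdim {1..n} (cols w) (rothe_exponent + spread k \<alpha>)"
  proof (rule wdim_mset_le)
    fix q assume "q \<in> {1..n}"
    show "mset (D q) = mset (cols w q)"
    proof (cases "q = k")
      case False
      then obtain q' where q': "q = skip k q'" by (rule skip_surj)
      then have "q' \<in> {1..n - 1}" using \<open>q \<in> {1..n}\<close> skip_mem[OF k] by blast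
      then show ?thesis unfolding q' D S_def by (rule cols_pattern_del[symmetric])
    qed (simp add: D_def)
  qed simp
  finally show ?thesis .
qed

lemma lookup_Sch_pattern_del_le:
  "Poly_Mapping.lookup (Sch (n - 1) (pattern_del n w k)) \<alpha> \<le> Poly_Mapping.lookup (Sch n w) (rothe_exponent + spread k \<alpha>)"
proof (cases "Poly_Mapping.lookup (Sch (n - 1) (pattern_del n w k)) \<alpha> = 0")
  case True
  then show ?thesis using lookup_Sch_nonneg[OF w] by simp
next
  case False
  then have \<alpha>: "0 \<notin> Poly_Mapping.keys \<alpha>" using lookup_Sch_outside by fastforce
  have "skip k 0 = 0" using k by (simp add: skip_def)
  then have "Poly_Mapping.lookup (spread k \<alpha>) 0 = 0" using \<alpha> lookup_spread(1)[of k \<alpha> 0] by (simp add: in_keys_iff)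
  moreover have "0 \<notin> set (cols w k)" using w_zero by (simp add: set_cols)
  ultimately have "0 \<notin> Poly_Mapping.keys (rothe_exponent + spread k \<alpha>)"
    using k by (simp add: in_keys_iff rothe_exponent_def lookup_add lookup_single lookup_bsum)
  then show ?thesis
    using Sch_eq_wdim[OF w] Sch_eq_wdim[OF pattern_del_permutes[OF w k] \<alpha>] wdim_pattern_del_le by simp
qed

end

theorem theorem1p2:
  fixes n k :: nat and w :: "nat \<Rightarrow> nat"
  assumes "w permutes {1..n}"
    and "k \<in> {1..n}"
  shows "\<exists>F :: mpoly. (\<forall>m. Poly_Mapping.lookup F m \<ge> 0) \<and>
           schubert n w =
             ((\<Prod>i\<in>{i. (k, i) \<in> rothe n w}. Var k) *
              (\<Prod>i\<in>{i. (i, w k) \<in> rothe n w}. Var i))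
             * psubst (\<lambda>j. Var (skip k j)) (schubert (n - 1) (pattern_del n w k))
             + F"
proof -
  define P where "P = Poly_Mapping.single (rothe_exponent n k w) 1 * psubst (\<lambda>j. Var (skip k j)) (Sch (n - 1) (pattern_del n w k))"
  \<comment> \<open>\<open>F\<close> is the difference. Relabelling the variables and multiplying by
    a monomial is injective on exponents, so each coefficient of \<open>P\<close> is a single
    coefficient for the pattern or zero.\<close>
  have "0 \<le> Poly_Mapping.lookup (Sch n w - P) \<beta>" for \<beta>
  proof (cases "\<exists>m. \<beta> = rothe_exponent n k w + spread k m")
    case True
    then obtain m where \<beta>: "\<beta> = rothe_exponent n k w + spread k m" by blast
    show ?thesis
      unfolding \<beta> lookup_minus P_def lookup_mult_psubst_skip(1)
      using lookup_Sch_pattern_del_le[OF assms, of m] by simp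
  next
    case False
    then have "Poly_Mapping.lookup P \<beta> = 0" unfolding P_def by (intro lookup_mult_psubst_skip(2)) blast
    then show ?thesis using lookup_Sch_nonneg[OF assms(1)] by (simp add: lookup_minus)
  qed
  then show ?thesis
    unfolding schubert_eq_Sch[OF assms(1)] schubert_eq_Sch[OF pattern_del_permutes[OF assms]]
      prod_rothe[OF assms] P_def[symmetric]
    by (intro exI[of _ "Sch n w - P"]) simp
qed

end
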